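(* Let $p\ge 2$, let $\varphi\in C^3(\overline\Omega)$, let $\varepsilon_n>0$ be sufficiently small, and let $x_i\in\Omega_n$ satisfy $\operatorname{dist}(x_i,\mathcal{O}\cup\partial\Omega)>(k+1)\varepsilon_n$. If $\nabla\varphi(x_i)\neq0$, then $$|L^{H_n}_{p,\varepsilon_n}\varphi(x_i)-L_p\varphi(x_i)|\le C\varepsilon_n+\frac{C\|Id-T_n\|_{L^\infty(\Omega)}}{\varepsilon_n^2},$$ where the constant $C$ depends only on $\|\varphi\|_{C^3(\overline\Omega)}$ (and the fixed data $d,\Omega,\rho,\eta,p$). Here the smallness threshold for $\varepsilon_n$ may depend on $\varphi$ and on $|\nabla\varphi(x_i)|$.
   Context: Setting. $\Omega\subset\mathbb{R}^d$ ($d\ge2$) is a bounded, connected, open domain with $C^1$ boundary. $N\ge1$ is fixed, $\mathcal{O}=\{x_1,\dots,x_N\}\subset\Omega$ is a fixed finite set (away from $\partial\Omega$). The points $x_{N+1},x_{N+2},\dots$ are i.i.d. samples of a probability measure $\mu$ on $\Omega$ with Lebesgue density $\rho\in C^2(\overline\Omega)$, $\rho>0$ on $\overline\Omega$. For $n>N$, $\Omega_n=\{x_i\}_{i=1}^n$ and $\mu_n=\frac1n\sum_{i=1}^n\delta_{x_i}$. Let $$\delta_n=\frac{(\ln n)^{3/4}}{\sqrt n}\ \text{ if } d=2,\qquad \delta_n=\frac{(\ln n)^{1/d}}{n^{1/d}}\ \text{ if } d\ge3.$$ The problem is considered deterministically for a realization of the samples for which there are transportation maps $T_n:\Omega\to\Omega_n$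 with $T_{n\sharp}\mu=\mu_n$ and $c\le\liminf_n\|Id-T_n\|_{L^\infty(\Omega)}/\delta_n\le\limsup_n\|Id-T_n\|_{L^\infty(\Omega)}/\delta_n\le C'$ for some constants $c,C'>0$ (this holds almost surely). It is always assumed that $\varepsilon_n\to0$ and $\sqrt{\delta_n}/\varepsilon_n\to0$, so that $\|Id-T_n\|_{L^\infty(\Omega)}/\varepsilon_n^2\to0$. Kernel. $\eta:[0,\infty)\to[0,\infty)$ is nonincreasing and Lipschitz with $\eta(0)\le2$, $\eta(1)\ge1$; $\eta_{\varepsilon}(s)=\varepsilon^{-d}\eta(s/\varepsilon)$ and $\eta^\chi_{\varepsilon}(s)=\chi_{\{|s|<\varepsilon\}}\eta_\varepsilon(s)$. Put $$\sigma_{\eta,1}=\tfrac12\int_{B(0,1)}\eta(|y|)|y_1|^2dy,\quad \sigma_{\eta,2}=\tfrac12\int_{B(0,1)}\eta(|y|)dy,\quad k=k(p)=\sqrt{\frac{(p-2)\sigma_{\eta,1}}{\sigma_{\eta,2}}} .$$ Discrete operator (applied to the restriction of $\varphi$ to $\Omega_n$). For $w:\Omega_n\to\mathbb{R}$ and $r\ge0$, $M^rw(x_i)=\max_{x_j\in\overline B(x_i,r)\cap\Omega_n}w(x_j)$ and $M_rw(x_i)=\min_{x_j\in\overline B(x_i,r)\cap\Omega_n}w(x_j)$, and $$L^{H_n}_{p,\varepsilon_n}w(x_i)=\frac1{2n\varepsilon_n^2}\sum_{j=1}^n\eta^\chi_{\varepsilon_n}(|x_i-x_j|)\bigl(M^{k\varepsilon_n}w(x_j)+M_{k\varepsilon_n}w(x_j)-2w(x_i)\bigr).$$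 Continuum operator. At points where $\nabla\varphi\ne0$, $$L_p\varphi=\sigma_{\eta,1}\,\frac1\rho\operatorname{div}(\rho^2\nabla\varphi)+k^2\sigma_{\eta,2}\,\rho\,\frac{1}{|\nabla\varphi|^2}\sum_{i,j}\varphi_{x_ix_j}\varphi_{x_i}\varphi_{x_j}=\frac{\sigma_{\eta,1}}{\rho}|\nabla\varphi|^{2-p}\operatorname{div}(\rho^2|\nabla\varphi|^{p-2}\nabla\varphi).$$ *)

theory Defs
  imports "HOL-Analysis.Analysis" "HOL-Probability.Probability"
begin

section \<open>Classical derivatives and function spaces\<close>

definition partial :: "'n::finite \<Rightarrow> (real^'n \<Rightarrow> real) \<Rightarrow> real^'n \<Rightarrow> real" where
  "partial i f x = frechet_derivative f (at x) (axis i 1)"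

definition grad :: "(real^'n::finite \<Rightarrow> real) \<Rightarrow> real^'n \<Rightarrow> real^'n" where
  "grad f x = (\<chi> i. partial i f x)"

definition divergence :: "(real^'n::finite \<Rightarrow> real^'n) \<Rightarrow> real^'n \<Rightarrow> real" where
  "divergence F x = (\<Sum>i\<in>UNIV. partial i (\<lambda>y. F y $ i) x)"

text \<open>The list \<open>is\<close> of coordinates plays the role of a multi-index, of order \<open>length is\<close>.\<close>

definition iter_partial :: "'n::finite list \<Rightarrow> (real^'n \<Rightarrow> real) \<Rightarrow> real^'n \<Rightarrow> real" where
  "iter_partial is f = foldr partial is f"

text \<open>Functions of class \<open>C^m\<close> up to the boundary of an open set \<open>\<Omega>\<close>: all partial derivatives
  of order at most \<open>m\<close> exist in \<open>\<Omega>\<close> and extend continuously to \<open>closure \<Omega>\<close>; the extension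
  of \<open>f\<close> itself is \<open>f\<close>. Nothing is required of \<open>f\<close> outside \<open>closure \<Omega>\<close>.\<close>

definition Ck_closure :: "nat \<Rightarrow> (real^'n::finite) set \<Rightarrow> (real^'n \<Rightarrow> real) \<Rightarrow> bool" where
  "Ck_closure m \<Omega> f \<longleftrightarrow>
     continuous_on (closure \<Omega>) f \<and>
     (\<forall>is. length is < m \<longrightarrow> (\<forall>x\<in>\<Omega>. iter_partial is f differentiable (at x))) \<and>
     (\<forall>is. length is \<le> m \<longrightarrow>
        (\<exists>g. continuous_on (closure \<Omega>) g \<and> (\<forall>x\<in>\<Omega>. g x = iter_partial is f x)))"

definition Ck_norm :: "nat \<Rightarrow> (real^'n::finite) set \<Rightarrow> (real^'n \<Rightarrow> real) \<Rightarrow> real" where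
  "Ck_norm m \<Omega> f = Sup {\<bar>iter_partial is f x\<bar> | is x. length is \<le> m \<and> x \<in> \<Omega>}"

text \<open>Near each boundary point, after a rotation of the axes taking the last one to the unit
  vector \<open>\<nu>\<close>, the set is the region above the graph of a \<open>C^1\<close> function on the hyperplane
  orthogonal to \<open>\<nu>\<close>. A \<open>C^1\<close> function on that hyperplane is the restriction of a \<open>C^1\<close>
  function \<open>\<gamma>\<close> on the whole space (compose with the orthogonal projection).\<close>

definition C1_boundary :: "(real^'n::finite) set \<Rightarrow> bool" where
  "C1_boundary \<Omega> \<longleftrightarrow>
     (\<forall>z\<in>frontier \<Omega>. \<exists>r>0. \<exists>\<nu> \<gamma> D. norm \<nu> = 1 \<and>
        (\<forall>y. ((\<gamma> :: real^'n \<Rightarrow> real) has_derivative (\<lambda>h. D y \<bullet> h)) (at y)) \<and>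
        continuous_on UNIV D \<and>
        \<Omega> \<inter> ball z r = {y \<in> ball z r. y \<bullet> \<nu> > \<gamma> (y - (y \<bullet> \<nu>) *\<^sub>R \<nu>)})"

section \<open>Measures and transportation maps\<close>

definition density_measure :: "(real^'n::finite) set \<Rightarrow> (real^'n \<Rightarrow> real) \<Rightarrow> (real^'n) measure" where
  "density_measure \<Omega> \<rho> = density (restrict_space lborel \<Omega>) (\<lambda>y. ennreal (\<rho> y))"

definition empirical_measure :: "(nat \<Rightarrow> real^'n::finite) \<Rightarrow> nat \<Rightarrow> (real^'n) measure" where
  "empirical_measure x n = distr (uniform_count_measure {1..n}) borel x"

text \<open>This is indeed the average of the Dirac masses at \<open>x 1, \<dots>, x n\<close>:\<close>

lemma measure_empirical_measure:
  assumes "n \<ge> 1" "A \<in> sets borel"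
  shows "measure (empirical_measure x n) A = (1 / n) * (\<Sum>i=1..n. indicator A (x i))"
proof -
  have m: "x \<in> measurable (uniform_count_measure {1..n}) borel"
    by (auto simp: measurable_def space_uniform_count_measure sets_uniform_count_measure)
  have "measure (empirical_measure x n) A
      = measure (uniform_count_measure {1..n}) (x -` A \<inter> {1..n})"
    unfolding empirical_measure_def using m assms
    by (subst measure_distr) (auto simp: space_uniform_count_measure)
  also have "\<dots> = card (x -` A \<inter> {1..n}) / n"
    using assms by (subst measure_uniform_count_measure) auto
  also have "real (card (x -` A \<inter> {1..n})) = (\<Sum>i=1..n. indicator A (x i))"
    by (simp add: indicator_def sum.If_cases vimage_def Int_commute)
  finally show ?thesis
    by simp
qed

definition Linf_dist_id :: "(real^'n::finite) set \<Rightarrow> (real^'n \<Rightarrow> real^'n) \<Rightarrow> real" where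
  "Linf_dist_id \<Omega> T =
     real_of_ereal (esssup (restrict_space lborel \<Omega>) (\<lambda>y. ereal (norm (y - T y))))"

definition transport_rate :: "nat \<Rightarrow> nat \<Rightarrow> real" where
  "transport_rate d n =
     (if d = 2 then ln (real n) powr (3/4) / sqrt (real n)
      else ln (real n) powr (1 / real d) / real n powr (1 / real d))"

definition transported_samples ::
  "(real^'n::finite) set \<Rightarrow> (real^'n \<Rightarrow> real) \<Rightarrow> nat \<Rightarrow> (nat \<Rightarrow> real^'n)
     \<Rightarrow> (nat \<Rightarrow> real^'n \<Rightarrow> real^'n) \<Rightarrow> bool" where
  "transported_samples \<Omega> \<rho> N x T \<longleftrightarrow>
     (\<forall>i\<ge>1. x i \<in> \<Omega>) \<and>
     (\<forall>n>N. T n ` \<Omega> \<subseteq> x ` {1..n} \<and>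
            T n \<in> measurable (density_measure \<Omega> \<rho>) borel \<and>
            distr (density_measure \<Omega> \<rho>) borel (T n) = empirical_measure x n) \<and>
     (\<exists>c>0. \<exists>c'>0.
        ereal c \<le> liminf (\<lambda>n. ereal (Linf_dist_id \<Omega> (T n) / transport_rate CARD('n) n)) \<and>
        limsup (\<lambda>n. ereal (Linf_dist_id \<Omega> (T n) / transport_rate CARD('n) n)) \<le> ereal c')"

section \<open>Kernel and constants\<close>

definition admissible_kernel :: "(real \<Rightarrow> real) \<Rightarrow> bool" where
  "admissible_kernel \<eta> \<longleftrightarrow>
     (\<forall>s\<ge>0. \<eta> s \<ge> 0) \<and>
     (\<forall>s t. 0 \<le> s \<longrightarrow> s \<le> t \<longrightarrow> \<eta> t \<le> \<eta> s) \<and>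
     (\<exists>L. L-lipschitz_on {0..} \<eta>) \<and>
     \<eta> 0 \<le> 2 \<and> \<eta> 1 \<ge> 1"

definition cut_kernel :: "nat \<Rightarrow> (real \<Rightarrow> real) \<Rightarrow> real \<Rightarrow> real \<Rightarrow> real" where
  "cut_kernel d \<eta> \<epsilon> s = (if \<bar>s\<bar> < \<epsilon> then \<eta> (s / \<epsilon>) / \<epsilon> ^ d else 0)"

text \<open>The index type carries no distinguished first element, so the coordinate called \<open>y\<^sub>1\<close>
  is the parameter \<open>i1\<close>; by symmetry the value does not depend on it.\<close>

definition sigma1 :: "'n::finite \<Rightarrow> (real \<Rightarrow> real) \<Rightarrow> real" where
  "sigma1 i1 \<eta> =
     1/2 * set_lebesgue_integral lborel (ball (0 :: real^'n) 1) (\<lambda>y. \<eta> (norm y) * \<bar>y $ i1\<bar>^2)"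

definition sigma2 :: "'n::finite itself \<Rightarrow> (real \<Rightarrow> real) \<Rightarrow> real" where
  "sigma2 _ \<eta> =
     1/2 * set_lebesgue_integral lborel (ball (0 :: real^'n) 1) (\<lambda>y. \<eta> (norm y))"

definition kappa :: "'n::finite \<Rightarrow> (real \<Rightarrow> real) \<Rightarrow> real \<Rightarrow> real" where
  "kappa i1 \<eta> p = sqrt ((p - 2) * sigma1 i1 \<eta> / sigma2 TYPE('n) \<eta>)"

section \<open>The two operators\<close>

definition ball_max :: "(nat \<Rightarrow> real^'n::finite) \<Rightarrow> nat \<Rightarrow> real \<Rightarrow> (real^'n \<Rightarrow> real) \<Rightarrow> real^'n \<Rightarrow> real" where
  "ball_max x n r w z = Max (w ` (cball z r \<inter> x ` {1..n}))"

definition ball_min :: "(nat \<Rightarrow> real^'n::finite) \<Rightarrow> nat \<Rightarrow> real \<Rightarrow> (real^'n \<Rightarrow> real) \<Rightarrow> real^'n \<Rightarrow> real" where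
  "ball_min x n r w z = Min (w ` (cball z r \<inter> x ` {1..n}))"

definition L_discrete ::
  "'n::finite \<Rightarrow> (real \<Rightarrow> real) \<Rightarrow> real \<Rightarrow> (nat \<Rightarrow> real^'n) \<Rightarrow> nat \<Rightarrow> real
     \<Rightarrow> (real^'n \<Rightarrow> real) \<Rightarrow> real^'n \<Rightarrow> real" where
  "L_discrete i1 \<eta> p x n \<epsilon> w z =
     1 / (2 * real n * \<epsilon>^2) *
     (\<Sum>j=1..n. cut_kernel CARD('n) \<eta> \<epsilon> (norm (z - x j)) *
        (ball_max x n (kappa i1 \<eta> p * \<epsilon>) w (x j) + ball_min x n (kappa i1 \<eta> p * \<epsilon>) w (x j)
         - 2 * w z))"

definition L_continuum ::
  "'n::finite \<Rightarrow> (real \<Rightarrow> real) \<Rightarrow> real \<Rightarrow> (real^'n \<Rightarrow> real) \<Rightarrow> (real^'n \<Rightarrow> real) \<Rightarrow> real^'n \<Rightarrow> real" where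
  "L_continuum i1 \<eta> p \<rho> \<phi> z =
     sigma1 i1 \<eta> * (1 / \<rho> z) * divergence (\<lambda>y. (\<rho> y)^2 *\<^sub>R grad \<phi> y) z
     + (kappa i1 \<eta> p)^2 * sigma2 TYPE('n) \<eta> * \<rho> z * (1 / (norm (grad \<phi> z))^2) *
       (\<Sum>i\<in>UNIV. \<Sum>j\<in>UNIV. partial i (partial j \<phi>) z * partial i \<phi> z * partial j \<phi> z)"

end

theory Submission
  imports Defs
begin

text \<open>Expand \<open>\<phi>\<close> at \<open>z\<close> to second order, \<open>\<phi> (z + w) - \<phi> z = Q w + O(\<bar>w\<bar>\<^sup>3)\<close> with
  \<open>Q w = g \<bullet> w + b w w / 2\<close>. If \<open>Max\<close> and \<open>Min\<close> denote the extrema of \<open>Q\<close> over the ball of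
  radius \<open>r = k \<epsilon>\<close> about \<open>w\<close>, reflecting an extremal point at the line spanned by \<open>g\<close> shows
  \<open>Max w + Min (- w) = b (w + r g / \<bar>g\<bar>) (w + r g / \<bar>g\<bar>)\<close> up to \<open>O(\<epsilon>\<^sup>4 / \<bar>g\<bar>\<^sup>2)\<close>. Averaging over the
  even kernel replaces \<open>Min (- w)\<close> by \<open>Min w\<close>, so that \<open>g\<close> enters the error only at fourth
  order, where the smallness of \<open>\<epsilon>\<close> absorbs \<open>\<bar>g\<bar>\<close>; the first order variation of the density
  meets \<open>Max w + Min w = 2 g \<bullet> w + O(\<epsilon>\<^sup>2)\<close>. The sum over the samples is compared with the integral
  by means of the transport map: the kernel jumps only on a shell of relative width
  \<open>\<delta> / \<epsilon>\<close>, on which the averaged quantity is \<open>O(\<epsilon>)\<close>.\<close>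

section \<open>Taylor expansion\<close>

text \<open>The obstacle is that the constant may see \<open>\<phi>\<close> only through its norm,
  while the extremal points of \<open>Q\<close> turn away from the direction of \<open>g\<close> by
  an angle of order \<epsilon>/|g|. At one fixed w this turning changes \<open>Max w + Min w\<close>
  by a term of size \<epsilon>^3/|g|: near the maximum the gradient of \<open>Q\<close> is perturbed
  by the form at w + r g/|g|, near the minimum by the form at w - r g/|g|, so the two effects do not
  balance. After division by the \<epsilon>^2 of the operator this leaves \<epsilon>/|g|, which no
  smallness of \<epsilon> brings below C \<epsilon>. Around w and -w the two perturbations are
  opposite, the tilts have the same size and the cubic terms cancel. What remains is
  \<epsilon>^2/|g|^2 after division, and this is at most \<epsilon> once \<epsilon> lies below a
  fixed multiple of |g|^2. That condition is the only place where the threshold depends on the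
  gradient.\<close>

lemma has_derivative_grad:
  fixes f :: "real^'n::finite \<Rightarrow> real"
  assumes "f differentiable (at x)"
  shows "(f has_derivative (\<lambda>h. grad f x \<bullet> h)) (at x)"
proof -
  let ?D = "frechet_derivative f (at x)"
  have D: "(f has_derivative ?D) (at x)"
    using assms frechet_derivative_works by blast
  then interpret linear ?D
    using has_derivative_linear by blast
  have "?D h = grad f x \<bullet> h" for h
  proof -
    have "?D h = ?D (\<Sum>i\<in>UNIV. h $ i *\<^sub>R axis i 1)"
      by (metis basis_expansion scalar_mult_eq_scaleR)
    also have "\<dots> = (\<Sum>i\<in>UNIV. h $ i * partial i f x)"
      by (simp add: sum scale partial_def)
    finally show ?thesis
      by (simp add: grad_def inner_vec_def mult.commute)
  qed
  then show ?thesis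
    using D by (metis (no_types, lifting) ext)
qed

lemma partial_eqI:
  "(f has_derivative f') (at x) \<Longrightarrow> partial i f x = f' (axis i 1)"
  by (simp add: partial_def frechet_derivative_at[symmetric])

text \<open>The derivative is again a combination of functions of \<open>z + t *\<^sub>R w\<close>,
  so the rule can be iterated to obtain the higher derivatives along the segment.\<close>

lemma has_real_derivative_along_segment:
  fixes f :: "real^'n::finite \<Rightarrow> real"
  assumes "f differentiable (at (z + t *\<^sub>R w))"
  shows "((\<lambda>t. f (z + t *\<^sub>R w)) has_real_derivative (\<Sum>i\<in>UNIV. w $ i * partial i f (z + t *\<^sub>R w))) (at t)"
proof -
  have "((\<lambda>t. f (z + t *\<^sub>R w)) has_derivative (\<lambda>s. grad f (z + t *\<^sub>R w) \<bullet> (s *\<^sub>R w))) (at t)"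
  proof (rule has_derivative_compose[where g = f])
    show "((\<lambda>t. z + t *\<^sub>R w) has_derivative (\<lambda>s. s *\<^sub>R w)) (at t)"
      by (auto intro!: derivative_eq_intros)
  qed (rule has_derivative_grad[OF assms])
  moreover have "(\<lambda>s. grad f (z + t *\<^sub>R w) \<bullet> (s *\<^sub>R w)) = (*) (\<Sum>i\<in>UNIV. w $ i * partial i f (z + t *\<^sub>R w))"
    by (auto simp: grad_def inner_vec_def sum_distrib_left sum_distrib_right mult_ac)
  ultimately show ?thesis
    by (simp add: has_field_derivative_def)
qed

lemma abs_sum_weighted_le:
  fixes w :: "real^'n::finite" and b :: real
  assumes "\<And>i. \<bar>c i\<bar> \<le> b"
  shows "\<bar>\<Sum>i\<in>UNIV. w $ i * c i\<bar> \<le> CARD('n) * b * norm w"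
proof -
  have "\<bar>\<Sum>i\<in>UNIV. w $ i * c i\<bar> \<le> (\<Sum>i\<in>(UNIV :: 'n set). norm w * b)"
    by (rule order_trans[OF sum_abs sum_mono])
       (auto simp: abs_mult intro!: mult_mono assms component_le_norm_cart)
  then show ?thesis by (simp add: mult_ac)
qed

text \<open>Maclaurin's formula on the segment from \<open>z\<close> to \<open>z + w\<close>. The
  factor \<open>CARD('n)^2\<close> counts the pairs of coordinates in the second derivative; the
  factorial is dropped. This version serves the density.\<close>

lemma Taylor_order_2:
  fixes f :: "real^'n::finite \<Rightarrow> real" and K :: real
  assumes seg: "\<And>t. 0 \<le> t \<Longrightarrow> t \<le> 1 \<Longrightarrow> z + t *\<^sub>R w \<in> \<Omega>"
    and diff: "\<And>is x. length is < 2 \<Longrightarrow> x \<in> \<Omega> \<Longrightarrow> iter_partial is f differentiable (at x)"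
    and bound: "\<And>is x. length is \<le> 2 \<Longrightarrow> x \<in> \<Omega> \<Longrightarrow> \<bar>iter_partial is f x\<bar> \<le> K"
  shows "\<bar>f (z + w) - f z - grad f z \<bullet> w\<bar> \<le> CARD('n)^2 * K * norm w ^ 2"
proof -
  let ?p = "\<lambda>t. z + t *\<^sub>R w"
  define df where "df m t = (if m = 0 then f (?p t)
      else if m = 1 then (\<Sum>i\<in>UNIV. w $ i * partial i f (?p t))
      else (\<Sum>i\<in>UNIV. w $ i * (\<Sum>j\<in>UNIV. w $ j * partial j (partial i f) (?p t))))" for m :: nat and t
  have d0: "f differentiable (at (?p t))" if "0 \<le> t" "t \<le> 1" for t
    using diff[of "[]"] seg that by (simp add: iter_partial_def)
  have d1: "partial i f differentiable (at (?p t))" if "0 \<le> t" "t \<le> 1" for t i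
    using diff[of "[i]"] seg that by (simp add: iter_partial_def)
  have "\<exists>t. 0 < t \<and> t < 1 \<and> df 0 1 = (\<Sum>m<2. (df m 0 / fact m) * 1 ^ m) + (df 2 t / fact 2) * 1 ^ 2"
  proof (rule Maclaurin)
    show "\<forall>m t. m < 2 \<and> 0 \<le> t \<and> t \<le> 1 \<longrightarrow> (df m has_real_derivative df (Suc m) t) (at t)"
    proof (intro allI impI)
      fix m :: nat and t :: real assume "m < 2 \<and> 0 \<le> t \<and> t \<le> 1"
      then show "(df m has_real_derivative df (Suc m) t) (at t)"
        by (cases "m = 0")
           (auto simp: df_def[abs_def] numeral_2_eq_2 less_Suc_eq intro!: DERIV_sum DERIV_cmult
              has_real_derivative_along_segment d0 d1)
    qed
  qed auto
  then obtain t where t: "0 < t" "t < 1"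
    and eq: "df 0 1 = (\<Sum>m<2. (df m 0 / fact m) * 1 ^ m) + (df 2 t / fact 2) * 1 ^ 2" by blast
  have "\<bar>df 2 t\<bar> \<le> CARD('n) * (CARD('n) * K * norm w) * norm w"
    unfolding df_def using bound[of "[_, _]"] seg t
    by (auto simp: iter_partial_def intro!: abs_sum_weighted_le)
  moreover have "df 1 0 = grad f z \<bullet> w"
    by (simp add: df_def grad_def inner_vec_def mult.commute)
  ultimately show ?thesis
    using eq by (simp add: eval_nat_numeral df_def mult_ac abs_if split: if_splits)
qed

text \<open>Same argument one order higher, for \<open>\<phi>\<close>. The second order part keeps
  the order of differentiation \<open>partial j (partial i f)\<close> produced by the iteration;
  \<open>hessian_form\<close> below is written to match it.\<close>

lemma Taylor_order_3:
  fixes f :: "real^'n::finite \<Rightarrow> real" and K :: real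
  assumes seg: "\<And>t. 0 \<le> t \<Longrightarrow> t \<le> 1 \<Longrightarrow> z + t *\<^sub>R w \<in> \<Omega>"
    and diff: "\<And>is x. length is < 3 \<Longrightarrow> x \<in> \<Omega> \<Longrightarrow> iter_partial is f differentiable (at x)"
    and bound: "\<And>is x. length is \<le> 3 \<Longrightarrow> x \<in> \<Omega> \<Longrightarrow> \<bar>iter_partial is f x\<bar> \<le> K"
  shows "\<bar>f (z + w) - f z - grad f z \<bullet> w - (\<Sum>i\<in>UNIV. w $ i * (\<Sum>j\<in>UNIV. w $ j * partial j (partial i f) z)) / 2\<bar>
    \<le> CARD('n)^3 * K * norm w ^ 3"
proof -
  let ?p = "\<lambda>t. z + t *\<^sub>R w"
  define df where "df m t = (if m = 0 then f (?p t)
      else if m = 1 then (\<Sum>i\<in>UNIV. w $ i * partial i f (?p t))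
      else if m = 2 then (\<Sum>i\<in>UNIV. w $ i * (\<Sum>j\<in>UNIV. w $ j * partial j (partial i f) (?p t)))
      else (\<Sum>i\<in>UNIV. w $ i * (\<Sum>j\<in>UNIV. w $ j * (\<Sum>k\<in>UNIV. w $ k * partial k (partial j (partial i f)) (?p t)))))"
    for m :: nat and t
  have d0: "f differentiable (at (?p t))" if "0 \<le> t" "t \<le> 1" for t
    using diff[of "[]"] seg that by (simp add: iter_partial_def)
  have d1: "partial i f differentiable (at (?p t))" if "0 \<le> t" "t \<le> 1" for t i
    using diff[of "[i]"] seg that by (simp add: iter_partial_def)
  have d2: "partial j (partial i f) differentiable (at (?p t))" if "0 \<le> t" "t \<le> 1" for t i j
    using diff[of "[j, i]"] seg that by (simp add: iter_partial_def)
  have "\<exists>t. 0 < t \<and> t < 1 \<and> df 0 1 = (\<Sum>m<3. (df m 0 / fact m) * 1 ^ m) + (df 3 t / fact 3) * 1 ^ 3"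
  proof (rule Maclaurin)
    show "\<forall>m t. m < 3 \<and> 0 \<le> t \<and> t \<le> 1 \<longrightarrow> (df m has_real_derivative df (Suc m) t) (at t)"
    proof (intro allI impI)
      fix m :: nat and t :: real assume "m < 3 \<and> 0 \<le> t \<and> t \<le> 1"
      then show "(df m has_real_derivative df (Suc m) t) (at t)"
        by (auto simp: df_def[abs_def] eval_nat_numeral less_Suc_eq intro!: DERIV_sum DERIV_cmult
              has_real_derivative_along_segment d0 d1 d2)
    qed
  qed auto
  then obtain t where t: "0 < t" "t < 1"
    and eq: "df 0 1 = (\<Sum>m<3. (df m 0 / fact m) * 1 ^ m) + (df 3 t / fact 3) * 1 ^ 3" by blast
  have b: "\<bar>df 3 t\<bar> \<le> CARD('n) * (CARD('n) * (CARD('n) * K * norm w) * norm w) * norm w"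
    unfolding df_def using bound[of "[_, _, _]"] seg t
    by (auto simp: iter_partial_def intro!: abs_sum_weighted_le)
  have "df 1 0 = grad f z \<bullet> w"
    by (simp add: df_def grad_def inner_vec_def mult.commute)
  then have "f (z + w) - f z - grad f z \<bullet> w - (\<Sum>i\<in>UNIV. w $ i * (\<Sum>j\<in>UNIV. w $ j * partial j (partial i f) z)) / 2 = df 3 t / 6"
    using eq by (simp add: eval_nat_numeral df_def)
  moreover have "\<bar>df 3 t / 6\<bar> \<le> \<bar>df 3 t\<bar>" by simp
  ultimately show ?thesis
    using b by (simp add: power3_eq_cube mult_ac)
qed

text \<open>A supremum of reals bounds its members only if the set is bounded above. Each derivative
  is bounded because it extends continuously to the compact closure, and only finitely many lists
  have length at most \<open>m\<close>, so the sum of the individual bounds is a common one.\<close>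

lemma abs_iter_partial_le_Ck_norm:
  fixes f :: "real^'n::finite \<Rightarrow> real"
  assumes f: "Ck_closure m \<Omega> f" and "bounded \<Omega>" and "length is \<le> m" "x \<in> \<Omega>"
  shows "\<bar>iter_partial is f x\<bar> \<le> Ck_norm m \<Omega> f"
proof -
  have "\<exists>b. \<forall>x\<in>\<Omega>. \<bar>iter_partial js f x\<bar> \<le> b" if js: "length js \<le> m" for js
  proof -
    obtain g where g: "continuous_on (closure \<Omega>) g" "\<And>x. x \<in> \<Omega> \<Longrightarrow> g x = iter_partial js f x"
      using f js unfolding Ck_closure_def by metis
    have "bounded (g ` closure \<Omega>)"
      using g(1) \<open>bounded \<Omega>\<close> by (simp add: compact_continuous_image compact_imp_bounded)
    then obtain b where "\<And>y. y \<in> closure \<Omega> \<Longrightarrow> \<bar>g y\<bar> \<le> b"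
      by (auto simp: bounded_real)
    then show ?thesis
      using g(2) closure_subset by (metis subset_iff)
  qed
  then obtain b where b: "\<And>js x. length js \<le> m \<Longrightarrow> x \<in> \<Omega> \<Longrightarrow> \<bar>iter_partial js f x\<bar> \<le> b js"
    by metis
  have fin: "finite {js :: 'n list. length js \<le> m}"
    using finite_lists_length_le[of "UNIV :: 'n set" m] by simp
  have "bdd_above {\<bar>iter_partial is f x\<bar> | is x. length is \<le> m \<and> x \<in> \<Omega>}"
  proof (rule bdd_aboveI)
    fix s assume "s \<in> {\<bar>iter_partial is f x\<bar> | is x. length is \<le> m \<and> x \<in> \<Omega>}"
    then obtain js x where s: "s = \<bar>iter_partial js f x\<bar>" "length js \<le> m" "x \<in> \<Omega>" by blast
    have "s \<le> \<bar>b js\<bar>" using b s by fastforce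
    also have "\<dots> \<le> (\<Sum>js | length js \<le> m. \<bar>b js\<bar>)"
      using fin s by (intro member_le_sum) auto
    finally show "s \<le> (\<Sum>js | length js \<le> m. \<bar>b js\<bar>)" .
  qed
  then show ?thesis
    unfolding Ck_norm_def using assms(3,4) by (intro cSup_upper) auto
qed

section \<open>Extrema of quadratic functions over balls\<close>

definition quadratic :: "'a \<Rightarrow> ('a \<Rightarrow> 'a \<Rightarrow> real) \<Rightarrow> 'a::euclidean_space \<Rightarrow> real" where
  "quadratic g b w = g \<bullet> w + b w w / 2"

definition quadratic_max :: "'a \<Rightarrow> ('a \<Rightarrow> 'a \<Rightarrow> real) \<Rightarrow> real \<Rightarrow> 'a::euclidean_space \<Rightarrow> real" where
  "quadratic_max g b r w = (SUP h\<in>cball 0 r. quadratic g b (w + h))"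

locale bounded_form =
  fixes g :: "'a::euclidean_space" and b :: "'a \<Rightarrow> 'a \<Rightarrow> real" and a :: real
  assumes bil: "bilinear b" and b_le: "\<bar>b u v\<bar> \<le> a * norm u * norm v" and a_nonneg: "a \<ge> 0"
begin

lemmas b_simps = bilinear_ladd[OF bil] bilinear_radd[OF bil] bilinear_lsub[OF bil]
  bilinear_rsub[OF bil] bilinear_lmul[OF bil] bilinear_rmul[OF bil] bilinear_lneg[OF bil] bilinear_rneg[OF bil]

text \<open>Since min Q = - max (- Q), this makes every result on maxima available for
  minima.\<close>

lemma negated: "bounded_form (\<lambda>u v. - b u v) a"
proof
  show "bilinear (\<lambda>u v. - b u v)"
    using bil by (auto simp: bilinear_def linear_compose_neg)
qed (use b_le a_nonneg in auto)

text \<open>Splitting the difference as \<open>b u (u - v) + b (u - v) v\<close> works for a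
  bilinear form that may fail to be symmetric.\<close>

lemma form_diff_le: "\<bar>b u u - b v v\<bar> \<le> a * (norm u + norm v) * norm (u - v)"
proof -
  have "b u u - b v v = b u (u - v) + b (u - v) v"
    by (simp add: b_simps)
  also have "\<bar>\<dots>\<bar> \<le> a * norm u * norm (u - v) + a * norm (u - v) * norm v"
    using b_le[of u "u - v"] b_le[of "u - v" v] by linarith
  finally show ?thesis by (simp add: algebra_simps)
qed

lemma quadratic_diff_le:
  assumes "norm u \<le> s" "norm v \<le> s"
  shows "\<bar>quadratic g b u - quadratic g b v\<bar> \<le> (norm g + a * s) * norm (u - v)"
proof -
  have "quadratic g b u - quadratic g b v = g \<bullet> (u - v) + (b u u - b v v) / 2"
    by (simp add: quadratic_def inner_diff_right diff_divide_distrib)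
  also have "\<bar>\<dots>\<bar> \<le> norm g * norm (u - v) + a * (norm u + norm v) * norm (u - v) / 2"
  proof -
    have "\<bar>x + y / 2\<bar> \<le> \<bar>x\<bar> + \<bar>y\<bar> / 2" for x y :: real by linarith
    then show ?thesis
      using form_diff_le[of u v] Cauchy_Schwarz_ineq2[of g "u - v"]
      by (meson add_mono divide_right_mono order_trans zero_le_numeral)
  qed
  also have "\<dots> \<le> norm g * norm (u - v) + a * (s + s) * norm (u - v) / 2"
    using assms a_nonneg by (intro add_mono divide_right_mono mult_right_mono mult_left_mono) auto
  finally show ?thesis by (simp add: algebra_simps)
qed

lemma continuous_quadratic: "continuous_on S (\<lambda>w. quadratic g b w)"
proof -
  have "bounded_bilinear b"
    using bil by (simp add: bilinear_conv_bounded_bilinear)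
  then show ?thesis
    unfolding quadratic_def by (auto intro!: continuous_intros bounded_bilinear.continuous_on[of b])
qed

lemma quadratic_max_attained:
  assumes "r \<ge> 0"
  obtains h where "norm h \<le> r" "quadratic_max g b r w = quadratic g b (w + h)"
proof -
  have "continuous_on (cball 0 r) (\<lambda>h. quadratic g b (w + h))"
    by (rule continuous_on_compose2[OF continuous_quadratic[of UNIV]]) (auto intro!: continuous_intros)
  then obtain h where h: "h \<in> cball 0 r" "\<And>h'. h' \<in> cball 0 r \<Longrightarrow> quadratic g b (w + h') \<le> quadratic g b (w + h)"
    using continuous_attains_sup[of "cball 0 r" "\<lambda>h. quadratic g b (w + h)"] assms by auto
  then have "quadratic_max g b r w = quadratic g b (w + h)"
    unfolding quadratic_max_def by (intro cSup_eq_maximum) auto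
  then show ?thesis using that h(1) by auto
qed

lemma quadratic_le_max:
  assumes "norm h \<le> r"
  shows "quadratic g b (w + h) \<le> quadratic_max g b r w"
proof -
  have "continuous_on (cball 0 r) (\<lambda>h. quadratic g b (w + h))"
    by (rule continuous_on_compose2[OF continuous_quadratic[of UNIV]]) (auto intro!: continuous_intros)
  then have "bdd_above ((\<lambda>h. quadratic g b (w + h)) ` cball 0 r)"
    by (intro bounded_imp_bdd_above compact_imp_bounded compact_continuous_image) auto
  then show ?thesis
    unfolding quadratic_max_def using assms by (intro cSUP_upper) auto
qed

text \<open>A maximiser around one centre, translated along with the centre, is a competitor around
  the other. Both balls lie in the ball of radius \<open>s\<close>, where \<open>Q\<close> has
  Lipschitz constant \<open>norm g + a * s\<close>.\<close>

lemma quadratic_max_diff_le: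
  assumes "r \<ge> 0" "norm u + r \<le> s" "norm v + r \<le> s"
  shows "\<bar>quadratic_max g b r u - quadratic_max g b r v\<bar> \<le> (norm g + a * s) * norm (u - v)"
proof -
  have *: "quadratic_max g b r u \<le> quadratic_max g b r v + (norm g + a * s) * norm (u - v)"
    if uv: "norm u + r \<le> s" "norm v + r \<le> s" for u v
  proof -
    obtain h where h: "norm h \<le> r" "quadratic_max g b r u = quadratic g b (u + h)"
      using quadratic_max_attained assms(1) by metis
    have "\<bar>quadratic g b (u + h) - quadratic g b (v + h)\<bar> \<le> (norm g + a * s) * norm ((u + h) - (v + h))"
      using uv h norm_triangle_ineq[of u h] norm_triangle_ineq[of v h]
      by (intro quadratic_diff_le) auto
    then show ?thesis
      using h quadratic_le_max[OF h(1), of v] by auto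
  qed
  show ?thesis
    using *[of u v] *[of v u] assms by (auto simp: norm_minus_commute)
qed

lemma continuous_quadratic_max:
  assumes "r \<ge> 0"
  shows "continuous_on UNIV (quadratic_max g b r)"
proof -
  have "isCont (quadratic_max g b r) v" for v
  proof -
    define L where "L = norm g + a * (norm v + 1 + r)"
    have "\<forall>\<^sub>F u in at v. \<bar>quadratic_max g b r u - quadratic_max g b r v\<bar> \<le> L * norm (u - v)"
      unfolding eventually_at
    proof (intro exI[of _ 1] conjI ballI impI)
      fix u assume "u \<noteq> v \<and> dist u v < 1"
      then have "norm (u - v) < 1" by (simp add: dist_norm)
      then have "norm u \<le> norm v + 1" using norm_triangle_ineq[of v "u - v"] by simp
      then show "\<bar>quadratic_max g b r u - quadratic_max g b r v\<bar> \<le> L * norm (u - v)"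
        unfolding L_def using assms by (intro quadratic_max_diff_le) auto
    qed simp
    moreover have "((\<lambda>u. L * norm (u - v)) \<longlongrightarrow> 0) (at v)"
      by (auto intro!: tendsto_eq_intros)
    ultimately have "((\<lambda>u. quadratic_max g b r u - quadratic_max g b r v) \<longlongrightarrow> 0) (at v)"
      unfolding real_norm_def[symmetric] by (rule Lim_null_comparison)
    then show ?thesis
      unfolding isCont_def by (rule LIM_zero_cancel)
  qed
  then show ?thesis by (simp add: continuous_on_eq_continuous_at)
qed

lemma abs_form_le_square:
  assumes "norm u \<le> s"
  shows "\<bar>b u u\<bar> \<le> a * s^2"
proof -
  have "\<bar>b u u\<bar> \<le> a * (norm u * norm u)" using b_le[of u u] by (simp add: mult.assoc)
  also have "\<dots> \<le> a * (s * s)"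
    using assms a_nonneg order_trans[OF norm_ge_zero assms] by (intro mult_left_mono mult_mono) auto
  finally show ?thesis by (simp add: power2_eq_square)
qed

text \<open>The linear part has maximum \<open>g \<bullet> w + r * norm g\<close> over the ball, and
  the form changes values by at most its own size there.\<close>

lemma quadratic_max_first_order:
  assumes "r \<ge> 0"
  shows "\<bar>quadratic_max g b r w - (g \<bullet> w + r * norm g)\<bar> \<le> a * (norm w + r)^2"
proof -
  obtain h where h: "norm h \<le> r" "quadratic_max g b r w = quadratic g b (w + h)"
    using quadratic_max_attained assms(1) by metis
  have hw: "norm (w + h) \<le> norm w + r"
    using h norm_triangle_ineq[of w h] by linarith
  have "g \<bullet> h \<le> norm g * r"
    using norm_cauchy_schwarz[of g h] h(1) by (meson mult_left_mono norm_ge_zero order_trans)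
  then have up: "quadratic_max g b r w \<le> g \<bullet> w + r * norm g + a * (norm w + r)^2"
    using h abs_form_le_square[OF hw] zero_le_mult_iff[of a "(norm w + r)^2"] a_nonneg
    by (simp add: quadratic_def inner_add_right mult.commute)
  \<comment> \<open>Where the linear part is largest. For \<open>g = 0\<close> the value of
    \<open>sgn g\<close> is 0, still an admissible competitor.\<close>
  define k where "k = r *\<^sub>R sgn g"
  have k: "norm k \<le> r" using assms by (simp add: k_def norm_sgn)
  have kw: "norm (w + k) \<le> norm w + r"
    using k norm_triangle_ineq[of w k] by linarith
  have "g \<bullet> k = r * norm g"
    by (cases "g = 0") (auto simp: k_def sgn_div_norm dot_square_norm power2_eq_square)
  then have "g \<bullet> w + r * norm g - a * (norm w + r)^2 \<le> quadratic g b (w + k)"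
    using abs_form_le_square[OF kw] zero_le_mult_iff[of a "(norm w + r)^2"] a_nonneg
    by (simp add: quadratic_def inner_add_right)
  then show ?thesis
    using up quadratic_le_max[OF k, of w] by linarith
qed

text \<open>Reflect a maximiser \<open>h\<close> at the line through \<open>g\<close> and use the result as a competitor for the
  minimum around \<open>-w\<close>: the linear terms cancel, and so does the component of \<open>h\<close> orthogonal to \<open>g\<close>
  to first order. Hence \<open>norm g\<close> enters the error only through a term of fourth order.\<close>

lemma quadratic_max_reflect_le:
  assumes r: "r \<ge> 0" and g: "g \<noteq> 0"
  obtains h where "norm h \<le> r"
    "quadratic_max g b r w + quadratic g b (- w - h) \<le>
      b (w + r *\<^sub>R sgn g) (w + r *\<^sub>R sgn g) + 8 * a^3 * (norm w + r)^4 / (norm g)^2"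
proof -
  obtain h where h: "norm h \<le> r" "quadratic_max g b r w = quadratic g b (w + h)"
    using quadratic_max_attained r by metis
  define e where "e = sgn g"
  have G: "norm g > 0" using g by simp
  have e: "norm e = 1" "e \<bullet> e = 1" and ge: "g \<bullet> e = norm g"
    using g by (auto simp: e_def norm_sgn sgn_div_norm dot_square_norm divide_simps power2_eq_square)
  define c where "c = e \<bullet> h"
  define q where "q = h - c *\<^sub>R e"
  define D where "D = norm (h - r *\<^sub>R e)"
  define s where "s = norm w + r"
  have s: "s \<ge> 0" "r \<le> s" using r by (auto simp: s_def)
  have eq: "e \<bullet> q = 0" by (simp add: q_def c_def inner_diff_right e)
  have gh: "g \<bullet> h = norm g * c" and gq: "g \<bullet> q = 0"
    using eq G by (simp_all add: c_def e_def sgn_div_norm)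
  have cr: "c \<le> r"
    using norm_cauchy_schwarz[of e h] h e by (simp add: c_def)
  \<comment> \<open>Since \<open>h\<close> has norm at most \<open>r\<close>, its distance to the
    pole \<open>r *\<^sub>R e\<close> is controlled by the deficit \<open>r - c\<close> of its
    component along \<open>e\<close>.\<close>
  have D2: "D^2 \<le> 2 * r * (r - c)"
  proof -
    have "D^2 = h \<bullet> h - 2 * r * c + r^2"
      unfolding D_def power2_norm_eq_inner
      by (simp add: inner_diff_left inner_diff_right e c_def inner_commute[of h e] power2_eq_square algebra_simps)
    moreover have "h \<bullet> h \<le> r^2"
      using h by (metis abs_le_square_iff abs_norm_cancel abs_of_nonneg dot_square_norm r)
    ultimately show ?thesis by (simp add: algebra_simps power2_eq_square)
  qed
  have nq: "norm q \<le> D"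
  proof -
    have "h - r *\<^sub>R e = q + (c - r) *\<^sub>R e" by (simp add: q_def algebra_simps)
    then have "D^2 = norm q^2 + (c - r)^2"
      unfolding D_def power2_norm_eq_inner
      by (simp add: inner_add_left inner_add_right eq e inner_commute[of q e] power2_eq_square)
    then show ?thesis
      by (metis D_def abs_le_square_iff abs_norm_cancel le_add_same_cancel1 zero_le_power2)
  qed
  \<comment> \<open>Maximality of \<open>h\<close> against the pole: the linear part lost by
    \<open>h\<close>, namely \<open>norm g * (r - c)\<close>, must be regained from the form, which
    can supply at most \<open>a * s * D\<close>.\<close>
  have "quadratic g b (w + r *\<^sub>R e) \<le> quadratic g b (w + h)"
    using quadratic_le_max[of "r *\<^sub>R e" r w] h(2) r e by simp
  then have "norm g * (r - c) \<le> (b (w + h) (w + h) - b (w + r *\<^sub>R e) (w + r *\<^sub>R e)) / 2"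
    by (simp add: quadratic_def inner_add_right gh ge algebra_simps diff_divide_distrib)
  also have "\<dots> \<le> a * (norm (w + h) + norm (w + r *\<^sub>R e)) * D / 2"
    using form_diff_le[of "w + h" "w + r *\<^sub>R e"] by (simp add: D_def)
  also have "\<dots> \<le> a * (s + s) * D / 2"
    using a_nonneg h e r norm_triangle_ineq[of w h] norm_triangle_ineq[of w "r *\<^sub>R e"]
    by (intro divide_right_mono mult_right_mono mult_left_mono) (auto simp: D_def s_def)
  finally have m: "norm g * (r - c) \<le> a * s * D" by simp
  \<comment> \<open>Inserting that bound into \<open>D^2 \<le> 2 * r * (r - c)\<close> and
    cancelling one factor \<open>D\<close> gives \<open>D\<close> of order 1/|g|; fed back, it gives
    \<open>r - c\<close> of order 1/|g|^2.\<close>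
  have Dle: "norm g * D \<le> 2 * r * a * s"
  proof (cases "D = 0")
    case False
    then have "D > 0" by (simp add: D_def)
    have "norm g * D * D \<le> norm g * (2 * r * (r - c))"
      using D2 G by (simp add: power2_eq_square mult.assoc)
    also have "\<dots> \<le> 2 * r * (a * s * D)"
      using mult_left_mono[OF m, of "2 * r"] r by (simp add: mult_ac)
    finally have "norm g * D * D \<le> (2 * r * a * s) * D" by (simp add: mult_ac)
    then show ?thesis using \<open>D > 0\<close> by simp
  qed (use r a_nonneg s in auto)
  have G2: "(norm g)^2 > 0" using G by simp
  have D2': "D^2 * (norm g)^2 \<le> 4 * a^2 * s^4"
  proof -
    have "norm g * D \<le> 2 * s * a * s"
      using Dle s a_nonneg by (meson mult_left_mono mult_right_mono order_trans zero_le_numeral)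
    then have "(norm g * D)^2 \<le> (2 * s * a * s)^2"
      using G by (intro power_mono) (auto simp: D_def)
    moreover have "(2 * s * a * s)^2 = 4 * a^2 * s^4" by (simp add: eval_nat_numeral)
    moreover have "(norm g * D)^2 = D^2 * (norm g)^2" by (simp add: power_mult_distrib)
    ultimately show ?thesis by metis
  qed
  have c2: "(r - c) * (norm g)^2 \<le> 2 * a^2 * s^3"
  proof -
    have "(r - c) * (norm g)^2 \<le> (a * s * D) * norm g"
      using mult_right_mono[OF m, of "norm g"] by (simp add: power2_eq_square mult_ac)
    also have "\<dots> \<le> a * s * (2 * r * a * s)"
      using mult_left_mono[OF Dle, of "a * s"] a_nonneg s by (simp add: mult_ac)
    also have "\<dots> \<le> a * s * (2 * s * a * s)"
      using a_nonneg s by (intro mult_left_mono mult_right_mono) auto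
    finally show ?thesis by (simp add: power2_eq_square power3_eq_cube mult_ac)
  qed
  \<comment> \<open>The mirror image of \<open>h = c *\<^sub>R e + q\<close> in the line spanned by
    \<open>e\<close>; it has the same norm and the same linear value.\<close>
  define k where "k = c *\<^sub>R e - q"
  have hk: "h = c *\<^sub>R e + q" by (simp add: q_def)
  have "norm k = norm h"
    unfolding norm_eq_sqrt_inner hk k_def
    by (simp add: inner_add_left inner_add_right inner_diff_left inner_diff_right eq inner_commute[of q e])
  then have k: "norm k \<le> r" using h by simp
  have gk: "g \<bullet> k = g \<bullet> h"
    by (simp add: hk k_def inner_add_right inner_diff_right gq)
  have cs: "norm (w + c *\<^sub>R e) \<le> s"
  proof -
    have "\<bar>c\<bar> \<le> r"
      using Cauchy_Schwarz_ineq2[of e h] h e by (simp add: c_def)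
    then show ?thesis
      using norm_triangle_ineq[of w "c *\<^sub>R e"] e by (simp add: s_def)
  qed
  \<comment> \<open>Parallelogram identity: the mixed terms in \<open>w + c *\<^sub>R e\<close> and
    \<open>q\<close> cancel. Each of them alone would be of order a s D, hence cubic with a factor
    1/|g|.\<close>
  have "quadratic_max g b r w + quadratic g b (- w - k)
      = b (w + c *\<^sub>R e) (w + c *\<^sub>R e) + b q q"
  proof -
    have "b (- w - k) (- w - k) = b (w + k) (w + k)" by (simp add: b_simps)
    moreover have "b (w + h) (w + h) + b (w + k) (w + k) = 2 * (b (w + c *\<^sub>R e) (w + c *\<^sub>R e) + b q q)"
      unfolding hk k_def by (simp add: b_simps algebra_simps)
    ultimately show ?thesis
      unfolding h(2) by (simp add: quadratic_def inner_add_right inner_diff_right gk)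
  qed
  also have "b q q \<le> a * D^2"
    using abs_form_le_square[OF nq] by simp
  also have "b (w + c *\<^sub>R e) (w + c *\<^sub>R e) \<le> b (w + r *\<^sub>R e) (w + r *\<^sub>R e) + a * (s + s) * (r - c)"
  proof -
    have "\<bar>b (w + c *\<^sub>R e) (w + c *\<^sub>R e) - b (w + r *\<^sub>R e) (w + r *\<^sub>R e)\<bar>
      \<le> a * (norm (w + c *\<^sub>R e) + norm (w + r *\<^sub>R e)) * norm ((w + c *\<^sub>R e) - (w + r *\<^sub>R e))"
      by (rule form_diff_le)
    also have "(w + c *\<^sub>R e) - (w + r *\<^sub>R e) = (c - r) *\<^sub>R e" by (simp add: algebra_simps)
    also have "norm \<dots> = r - c" using cr e by simp
    also have "a * (norm (w + c *\<^sub>R e) + norm (w + r *\<^sub>R e)) * (r - c) \<le> a * (s + s) * (r - c)"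
      using a_nonneg cs norm_triangle_ineq[of w "r *\<^sub>R e"] e cr r
      by (intro mult_right_mono mult_left_mono) (auto simp: s_def)
    finally show ?thesis by linarith
  qed
  \<comment> \<open>The deficit \<open>r - c\<close> and the square \<open>D^2\<close> contribute 4
    each to the final constant 8.\<close>
  also have "a * (s + s) * (r - c) \<le> 4 * a^3 * s^4 / (norm g)^2"
  proof -
    have "a * (s + s) * ((r - c) * (norm g)^2) \<le> a * (s + s) * (2 * a^2 * s^3)"
      using a_nonneg s by (intro mult_left_mono c2) auto
    also have "\<dots> = 4 * a^3 * s^4" by (simp add: eval_nat_numeral)
    finally show ?thesis
      using G2 by (simp add: pos_le_divide_eq mult.assoc)
  qed
  also have "a * D^2 \<le> 4 * a^3 * s^4 / (norm g)^2"
  proof -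
    have "a * (D^2 * (norm g)^2) \<le> a * (4 * a^2 * s^4)"
      using a_nonneg by (intro mult_left_mono D2')
    also have "\<dots> = 4 * a^3 * s^4" by (simp add: eval_nat_numeral)
    finally show ?thesis
      using G2 by (simp add: pos_le_divide_eq mult.assoc)
  qed
  finally have "quadratic_max g b r w + quadratic g b (- w - k)
      \<le> b (w + r *\<^sub>R e) (w + r *\<^sub>R e) + 8 * a^3 * s^4 / (norm g)^2"
    by simp
  then show ?thesis
    using that[OF k] by (simp add: e_def s_def)
qed

end

text \<open>The subtracted maximum is that of - Q, so this is max Q + min Q over the ball around
  \<open>w\<close>, i.e. twice the midrange, matching the sum in the discrete operator.\<close>

definition quadratic_midrange :: "'a \<Rightarrow> ('a \<Rightarrow> 'a \<Rightarrow> real) \<Rightarrow> real \<Rightarrow> 'a::euclidean_space \<Rightarrow> real" where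
  "quadratic_midrange g b r w = quadratic_max g b r w - quadratic_max (- g) (\<lambda>u v. - b u v) r w"

lemma quadratic_uminus: "quadratic (- g) (\<lambda>u v. - b u v) w = - quadratic g b w"
  by (simp add: quadratic_def)

context bounded_form
begin

text \<open>One bound comes from reflecting a maximiser of \<open>Q\<close> around \<open>w\<close>,
  the other from reflecting a maximiser of - Q around \<open>- w\<close>. In the second case
  \<open>sgn (- g)\<close> and \<open>- w\<close> flip together, so the form takes the same
  value.\<close>

lemma quadratic_max_antipodal:
  assumes r: "r \<ge> 0" and g: "g \<noteq> 0"
  shows "\<bar>quadratic_max g b r w - quadratic_max (- g) (\<lambda>u v. - b u v) r (- w)
      - b (w + r *\<^sub>R sgn g) (w + r *\<^sub>R sgn g)\<bar> \<le> 8 * a^3 * (norm w + r)^4 / (norm g)^2"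
proof -
  interpret neg: bounded_form "- g" "\<lambda>u v. - b u v" a
    by (rule negated)
  obtain h where h: "norm h \<le> r"
    "quadratic_max g b r w + quadratic g b (- w - h) \<le>
      b (w + r *\<^sub>R sgn g) (w + r *\<^sub>R sgn g) + 8 * a^3 * (norm w + r)^4 / (norm g)^2"
    using quadratic_max_reflect_le[OF r g] by metis
  have 1: "- quadratic g b (- w - h) \<le> quadratic_max (- g) (\<lambda>u v. - b u v) r (- w)"
    using neg.quadratic_le_max[of "- h" r "- w"] h(1) by (simp add: quadratic_uminus)
  obtain k where k: "norm k \<le> r"
    "quadratic_max (- g) (\<lambda>u v. - b u v) r (- w) - quadratic g b (w - k) \<le>
      - b (- w - r *\<^sub>R sgn g) (- w - r *\<^sub>R sgn g) + 8 * a^3 * (norm w + r)^4 / (norm g)^2"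
    using neg.quadratic_max_reflect_le[OF r, of "- w"] g
    by (auto simp: quadratic_uminus sgn_minus)
  have 2: "quadratic g b (w - k) \<le> quadratic_max g b r w"
    using quadratic_le_max[of "- k" r w] k(1) by simp
  have 3: "b (- w - r *\<^sub>R sgn g) (- w - r *\<^sub>R sgn g) = b (w + r *\<^sub>R sgn g) (w + r *\<^sub>R sgn g)"
    by (simp add: b_simps algebra_simps)
  show ?thesis using h(2) k(2) 1 2 3 by linarith
qed

end

section \<open>Moments of the kernel\<close>

text \<open>A family of isometries containing the three symmetries used for the moments: exchanging
  two coordinates, changing one sign, and \<open>- u\<close>.\<close>

definition signed_permutation :: "('n::finite \<Rightarrow> real) \<Rightarrow> ('n \<Rightarrow> 'n) \<Rightarrow> real^'n \<Rightarrow> real^'n" where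
  "signed_permutation s \<pi> u = (\<chi> k. s k * u $ \<pi> k)"

lemma measurable_signed_permutation [measurable]: "signed_permutation s \<pi> \<in> borel_measurable borel"
  unfolding signed_permutation_def by (intro borel_measurable_continuous_onI continuous_intros)

lemma norm_signed_permutation:
  assumes "bij \<pi>" "\<And>k. s k = 1 \<or> s k = - 1"
  shows "norm (signed_permutation s \<pi> u) = norm u"
proof -
  have "s k * x * (s k * x) = x * x" for k and x :: real
    using assms(2)[of k] by (elim disjE) simp_all
  then have "(\<Sum>k\<in>UNIV. s k * u $ \<pi> k * (s k * u $ \<pi> k)) = (\<Sum>k\<in>UNIV. u $ \<pi> k * u $ \<pi> k)"
    by (intro sum.cong refl)
  moreover have "(\<Sum>k\<in>UNIV. u $ \<pi> k * u $ \<pi> k) = (\<Sum>k\<in>UNIV. u $ k * u $ k)"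
    by (rule sum.reindex_bij_betw[OF assms(1)])
  ultimately show ?thesis
    by (simp add: norm_eq_sqrt_inner inner_vec_def signed_permutation_def)
qed

lemma prod_Basis_cart:
  fixes v :: "real^'n::finite"
  shows "(\<Prod>b\<in>Basis. v \<bullet> b) = (\<Prod>i\<in>UNIV. v $ i)"
proof -
  have "(Basis :: (real^'n) set) = (\<lambda>i. axis i 1) ` UNIV"
    by (auto simp: Basis_vec_def)
  then have "(\<Prod>b\<in>Basis. v \<bullet> b) = (\<Prod>b\<in>(\<lambda>i. axis i 1) ` UNIV. v \<bullet> b)"
    by (rule arg_cong)
  also have "\<dots> = (\<Prod>i\<in>UNIV. v $ i)"
    by (subst prod.reindex) (auto simp: inj_on_def axis_eq_axis inner_axis)
  finally show ?thesis .
qed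

text \<open>Lebesgue measure is determined on boxes, and the preimage of a box is a box with the
  same side lengths in another order.\<close>

lemma lborel_distr_signed_permutation:
  fixes s :: "'n::finite \<Rightarrow> real"
  assumes \<pi>: "bij \<pi>" and s: "\<And>k. s k = 1 \<or> s k = - 1"
  shows "distr lborel borel (signed_permutation s \<pi>) = lborel"
proof (rule sym, rule lborel_eqI)
  fix l u :: "real^'n"
  assume "\<And>b. b \<in> Basis \<Longrightarrow> l \<bullet> b \<le> u \<bullet> b"
  from this[of "axis _ 1"] have lu: "l $ k \<le> u $ k" for k
    by (auto simp: Basis_vec_def inner_axis)
  define \<tau> where "\<tau> = inv \<pi>"
  have \<tau>: "\<tau> (\<pi> k) = k" "\<pi> (\<tau> k) = k" for k
    using \<pi> by (auto simp: \<tau>_def bij_is_inj bij_is_surj surj_f_inv_f)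
  \<comment> \<open>A coordinate with sign -1 reverses its interval, so the lower end comes from the
    negated upper end and conversely.\<close>
  define l' where "l' = (\<chi> j. if s (\<tau> j) = 1 then l $ \<tau> j else - u $ \<tau> j)"
  define u' where "u' = (\<chi> j. if s (\<tau> j) = 1 then u $ \<tau> j else - l $ \<tau> j)"
  have "signed_permutation s \<pi> -` box l u = box l' u'"
  proof -
    have "(l $ k < s k * w $ \<pi> k \<and> s k * w $ \<pi> k < u $ k) \<longleftrightarrow> (l' $ \<pi> k < w $ \<pi> k \<and> w $ \<pi> k < u' $ \<pi> k)" for w k
      using s[of k] by (auto simp: l'_def u'_def \<tau>)
    then have "signed_permutation s \<pi> w \<in> box l u \<longleftrightarrow> w \<in> box l' u'" for w
      unfolding mem_box_cart signed_permutation_def by simp (metis \<tau>(2))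
    then show ?thesis by auto
  qed
  moreover have "l' $ k \<le> u' $ k" for k
    using lu by (simp add: l'_def u'_def)
  then have "emeasure lborel (box l' u') = (\<Prod>b\<in>Basis. (u' - l') \<bullet> b)"
    by (intro emeasure_lborel_box) (auto simp: Basis_vec_def inner_axis)
  moreover have "(\<Prod>k\<in>UNIV. (u' - l') $ k) = (\<Prod>k\<in>UNIV. (u - l) $ k)"
  proof -
    have "(\<Prod>k\<in>UNIV. (u' - l') $ k) = (\<Prod>k\<in>UNIV. (u' - l') $ \<pi> k)"
      by (rule prod.reindex_bij_betw[OF \<pi>, symmetric])
    also have "\<dots> = (\<Prod>k\<in>UNIV. (u - l) $ k)"
      by (auto simp: u'_def l'_def \<tau> intro!: prod.cong)
    finally show ?thesis .
  qed
  ultimately show "emeasure (distr lborel borel (signed_permutation s \<pi>)) (box l u) = (\<Prod>b\<in>Basis. (u - l) \<bullet> b)"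
    by (simp add: emeasure_distr prod_Basis_cart)
qed simp

section \<open>The truncated kernel: size, scaling, measurability\<close>

lemma cut_kernel_nonneg:
  "admissible_kernel \<eta> \<Longrightarrow> \<epsilon> > 0 \<Longrightarrow> s \<ge> 0 \<Longrightarrow> 0 \<le> cut_kernel d \<eta> \<epsilon> s"
  by (auto simp: admissible_kernel_def cut_kernel_def)

lemma cut_kernel_le:
  assumes "admissible_kernel \<eta>" "\<epsilon> > 0" "s \<ge> 0"
  shows "cut_kernel d \<eta> \<epsilon> s \<le> 2 / \<epsilon> ^ d"
proof -
  have "\<eta> (s / \<epsilon>) \<le> \<eta> 0"
    using assms by (auto simp: admissible_kernel_def)
  also have "\<eta> 0 \<le> 2"
    using assms by (simp add: admissible_kernel_def)
  finally have "\<eta> (s / \<epsilon>) \<le> 2" .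
  then show ?thesis
    using assms by (auto simp: cut_kernel_def divide_right_mono)
qed

lemma cut_kernel_scale: "\<epsilon> > 0 \<Longrightarrow> cut_kernel d \<eta> \<epsilon> (\<epsilon> * s) = cut_kernel d \<eta> 1 s / \<epsilon> ^ d"
  by (auto simp: cut_kernel_def abs_mult)

lemma measurable_cut_kernel_norm:
  fixes \<eta> :: "real \<Rightarrow> real"
  assumes "admissible_kernel \<eta>" "\<epsilon> > 0"
  shows "(\<lambda>u :: 'a::euclidean_space. cut_kernel d \<eta> \<epsilon> (norm u)) \<in> borel_measurable borel"
proof -
  have "continuous_on {0..} \<eta>"
    using assms lipschitz_on_continuous_on by (auto simp: admissible_kernel_def)
  then have "continuous_on UNIV (\<lambda>u :: 'a. \<eta> (norm u / \<epsilon>))"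
    by (rule continuous_on_compose2) (use assms in \<open>auto intro!: continuous_intros\<close>)
  then have [measurable]: "(\<lambda>u :: 'a. \<eta> (norm u / \<epsilon>)) \<in> borel_measurable borel"
    by (rule borel_measurable_continuous_onI)
  show ?thesis
    unfolding cut_kernel_def by measurable
qed

section \<open>Moments of the kernel at unit scale\<close>

locale kernel =
  fixes \<eta> :: "real \<Rightarrow> real" and i1 :: "'n::finite"
  assumes admissible: "admissible_kernel \<eta>"
begin

definition weight :: "real^'n \<Rightarrow> real" where
  "weight u = cut_kernel CARD('n) \<eta> 1 (norm u)"

lemma weight_measurable [measurable]: "weight \<in> borel_measurable borel"
  unfolding weight_def by (rule measurable_cut_kernel_norm[OF admissible]) simp

lemma weight_nonneg: "0 \<le> weight u" and weight_le: "weight u \<le> 2"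
  unfolding weight_def using cut_kernel_nonneg[OF admissible] cut_kernel_le[OF admissible, of 1 "norm u" "CARD('n)"]
  by auto

lemma weight_eq_0: "norm u \<ge> 1 \<Longrightarrow> weight u = 0"
  by (simp add: weight_def cut_kernel_def)

text \<open>The weight is bounded by 2 and vanishes outside the unit ball, so only values of
  \<open>f\<close> inside that ball matter.\<close>

lemma integrable_weight_mult:
  assumes f [measurable]: "f \<in> borel_measurable borel" and le: "\<And>u. norm u < 1 \<Longrightarrow> \<bar>f u\<bar> \<le> c"
  shows "integrable lborel (\<lambda>u. weight u * f u)"
proof (rule Bochner_Integration.integrable_bound)
  show "integrable lborel (\<lambda>u :: real^'n. 2 * c * indicator (ball 0 1) u)"
    using emeasure_bounded_finite[OF bounded_ball, of "0 :: real^'n" 1]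
    by (intro integrable_mult_right integrable_real_indicator) auto
  have "norm (weight u * f u) \<le> norm (2 * c * indicator (ball 0 1) u)" for u
  proof (cases "norm u < 1")
    case True
    have "weight u * \<bar>f u\<bar> \<le> 2 * \<bar>c\<bar>"
      using le[OF True] weight_nonneg weight_le by (intro mult_mono) auto
    then show ?thesis
      using True weight_nonneg by (simp add: abs_mult)
  qed (simp add: weight_eq_0)
  then show "AE u in lborel. norm (weight u * f u) \<le> norm (2 * c * indicator (ball 0 1) u)"
    by simp
qed simp

lemma integral_weight: "(\<integral>u. weight u \<partial>lborel) = 2 * sigma2 TYPE('n) \<eta>"
proof -
  have "weight u = indicat_real (ball 0 1) u *\<^sub>R \<eta> (norm u)" for u
    by (auto simp: weight_def cut_kernel_def indicator_def)
  then show ?thesis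
    by (simp add: sigma2_def set_lebesgue_integral_def)
qed

lemma integral_weight_le:
  assumes f [measurable]: "f \<in> borel_measurable borel" and le: "\<And>u. norm u < 1 \<Longrightarrow> \<bar>f u\<bar> \<le> c"
  shows "\<bar>\<integral>u. weight u * f u \<partial>lborel\<bar> \<le> 2 * sigma2 TYPE('n) \<eta> * c"
proof -
  have int: "integrable lborel (\<lambda>u. weight u * f u)"
    by (rule integrable_weight_mult[OF f le])
  have "\<bar>\<integral>u. weight u * f u \<partial>lborel\<bar> \<le> (\<integral>u. \<bar>weight u * f u\<bar> \<partial>lborel)"
    by (rule integral_abs_bound)
  also have "\<dots> \<le> (\<integral>u. weight u * c \<partial>lborel)"
  proof (rule integral_mono)
    show "integrable lborel (\<lambda>u. weight u * c)"
      by (rule integrable_weight_mult) auto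
    show "\<bar>weight u * f u\<bar> \<le> weight u * c" for u
      using le[of u] weight_nonneg[of u] weight_eq_0[of u]
      by (cases "norm u < 1") (auto simp: abs_mult intro!: mult_left_mono)
  qed (use int in auto)
  finally show ?thesis
    by (simp add: integral_weight)
qed

lemma integral_weight_signed_permutation:
  assumes "bij \<pi>" "\<And>k. s k = 1 \<or> s k = - 1" and f [measurable]: "f \<in> borel_measurable borel"
  shows "(\<integral>u. weight u * f (signed_permutation s \<pi> u) \<partial>lborel) = (\<integral>u. weight u * f u \<partial>lborel)"
proof -
  let ?T = "signed_permutation s \<pi>"
  have "(\<integral>u. weight u * f u \<partial>lborel) = (\<integral>u. weight u * f u \<partial>distr lborel borel ?T)"
    by (simp add: lborel_distr_signed_permutation assms)
  also have "\<dots> = (\<integral>u. weight (?T u) * f (?T u) \<partial>lborel)"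
    by (rule integral_distr) measurable
  finally show ?thesis
    by (simp add: weight_def norm_signed_permutation assms)
qed

lemma integral_weight_uminus:
  assumes "f \<in> borel_measurable borel"
  shows "(\<integral>u. weight u * f (- u) \<partial>lborel) = (\<integral>u. weight u * f u \<partial>lborel)"
proof -
  have "signed_permutation (\<lambda>_. - 1) (\<lambda>k. k) = (\<lambda>u :: real^'n. - u)"
    by (auto simp: signed_permutation_def vec_eq_iff)
  then show ?thesis
    using integral_weight_signed_permutation[of "\<lambda>k. k" "\<lambda>_. - 1" f] assms by (simp add: bij_def)
qed

lemma integrable_weight_second_moment: "integrable lborel (\<lambda>u. weight u * (u $ i * u $ j))"
proof (rule integrable_weight_mult)
  show "\<bar>u $ i * u $ j\<bar> \<le> 1" if "norm u < 1" for u :: "real^'n"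
    using mult_mono[of "\<bar>u $ i\<bar>" 1 "\<bar>u $ j\<bar>" 1] component_le_norm_cart[of u i] component_le_norm_cart[of u j] that
    by (simp add: abs_mult)
qed (intro borel_measurable_continuous_onI continuous_intros)

text \<open>On the diagonal, exchange the coordinates \<open>i\<close> and \<open>i1\<close>. Off
  the diagonal, changing the sign of coordinate \<open>i\<close> shows that the integral equals its
  own negative.\<close>

lemma integral_weight_second_moment:
  "(\<integral>u. weight u * (u $ i * u $ j) \<partial>lborel) = (if i = j then 2 * sigma1 i1 \<eta> else 0)"
proof -
  have [measurable]: "(\<lambda>u :: real^'n. u $ i * u $ j) \<in> borel_measurable borel" for i j
    by (intro borel_measurable_continuous_onI continuous_intros)
  show ?thesis
  proof (cases "i = j")
    case True
    define \<pi> where "\<pi> k = (if k = i then i1 else if k = i1 then i else k)" for k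
    have "\<pi> \<circ> \<pi> = id" by (auto simp: \<pi>_def)
    then have "bij \<pi>" by (rule o_bij) fact
    have "(\<integral>u. weight u * (u $ i * u $ i) \<partial>lborel) = (\<integral>u. weight u * (u $ i1 * u $ i1) \<partial>lborel)"
      using integral_weight_signed_permutation[OF \<open>bij \<pi>\<close>, of "\<lambda>_. 1" "\<lambda>u. u $ i * u $ i"]
      by (simp add: \<pi>_def signed_permutation_def)
    also have "\<dots> = (\<integral>u. indicat_real (ball 0 1) u *\<^sub>R (\<eta> (norm u) * \<bar>u $ i1\<bar>^2) \<partial>lborel)"
      by (rule Bochner_Integration.integral_cong)
         (auto simp: weight_def cut_kernel_def indicator_def power2_eq_square)
    finally show ?thesis
      using True by (simp add: sigma1_def set_lebesgue_integral_def)
  next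
    case False
    then have "(\<integral>u. weight u * - (u $ i * u $ j) \<partial>lborel) = (\<integral>u. weight u * (u $ i * u $ j) \<partial>lborel)"
      using integral_weight_signed_permutation[of "\<lambda>k. k" "\<lambda>k. if k = i then - 1 else 1" "\<lambda>u. u $ i * u $ j"]
      by (simp add: signed_permutation_def bij_def)
    then show ?thesis using False by simp
  qed
qed

lemma has_bochner_integral_weight_form:
  "has_bochner_integral lborel (\<lambda>u. weight u * (\<Sum>i\<in>UNIV. u $ i * (\<Sum>j\<in>UNIV. u $ j * A i j)))
    (2 * sigma1 i1 \<eta> * (\<Sum>i\<in>UNIV. A i i))"
proof -
  have "has_bochner_integral lborel (\<lambda>u. weight u * (u $ i * u $ j)) (if i = j then 2 * sigma1 i1 \<eta> else 0)" for i j
    by (simp add: has_bochner_integral_iff integrable_weight_second_moment integral_weight_second_moment)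
  then have "has_bochner_integral lborel (\<lambda>u. \<Sum>i\<in>UNIV. \<Sum>j\<in>UNIV. weight u * (u $ i * u $ j) * A i j)
      (\<Sum>i\<in>UNIV. \<Sum>j\<in>UNIV. (if i = j then 2 * sigma1 i1 \<eta> else 0) * A i j)"
    by (intro has_bochner_integral_sum has_bochner_integral_mult_left)
  also have "(\<Sum>i\<in>UNIV. \<Sum>j\<in>UNIV. (if i = j then 2 * sigma1 i1 \<eta> else 0) * A i j)
     = 2 * sigma1 i1 \<eta> * (\<Sum>i\<in>UNIV. A i i)"
    by (simp add: if_distrib[where f = "\<lambda>x. x * _"] sum_distrib_left cong: if_cong)
  finally show ?thesis
    by (simp add: sum_distrib_left mult_ac)
qed

text \<open>The rank one case of the preceding moment. It evaluates the linear part of the density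
  against the leading part \<open>2 * (g \<bullet> w)\<close> of max plus min.\<close>

lemma has_bochner_integral_weight_inner_inner:
  "has_bochner_integral lborel (\<lambda>u. weight u * ((g \<bullet> u) * (h \<bullet> u))) (2 * sigma1 i1 \<eta> * (g \<bullet> h))"
proof -
  have "(g \<bullet> u) * (h \<bullet> u) = (\<Sum>i\<in>UNIV. \<Sum>j\<in>UNIV. g $ i * u $ i * (h $ j * u $ j))" for u :: "real^'n"
    by (simp only: inner_vec_def inner_real_def sum_product)
  then have "(g \<bullet> u) * (h \<bullet> u) = (\<Sum>i\<in>UNIV. u $ i * (\<Sum>j\<in>UNIV. u $ j * (g $ i * h $ j)))" for u :: "real^'n"
    by (simp add: sum_distrib_left mult_ac)
  then show ?thesis
    using has_bochner_integral_weight_form[of "\<lambda>i j. g $ i * h $ j"] by (simp add: inner_vec_def)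
qed

lemma sigma1_nonneg: "0 \<le> sigma1 i1 \<eta>"
proof -
  have "0 \<le> (\<integral>u. weight u * (u $ i1 * u $ i1) \<partial>lborel)"
    by (rule Bochner_Integration.integral_nonneg) (simp add: weight_nonneg)
  then show ?thesis by (simp add: integral_weight_second_moment)
qed

lemma sigma2_nonneg: "0 \<le> sigma2 TYPE('n) \<eta>"
proof -
  have "0 \<le> (\<integral>u. weight u \<partial>lborel)"
    by (rule Bochner_Integration.integral_nonneg) (simp add: weight_nonneg)
  then show ?thesis by (simp add: integral_weight)
qed

lemma kappa_nonneg: "p \<ge> 2 \<Longrightarrow> 0 \<le> kappa i1 \<eta> p"
  unfolding kappa_def using sigma1_nonneg sigma2_nonneg by simp

end

section \<open>Comparison of sample averages with integrals\<close>

text \<open>Bounds the volume of the shell on which the kernel may jump.\<close>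

lemma power_diff_le:
  fixes a b :: real
  assumes "0 \<le> b" "b \<le> a"
  shows "a ^ n - b ^ n \<le> real n * a ^ (n - 1) * (a - b)"
proof (induction n)
  case (Suc n)
  have "b * (a ^ n - b ^ n) \<le> b * (real n * a ^ (n - 1) * (a - b))"
    using Suc assms by (intro mult_left_mono) auto
  also have "\<dots> \<le> a * (real n * a ^ (n - 1) * (a - b))"
    using assms by (intro mult_right_mono) auto
  also have "\<dots> = real n * a ^ n * (a - b)"
    by (cases n) auto
  finally show ?case
    by (simp add: algebra_simps)
qed simp

lemma integral_lborel_affine:
  fixes f :: "'a::euclidean_space \<Rightarrow> real"
  assumes [measurable]: "f \<in> borel_measurable borel" and "c > 0"
  shows "(\<integral>y. f y \<partial>lborel) = c ^ DIM('a) * (\<integral>u. f (t + c *\<^sub>R u) \<partial>lborel)"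
proof -
  have "(\<integral>y. f y \<partial>lborel) = (\<integral>y. f y \<partial>density (distr lborel borel (\<lambda>x. t + c *\<^sub>R x)) (\<lambda>_. ennreal (\<bar>c\<bar> ^ DIM('a))))"
    using lborel_affine[of c t] \<open>c > 0\<close> by (simp add: ennreal_power)
  also have "\<dots> = (\<integral>y. \<bar>c\<bar> ^ DIM('a) * f y \<partial>distr lborel borel (\<lambda>x. t + c *\<^sub>R x))"
    by (subst integral_density) auto
  also have "\<dots> = (\<integral>u. \<bar>c\<bar> ^ DIM('a) * f (t + c *\<^sub>R u) \<partial>lborel)"
    by (subst integral_distr) auto
  finally show ?thesis
    using \<open>c > 0\<close> by simp
qed

lemma integral_empirical_measure:
  fixes f :: "real^'n::finite \<Rightarrow> real"
  assumes "f \<in> borel_measurable borel"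
  shows "(\<integral>y. f y \<partial>empirical_measure x n) = (\<Sum>j=1..n. f (x j)) / real n"
proof -
  have "x \<in> measurable (uniform_count_measure {1..n}) borel"
    by (auto simp: measurable_def space_uniform_count_measure sets_uniform_count_measure)
  then have "(\<integral>y. f y \<partial>empirical_measure x n) = (\<integral>j. f (x j) \<partial>uniform_count_measure {1..n})"
    unfolding empirical_measure_def using assms by (intro integral_distr)
  then show ?thesis
    by (simp add: integral_uniform_count_measure)
qed

text \<open>Both arguments stay below the cut-off; the jump at \<epsilon> is accounted for
  separately, by the shell.\<close>

lemma cut_kernel_diff_le:
  assumes "L-lipschitz_on {0..} \<eta>" "\<epsilon> > 0" "0 \<le> s" "s < \<epsilon>" "0 \<le> t" "t < \<epsilon>"
  shows "\<bar>cut_kernel d \<eta> \<epsilon> s - cut_kernel d \<eta> \<epsilon> t\<bar> \<le> L * \<bar>s - t\<bar> / \<epsilon> / \<epsilon> ^ d"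
proof -
  have "\<bar>\<eta> (s / \<epsilon>) - \<eta> (t / \<epsilon>)\<bar> \<le> L * \<bar>s / \<epsilon> - t / \<epsilon>\<bar>"
    using lipschitz_onD[OF assms(1), of "s / \<epsilon>" "t / \<epsilon>"] assms by (simp add: dist_real_def)
  also have "\<dots> = L * \<bar>s - t\<bar> / \<epsilon>"
    using assms by (simp flip: diff_divide_distrib)
  finally have "\<bar>\<eta> (s / \<epsilon>) - \<eta> (t / \<epsilon>)\<bar> / \<epsilon> ^ d \<le> L * \<bar>s - t\<bar> / \<epsilon> / \<epsilon> ^ d"
    using assms by (intro divide_right_mono) auto
  then show ?thesis
    using assms by (simp add: cut_kernel_def flip: diff_divide_distrib)
qed

context kernel
begin

text \<open>In the application \<open>v\<close> is the image of \<open>y\<close> under the transport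
  map. If both points are inside the kernel's ball, the factor 1/\<epsilon> from the slope of the
  kernel is compensated by \<open>F\<close> being at most \<open>c1 * \<epsilon>\<close>. If exactly
  one is inside, \<open>y\<close> lies in the shell. The inner ball removed from the shell is open,
  because distance exactly \<epsilon> - \<delta> can occur.\<close>

lemma kernel_times_diff_le:
  assumes L: "L-lipschitz_on {0..} \<eta>" and \<epsilon>: "\<epsilon> > 0" and c: "0 \<le> c1" "0 \<le> c2"
    and F_le: "\<And>w. norm w \<le> \<epsilon> \<Longrightarrow> \<bar>F w\<bar> \<le> c1 * \<epsilon>"
    and F_diff: "\<And>v w. norm v \<le> \<epsilon> \<Longrightarrow> norm w \<le> \<epsilon> \<Longrightarrow> \<bar>F v - F w\<bar> \<le> c2 * norm (v - w)"
    and \<delta>: "norm (y - v) \<le> \<delta>"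
  shows "\<bar>cut_kernel d \<eta> \<epsilon> (norm (z - v)) * F (v - z) - cut_kernel d \<eta> \<epsilon> (norm (z - y)) * F (y - z)\<bar>
    \<le> (L * c1 + 2 * c2) * \<delta> / \<epsilon> ^ d * indicator (ball z \<epsilon>) y
      + 2 / \<epsilon> ^ d * (c1 * \<epsilon>) * indicator (cball z (\<epsilon> + \<delta>) - ball z (\<epsilon> - \<delta>)) y"
proof -
  define kv ky where "kv = cut_kernel d \<eta> \<epsilon> (norm (z - v))" and "ky = cut_kernel d \<eta> \<epsilon> (norm (z - y))"
  have k: "0 \<le> kv" "kv \<le> 2 / \<epsilon> ^ d" "0 \<le> ky" "ky \<le> 2 / \<epsilon> ^ d"
    unfolding kv_def ky_def using cut_kernel_nonneg[OF admissible \<epsilon>] cut_kernel_le[OF admissible \<epsilon>] by auto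
  have L0: "0 \<le> L" and \<delta>0: "0 \<le> \<delta>"
    using L \<delta> order_trans[OF norm_ge_zero \<delta>] by (auto simp: lipschitz_on_def)
  have tri: "\<bar>norm (z - v) - norm (z - y)\<bar> \<le> \<delta>"
    using norm_triangle_ineq3[of "z - v" "z - y"] \<delta> by simp
  have ind: "0 \<le> (L * c1 + 2 * c2) * \<delta> / \<epsilon> ^ d * indicat_real (ball z \<epsilon>) y"
    "0 \<le> 2 / \<epsilon> ^ d * (c1 * \<epsilon>) * indicat_real (cball z (\<epsilon> + \<delta>) - ball z (\<epsilon> - \<delta>)) y"
    using L0 \<delta>0 c \<epsilon> by auto
  consider "norm (z - v) < \<epsilon>" "norm (z - y) < \<epsilon>" | "norm (z - v) < \<epsilon>" "\<not> norm (z - y) < \<epsilon>"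
    | "\<not> norm (z - v) < \<epsilon>" "norm (z - y) < \<epsilon>" | "\<not> norm (z - v) < \<epsilon>" "\<not> norm (z - y) < \<epsilon>"
    by blast
  then show ?thesis
  proof cases
    case 1
    have "kv * F (v - z) - ky * F (y - z) = (kv - ky) * F (v - z) + ky * (F (v - z) - F (y - z))"
      by (simp add: algebra_simps)
    also have "\<bar>\<dots>\<bar> \<le> \<bar>kv - ky\<bar> * \<bar>F (v - z)\<bar> + \<bar>ky\<bar> * \<bar>F (v - z) - F (y - z)\<bar>"
      by (metis abs_mult abs_triangle_ineq)
    also have "\<dots> \<le> L * \<delta> / \<epsilon> / \<epsilon> ^ d * (c1 * \<epsilon>) + 2 / \<epsilon> ^ d * (c2 * \<delta>)"
    proof (intro add_mono mult_mono)
      have "\<bar>kv - ky\<bar> \<le> L * \<bar>norm (z - v) - norm (z - y)\<bar> / \<epsilon> / \<epsilon> ^ d"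
        unfolding kv_def ky_def using 1 by (intro cut_kernel_diff_le L \<epsilon>) auto
      also have "\<dots> \<le> L * \<delta> / \<epsilon> / \<epsilon> ^ d"
        using tri L0 \<epsilon> by (intro divide_right_mono mult_left_mono) auto
      finally show "\<bar>kv - ky\<bar> \<le> L * \<delta> / \<epsilon> / \<epsilon> ^ d" .
      show "\<bar>F (v - z)\<bar> \<le> c1 * \<epsilon>"
        using 1 by (intro F_le) (simp add: norm_minus_commute)
      have "\<bar>F (v - z) - F (y - z)\<bar> \<le> c2 * norm ((v - z) - (y - z))"
        using 1 by (intro F_diff) (simp_all add: norm_minus_commute)
      also have "\<dots> \<le> c2 * \<delta>"
        using \<delta> c by (intro mult_left_mono) (auto simp: norm_minus_commute)
      finally show "\<bar>F (v - z) - F (y - z)\<bar> \<le> c2 * \<delta>" .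
    qed (use k c \<epsilon> \<delta>0 L0 in auto)
    also have "\<dots> = (L * c1 + 2 * c2) * \<delta> / \<epsilon> ^ d * indicator (ball z \<epsilon>) y"
      using 1 \<epsilon> by (simp add: dist_norm field_simps)
    finally show ?thesis
      unfolding kv_def ky_def using ind by linarith
  next
    case 2
    have "ky = 0" using 2 by (simp add: ky_def cut_kernel_def)
    then have "\<bar>kv * F (v - z) - ky * F (y - z)\<bar> = kv * \<bar>F (v - z)\<bar>"
      using k by (simp add: abs_mult)
    also have "\<dots> \<le> 2 / \<epsilon> ^ d * (c1 * \<epsilon>)"
      using 2 k c \<epsilon> by (intro mult_mono F_le) (auto simp: norm_minus_commute)
    also have "\<dots> = 2 / \<epsilon> ^ d * (c1 * \<epsilon>) * indicator (cball z (\<epsilon> + \<delta>) - ball z (\<epsilon> - \<delta>)) y"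
      using 2 tri \<delta>0 by (auto simp: dist_norm)
    finally show ?thesis
      unfolding kv_def ky_def using ind by linarith
  next
    case 3
    have "kv = 0" using 3 by (simp add: kv_def cut_kernel_def)
    then have "\<bar>kv * F (v - z) - ky * F (y - z)\<bar> = ky * \<bar>F (y - z)\<bar>"
      using k by (simp add: abs_mult)
    also have "\<dots> \<le> 2 / \<epsilon> ^ d * (c1 * \<epsilon>)"
      using 3 k c \<epsilon> by (intro mult_mono F_le) (auto simp: norm_minus_commute)
    also have "\<dots> = 2 / \<epsilon> ^ d * (c1 * \<epsilon>) * indicator (cball z (\<epsilon> + \<delta>) - ball z (\<epsilon> - \<delta>)) y"
      using 3 tri \<delta>0 by (auto simp: dist_norm)
    finally show ?thesis
      unfolding kv_def ky_def using ind by linarith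
  next
    case 4
    then show ?thesis using ind \<epsilon> by (simp add: cut_kernel_def)
  qed
qed

end

section \<open>The sampling measure\<close>

locale sampled_domain = kernel \<eta> i1 for \<eta> :: "real \<Rightarrow> real" and i1 :: "'n::finite" +
  fixes \<Omega> :: "(real^'n) set" and \<rho> :: "real^'n \<Rightarrow> real" and R :: real
  assumes open_\<Omega>: "open \<Omega>" and bounded_\<Omega>: "bounded \<Omega>"
    and cont_\<rho>: "continuous_on (closure \<Omega>) \<rho>" and pos_\<rho>: "\<forall>y\<in>closure \<Omega>. \<rho> y > 0"
    and le_\<rho>: "\<And>y. y \<in> \<Omega> \<Longrightarrow> \<rho> y \<le> R"
    and prob: "prob_space (density_measure \<Omega> \<rho>)"
begin

abbreviation \<mu> :: "(real^'n) measure" where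
  "\<mu> \<equiv> density_measure \<Omega> \<rho>"

sublocale \<mu>: prob_space \<mu>
  by (rule prob)

lemma \<Omega>_borel [measurable]: "\<Omega> \<in> sets borel"
  using open_\<Omega> by simp

lemma sets_\<mu> [measurable_cong]: "sets \<mu> = sets (restrict_space lborel \<Omega>)"
  by (simp add: density_measure_def)

lemma space_\<mu>: "space \<mu> = \<Omega>"
  by (simp add: density_measure_def space_restrict_space)

lemma \<Omega>_nonempty: "\<Omega> \<noteq> {}"
  using \<mu>.not_empty by (simp add: space_\<mu>)

lemma R_pos: "R > 0"
proof -
  obtain y where "y \<in> \<Omega>" using \<Omega>_nonempty by blast
  then show ?thesis
    using le_\<rho>[of y] pos_\<rho> closure_subset[of \<Omega>] by fastforce
qed

lemma measurable_\<mu>: "f \<in> borel_measurable borel \<Longrightarrow> f \<in> borel_measurable \<mu>"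
  using measurable_cong_sets[OF sets_\<mu> refl] by (metis measurable_lborel2 measurable_restrict_space1)

lemma \<rho>_pos: "y \<in> \<Omega> \<Longrightarrow> \<rho> y > 0"
  using pos_\<rho> closure_subset by blast

lemma \<rho>_measurable: "\<rho> \<in> borel_measurable (restrict_space lborel \<Omega>)"
  using borel_measurable_continuous_on_restrict[of \<Omega> \<rho>] continuous_on_subset[OF cont_\<rho> closure_subset]
  by (simp add: measurable_def space_restrict_space sets_restrict_space)

text \<open>Outside the closure of \<open>\<Omega>\<close> nothing is known about
  \<open>\<rho>\<close>; the factor turns it into a Borel function on the whole space, to which
  changes of variables apply.\<close>

lemma \<rho>_indicator_measurable [measurable]: "(\<lambda>y. indicator \<Omega> y * \<rho> y) \<in> borel_measurable borel"
  using \<rho>_measurable borel_measurable_restrict_space_iff[of \<Omega> lborel \<rho>] by simp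

text \<open>The density is positive on \<open>\<Omega>\<close>, so both measures have the same null
  sets. This carries the essential supremum, taken for Lebesgue measure, over to
  \<open>\<mu>\<close>.\<close>

lemma AE_\<mu>_iff: "(AE y in \<mu>. P y) \<longleftrightarrow> (AE y in restrict_space lborel \<Omega>. P y)"
proof -
  have "(AE y in \<mu>. P y) \<longleftrightarrow> (AE y in restrict_space lborel \<Omega>. 0 < ennreal (\<rho> y) \<longrightarrow> P y)"
    unfolding density_measure_def using \<rho>_measurable by (intro AE_density) simp
  also have "\<dots> \<longleftrightarrow> (AE y in restrict_space lborel \<Omega>. P y)"
    by (intro AE_cong) (simp add: space_restrict_space \<rho>_pos)
  finally show ?thesis .
qed

lemma integral_\<mu>:
  assumes [measurable]: "f \<in> borel_measurable borel"
  shows "(\<integral>y. f y \<partial>\<mu>) = (\<integral>y. (indicator \<Omega> y * \<rho> y) * f y \<partial>lborel)"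
proof -
  have "(\<integral>y. f y \<partial>\<mu>) = (\<integral>y. \<rho> y *\<^sub>R f y \<partial>restrict_space lborel \<Omega>)"
    unfolding density_measure_def
  proof (rule integral_density)
    show "f \<in> borel_measurable (restrict_space lborel \<Omega>)"
      by (intro measurable_restrict_space1) simp
    show "AE y in restrict_space lborel \<Omega>. 0 \<le> \<rho> y"
      by (rule AE_I2) (auto simp: space_restrict_space intro: less_imp_le \<rho>_pos)
  qed (rule \<rho>_measurable)
  then show ?thesis
    by (simp add: integral_restrict_space mult.assoc)
qed

lemma Int_\<Omega>_sets_\<mu>: "A \<in> sets borel \<Longrightarrow> A \<inter> \<Omega> \<in> sets \<mu>"
  by (auto simp: sets_\<mu> sets_restrict_space)

lemma measure_\<mu>_le:
  assumes "A \<in> sets borel" "bounded A"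
  shows "measure \<mu> (A \<inter> \<Omega>) \<le> R * measure lborel A"
proof -
  have fin: "emeasure lborel A < \<infinity>" using assms(2) by (rule emeasure_bounded_finite)
  have "A \<inter> \<Omega> \<in> sets \<mu>"
    using assms(1) by (rule Int_\<Omega>_sets_\<mu>)
  then have "measure \<mu> (A \<inter> \<Omega>) = (\<integral>y. indicator (A \<inter> \<Omega>) y \<partial>\<mu>)"
    by (simp add: space_\<mu> Int_absorb2)
  also have "\<dots> = (\<integral>y. (indicator \<Omega> y * \<rho> y) * indicator (A \<inter> \<Omega>) y \<partial>lborel)"
    using assms by (intro integral_\<mu>) auto
  also have "\<dots> \<le> (\<integral>y. R * indicator A y \<partial>lborel)"
  proof (rule integral_mono')
    show "integrable lborel (\<lambda>y. R * indicat_real A y)"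
      using assms fin by (intro integrable_mult_right integrable_real_indicator) auto
  qed (use le_\<rho> R_pos \<rho>_pos in \<open>auto simp: indicator_def less_imp_le\<close>)
  finally show ?thesis using assms by simp
qed

text \<open>Substituting y = z + \<epsilon> u, the Jacobian cancels the normalisation of the kernel
  and the unit-scale weight remains.\<close>

lemma integral_\<mu>_rescale:
  assumes [measurable]: "F \<in> borel_measurable borel" and "\<epsilon> > 0"
  shows "(\<integral>y. cut_kernel CARD('n) \<eta> \<epsilon> (norm (z - y)) * F (y - z) \<partial>\<mu>)
    = (\<integral>u. weight u * (F (\<epsilon> *\<^sub>R u) * (indicator \<Omega> (z + \<epsilon> *\<^sub>R u) * \<rho> (z + \<epsilon> *\<^sub>R u))) \<partial>lborel)"
proof -
  let ?k = "\<lambda>y. cut_kernel CARD('n) \<eta> \<epsilon> (norm (z - y))"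
  have [measurable]: "?k \<in> borel_measurable borel"
    using measurable_compose[OF _ measurable_cut_kernel_norm[OF admissible \<open>\<epsilon> > 0\<close>], of "\<lambda>y. z - y"] by simp
  have k: "?k (z + \<epsilon> *\<^sub>R u) = weight u / \<epsilon> ^ CARD('n)" for u :: "real^'n"
    using cut_kernel_scale[OF \<open>\<epsilon> > 0\<close>, of "CARD('n)" \<eta> "norm u"] \<open>\<epsilon> > 0\<close> by (simp add: weight_def)
  have "(\<integral>y. ?k y * F (y - z) \<partial>\<mu>) = (\<integral>y. (indicator \<Omega> y * \<rho> y) * (?k y * F (y - z)) \<partial>lborel)"
    by (rule integral_\<mu>) measurable
  also have "\<dots> = \<epsilon> ^ CARD('n) * (\<integral>u. (indicator \<Omega> (z + \<epsilon> *\<^sub>R u) * \<rho> (z + \<epsilon> *\<^sub>R u)) * (?k (z + \<epsilon> *\<^sub>R u) * F (z + \<epsilon> *\<^sub>R u - z)) \<partial>lborel)"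
    using integral_lborel_affine[of "\<lambda>y. (indicator \<Omega> y * \<rho> y) * (?k y * F (y - z))" \<epsilon> z] \<open>\<epsilon> > 0\<close> by simp
  also have "\<dots> = (\<integral>u. \<epsilon> ^ CARD('n) * ((indicator \<Omega> (z + \<epsilon> *\<^sub>R u) * \<rho> (z + \<epsilon> *\<^sub>R u)) * (?k (z + \<epsilon> *\<^sub>R u) * F (z + \<epsilon> *\<^sub>R u - z))) \<partial>lborel)"
    by simp
  also have "\<dots> = (\<integral>u. weight u * (F (\<epsilon> *\<^sub>R u) * (indicator \<Omega> (z + \<epsilon> *\<^sub>R u) * \<rho> (z + \<epsilon> *\<^sub>R u))) \<partial>lborel)"
    unfolding k using \<open>\<epsilon> > 0\<close> by (intro Bochner_Integration.integral_cong) auto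
  finally show ?thesis .
qed

end

section \<open>Transport at a fixed sample size, with any almost sure bound \<delta> on the
  displacement\<close>

locale transported = sampled_domain \<eta> i1 \<Omega> \<rho> R
  for \<eta> and i1 :: "'n::finite" and \<Omega> \<rho> R +
  fixes n :: nat and x :: "nat \<Rightarrow> real^'n" and T :: "real^'n \<Rightarrow> real^'n" and \<delta> :: real
  assumes n_pos: "n \<ge> 1"
    and T_image: "T ` \<Omega> \<subseteq> x ` {1..n}"
    and T_measurable: "T \<in> measurable \<mu> borel"
    and T_push: "distr \<mu> borel T = empirical_measure x n"
    and T_close: "AE y in \<mu>. norm (y - T y) \<le> \<delta>"
begin

lemma average_samples:
  assumes "f \<in> borel_measurable borel"
  shows "(\<Sum>j=1..n. f (x j)) / real n = (\<integral>y. f (T y) \<partial>\<mu>)"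
  using integral_empirical_measure[OF assms, of x n] integral_distr[OF T_measurable assms]
  by (simp add: T_push)

text \<open>The displacement bound holds only almost everywhere, but a ball of radius \<delta> has
  positive measure and so contains a good point; its image is a sample.\<close>

lemma sample_near:
  assumes "\<delta> > 0" "ball c \<delta> \<subseteq> \<Omega>"
  obtains j where "j \<in> {1..n}" "dist c (x j) < 2 * \<delta>"
proof -
  have "\<exists>y\<in>ball c \<delta>. norm (y - T y) \<le> \<delta>"
  proof (rule ccontr)
    assume neg: "\<not> ?thesis"
    have "AE y in lborel. y \<in> \<Omega> \<longrightarrow> norm (y - T y) \<le> \<delta>"
      using T_close unfolding AE_\<mu>_iff by (subst (asm) AE_restrict_space_iff) auto
    then have "AE y in lborel. y \<notin> ball c \<delta>"
      using neg assms(2) by (auto elim!: eventually_mono)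
    then have "ball c \<delta> \<in> null_sets lborel"
      by (subst AE_iff_null_sets) auto
    then have "measure lborel (ball c \<delta>) = 0"
      by (auto simp: measure_def)
    then show False
      using content_ball_gt_0_iff[of c \<delta>] assms(1) by simp
  qed
  then obtain y where y: "dist c y < \<delta>" "norm (y - T y) \<le> \<delta>" "y \<in> \<Omega>"
    using assms(2) by auto
  then obtain j where j: "j \<in> {1..n}" "T y = x j"
    using T_image by blast
  have "dist c (x j) < 2 * \<delta>"
    using y j dist_triangle[of c "x j" y] by (simp add: dist_norm)
  then show ?thesis using that j by blast
qed

text \<open>If \<open>T y\<close> lies within \<epsilon> of \<open>z\<close>, then \<open>y\<close>
  lies within 2 \<epsilon>, as \<delta> is at most \<epsilon>. Doubling the radius costs
  \<open>2 ^ CARD('n)\<close>, the bound 2 on the kernel profile the remaining factor.\<close>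

lemma average_kernel_le:
  assumes "\<epsilon> > 0" "0 \<le> \<delta>" "\<delta> \<le> \<epsilon>"
  shows "(\<Sum>j=1..n. cut_kernel CARD('n) \<eta> \<epsilon> (norm (z - x j))) / real n
    \<le> 2 ^ (CARD('n) + 1) * R * unit_ball_vol CARD('n)"
proof -
  let ?k = "\<lambda>y. cut_kernel CARD('n) \<eta> \<epsilon> (norm (z - y))" and ?d = "CARD('n)"
  have k_meas [measurable]: "?k \<in> borel_measurable borel"
    using measurable_compose[OF _ measurable_cut_kernel_norm[OF admissible \<open>\<epsilon> > 0\<close>], of "\<lambda>y. z - y"] by simp
  have B: "ball z (2 * \<epsilon>) \<inter> \<Omega> \<in> sets \<mu>"
    by (rule Int_\<Omega>_sets_\<mu>) simp
  have "(\<Sum>j=1..n. ?k (x j)) / real n = (\<integral>y. ?k (T y) \<partial>\<mu>)"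
    by (rule average_samples) measurable
  also have "\<dots> \<le> (\<integral>y. 2 / \<epsilon> ^ ?d * indicator (ball z (2 * \<epsilon>) \<inter> \<Omega>) y \<partial>\<mu>)"
  proof (rule integral_mono_AE')
    show "integrable \<mu> (\<lambda>y. 2 / \<epsilon> ^ ?d * indicator (ball z (2 * \<epsilon>) \<inter> \<Omega>) y)"
      using B by (intro integrable_mult_right integrable_real_indicator) (auto simp: \<mu>.emeasure_finite less_top[symmetric])
    show "AE y in \<mu>. ?k (T y) \<le> 2 / \<epsilon> ^ ?d * indicator (ball z (2 * \<epsilon>) \<inter> \<Omega>) y"
      using T_close AE_space
    proof eventually_elim
      case (elim y)
      show ?case
      proof (cases "norm (z - T y) < \<epsilon>")
        case True
        have "norm (z - y) < 2 * \<epsilon>"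
          using True elim assms norm_triangle_ineq[of "z - T y" "T y - y"] by (simp add: norm_minus_commute)
        then show ?thesis
          using elim cut_kernel_le[OF admissible assms(1), of "norm (z - T y)" ?d] by (simp add: space_\<mu> dist_norm)
      next
        case False
        then show ?thesis using assms by (simp add: cut_kernel_def)
      qed
    qed
    show "AE y in \<mu>. 0 \<le> 2 / \<epsilon> ^ ?d * indicat_real (ball z (2 * \<epsilon>) \<inter> \<Omega>) y"
      using assms by simp
  qed
  also have "\<dots> = 2 / \<epsilon> ^ ?d * measure \<mu> (ball z (2 * \<epsilon>) \<inter> \<Omega>)"
    by (simp add: space_\<mu> Int_absorb2)
  also have "\<dots> \<le> 2 / \<epsilon> ^ ?d * (R * measure lborel (ball z (2 * \<epsilon>)))"
    using assms by (intro mult_left_mono measure_\<mu>_le) auto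
  also have "measure lborel (ball z (2 * \<epsilon>)) = unit_ball_vol ?d * (2 * \<epsilon>) ^ ?d"
    using content_ball[of "2 * \<epsilon>" z] assms by simp
  also have "2 / \<epsilon> ^ ?d * (R * (unit_ball_vol ?d * (2 * \<epsilon>) ^ ?d)) = 2 ^ (?d + 1) * R * unit_ball_vol ?d"
    using assms by (simp add: power_mult_distrib)
  finally show ?thesis .
qed

text \<open>Both terms become integrals over \<open>\<mu>\<close>, of a function at
  \<open>T y\<close> and at \<open>y\<close>; the pointwise comparison is then integrated. The full
  ball contributes the terms with \<open>L\<close> and \<open>c2\<close>, the shell the last
  one.\<close>

lemma average_minus_integral_le:
  assumes L: "L-lipschitz_on {0..} \<eta>" and \<epsilon>: "\<epsilon> > 0" and c: "0 \<le> c1" "0 \<le> c2"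
    and F_meas [measurable]: "F \<in> borel_measurable borel"
    and F_le: "\<And>w. norm w \<le> \<epsilon> \<Longrightarrow> \<bar>F w\<bar> \<le> c1 * \<epsilon>"
    and F_diff: "\<And>v w. norm v \<le> \<epsilon> \<Longrightarrow> norm w \<le> \<epsilon> \<Longrightarrow> \<bar>F v - F w\<bar> \<le> c2 * norm (v - w)"
    and \<delta>: "0 \<le> \<delta>" "\<delta> \<le> \<epsilon>"
  shows "\<bar>(\<Sum>j=1..n. cut_kernel CARD('n) \<eta> \<epsilon> (norm (z - x j)) * F (x j - z)) / real n
      - (\<integral>y. cut_kernel CARD('n) \<eta> \<epsilon> (norm (z - y)) * F (y - z) \<partial>\<mu>)\<bar>
    \<le> (L * c1 + 2 * c2 + 2 ^ (CARD('n) + 1) * real CARD('n) * c1) * R * unit_ball_vol CARD('n) * \<delta>"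
proof -
  let ?d = "CARD('n)" and ?V = "unit_ball_vol (real CARD('n))"
  define f where "f = (\<lambda>y. cut_kernel ?d \<eta> \<epsilon> (norm (z - y)) * F (y - z))"
  define A where "A = cball z (\<epsilon> + \<delta>) - ball z (\<epsilon> - \<delta>)"
  define a1 a2 where "a1 = (L * c1 + 2 * c2) * \<delta> / \<epsilon> ^ ?d" and "a2 = 2 / \<epsilon> ^ ?d * (c1 * \<epsilon>)"
  define g where "g = (\<lambda>y. a1 * indicator (ball z \<epsilon> \<inter> \<Omega>) y + a2 * indicator (A \<inter> \<Omega>) y)"
  have L0: "0 \<le> L" using L by (simp add: lipschitz_on_def)
  have a: "0 \<le> a1" "0 \<le> a2" using L0 c \<epsilon> \<delta> by (auto simp: a1_def a2_def)
  have [measurable]: "(\<lambda>y. cut_kernel ?d \<eta> \<epsilon> (norm (z - y))) \<in> borel_measurable borel"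
    using measurable_compose[OF _ measurable_cut_kernel_norm[OF admissible \<epsilon>], of "\<lambda>y. z - y"] by simp
  have f_meas [measurable]: "f \<in> borel_measurable borel"
    unfolding f_def by measurable
  have f_le: "\<bar>f y\<bar> \<le> 2 / \<epsilon> ^ ?d * (c1 * \<epsilon>)" for y
  proof (cases "norm (z - y) < \<epsilon>")
    case True
    have "\<bar>f y\<bar> = cut_kernel ?d \<eta> \<epsilon> (norm (z - y)) * \<bar>F (y - z)\<bar>"
      using cut_kernel_nonneg[OF admissible \<epsilon>] by (simp add: f_def abs_mult)
    also have "\<dots> \<le> 2 / \<epsilon> ^ ?d * (c1 * \<epsilon>)"
      using True c \<epsilon> by (intro mult_mono F_le cut_kernel_le[OF admissible]) (auto simp: norm_minus_commute)
    finally show ?thesis .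
  qed (use c \<epsilon> in \<open>simp add: f_def cut_kernel_def\<close>)
  have sets: "ball z \<epsilon> \<inter> \<Omega> \<in> sets \<mu>" "A \<inter> \<Omega> \<in> sets \<mu>"
    unfolding A_def by (rule Int_\<Omega>_sets_\<mu>, simp)+
  have fm: "f \<in> borel_measurable \<mu>" "(\<lambda>y. f (T y)) \<in> borel_measurable \<mu>"
    by (rule measurable_\<mu>[OF f_meas], rule measurable_compose[OF T_measurable f_meas])
  have int_f: "integrable \<mu> f"
  proof (rule \<mu>.integrable_const_bound)
    show "AE y in \<mu>. norm (f y) \<le> 2 / \<epsilon> ^ ?d * (c1 * \<epsilon>)"
      using f_le by (simp add: AE_I2)
  qed (rule fm)
  have int_fT: "integrable \<mu> (\<lambda>y. f (T y))"
  proof (rule \<mu>.integrable_const_bound)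
    show "AE y in \<mu>. norm (f (T y)) \<le> 2 / \<epsilon> ^ ?d * (c1 * \<epsilon>)"
      using f_le by (simp add: AE_I2)
  qed (rule fm)
  note int = int_f int_fT
  have int_ind: "integrable \<mu> (indicat_real (ball z \<epsilon> \<inter> \<Omega>))" "integrable \<mu> (indicat_real (A \<inter> \<Omega>))"
    using sets by (auto intro!: integrable_real_indicator simp: \<mu>.emeasure_finite less_top[symmetric])
  have "(\<Sum>j=1..n. f (x j)) / real n - (\<integral>y. f y \<partial>\<mu>) = (\<integral>y. f (T y) - f y \<partial>\<mu>)"
    using average_samples[OF f_meas] int by simp
  also have "\<bar>\<dots>\<bar> \<le> (\<integral>y. \<bar>f (T y) - f y\<bar> \<partial>\<mu>)"
    by (rule integral_abs_bound)
  also have "\<dots> \<le> (\<integral>y. g y \<partial>\<mu>)"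
  proof (rule integral_mono_AE)
    show "integrable \<mu> g" unfolding g_def using int_ind by simp
    show "AE y in \<mu>. \<bar>f (T y) - f y\<bar> \<le> g y"
      using T_close AE_space
    proof eventually_elim
      case (elim y)
      then have "indicat_real (ball z \<epsilon> \<inter> \<Omega>) y = indicat_real (ball z \<epsilon>) y"
        "indicat_real (A \<inter> \<Omega>) y = indicat_real A y"
        by (auto simp: space_\<mu> indicator_def)
      then show ?case
        unfolding f_def g_def a1_def a2_def A_def
        using kernel_times_diff_le[OF L \<epsilon> c F_le F_diff, where y = y and v = "T y" and z = z and d = ?d] elim by simp
    qed
  qed (use int in auto)
  also have "\<dots> = a1 * measure \<mu> (ball z \<epsilon> \<inter> \<Omega>) + a2 * measure \<mu> (A \<inter> \<Omega>)"
    unfolding g_def using int_ind by (simp add: space_\<mu> Int_absorb2)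
  also have "\<dots> \<le> a1 * (R * (?V * \<epsilon> ^ ?d)) + a2 * (R * (?V * (2 ^ ?d * real ?d * \<epsilon> ^ (?d - 1) * \<delta>)))"
  proof (intro add_mono mult_left_mono)
    have "measure \<mu> (ball z \<epsilon> \<inter> \<Omega>) \<le> R * measure lborel (ball z \<epsilon>)"
      by (intro measure_\<mu>_le) auto
    then show "measure \<mu> (ball z \<epsilon> \<inter> \<Omega>) \<le> R * (?V * \<epsilon> ^ ?d)"
      using content_ball[of \<epsilon> z] \<epsilon> by simp
    have "measure \<mu> (A \<inter> \<Omega>) \<le> R * measure lborel A"
      by (intro measure_\<mu>_le) (auto simp: A_def intro: bounded_subset[OF bounded_cball])
    also have "measure lborel A = measure lborel (cball z (\<epsilon> + \<delta>)) - measure lborel (ball z (\<epsilon> - \<delta>))"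
      unfolding A_def using \<delta> emeasure_bounded_finite[OF bounded_cball, of z "\<epsilon> + \<delta>"] by (intro measure_Diff) auto
    also have "\<dots> = ?V * ((\<epsilon> + \<delta>) ^ ?d - (\<epsilon> - \<delta>) ^ ?d)"
      using content_ball[of "\<epsilon> - \<delta>" z] content_cball[of "\<epsilon> + \<delta>" z] \<delta> \<epsilon> by (simp add: algebra_simps)
    also have "R * \<dots> \<le> R * (?V * (2 ^ ?d * real ?d * \<epsilon> ^ (?d - 1) * \<delta>))"
    proof (intro mult_left_mono)
      \<comment> \<open>The shell has thickness 2 \<delta> and outer radius at most 2 \<epsilon>;
        the two sources of powers of 2 combine to \<open>2 ^ ?d\<close>.\<close>
      have "(\<epsilon> + \<delta>) ^ ?d - (\<epsilon> - \<delta>) ^ ?d \<le> real ?d * (\<epsilon> + \<delta>) ^ (?d - 1) * ((\<epsilon> + \<delta>) - (\<epsilon> - \<delta>))"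
        using \<delta> \<epsilon> by (intro power_diff_le) auto
      also have "\<dots> \<le> real ?d * (2 * \<epsilon>) ^ (?d - 1) * ((\<epsilon> + \<delta>) - (\<epsilon> - \<delta>))"
        using \<delta> \<epsilon> by (intro mult_right_mono mult_left_mono power_mono) auto
      also have "\<dots> = 2 ^ ?d * real ?d * \<epsilon> ^ (?d - 1) * \<delta>"
        using power_Suc[of "2 :: real" "?d - 1"] by (simp add: power_mult_distrib)
      finally show "(\<epsilon> + \<delta>) ^ ?d - (\<epsilon> - \<delta>) ^ ?d \<le> 2 ^ ?d * real ?d * \<epsilon> ^ (?d - 1) * \<delta>" .
    qed (use R_pos in auto)
    finally show "measure \<mu> (A \<inter> \<Omega>) \<le> R * (?V * (2 ^ ?d * real ?d * \<epsilon> ^ (?d - 1) * \<delta>))" .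
  qed (use a in auto)
  also have "\<dots> = (L * c1 + 2 * c2 + 2 ^ (?d + 1) * real ?d * c1) * R * ?V * \<delta>"
  proof -
    have p: "\<epsilon> * \<epsilon> ^ (?d - 1) = \<epsilon> ^ ?d"
      using power_Suc[of \<epsilon> "?d - 1"] by simp
    have "a2 * \<epsilon> ^ (?d - 1) = 2 * c1 * (\<epsilon> * \<epsilon> ^ (?d - 1)) / \<epsilon> ^ ?d"
      by (simp add: a2_def)
    also have "\<dots> = 2 * c1"
      unfolding p using \<epsilon> by simp
    finally have "a2 * \<epsilon> ^ (?d - 1) = 2 * c1" .
    moreover have "a1 * \<epsilon> ^ ?d = (L * c1 + 2 * c2) * \<delta>"
      using \<epsilon> by (simp add: a1_def)
    moreover have "a1 * (R * (?V * \<epsilon> ^ ?d)) + a2 * (R * (?V * (2 ^ ?d * real ?d * \<epsilon> ^ (?d - 1) * \<delta>)))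
      = (a1 * \<epsilon> ^ ?d) * R * ?V + (a2 * \<epsilon> ^ (?d - 1)) * R * ?V * 2 ^ ?d * real ?d * \<delta>"
      by (simp add: mult_ac)
    ultimately show ?thesis by (simp add: algebra_simps)
  qed
  finally show ?thesis unfolding f_def .
qed

end

text \<open>The definition converts an extended real to a real, sending infinite values to 0, so
  finiteness from both sides must be shown first. Boundedness of domain and range gives the upper
  side.\<close>

lemma AE_norm_diff_le_Linf_dist_id:
  fixes \<Omega> :: "(real^'n::finite) set"
  assumes "open \<Omega>" "bounded \<Omega>" "\<Omega> \<noteq> {}"
    and T: "T \<in> borel_measurable (restrict_space lborel \<Omega>)" "bounded (T ` \<Omega>)"
  shows "AE y in restrict_space lborel \<Omega>. norm (y - T y) \<le> Linf_dist_id \<Omega> T" "0 \<le> Linf_dist_id \<Omega> T"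
proof -
  let ?M = "restrict_space lborel \<Omega>"
  let ?f = "\<lambda>y. ereal (norm (y - T y))"
  \<comment> \<open>On a space of measure zero the essential supremum lies below every constant, so
    the lower bound 0 needs positive measure.\<close>
  have "\<Omega> \<notin> null_sets lborel"
    using assms(1,3) by (metis negligible_iff_null_sets null_sets_completionI open_not_negligible)
  then have "emeasure lborel \<Omega> \<noteq> 0"
    using assms(1) by (auto simp: null_sets_def)
  then have ne: "emeasure ?M (space ?M) \<noteq> 0"
    using assms(1) by (simp add: emeasure_restrict_space space_restrict_space)
  obtain c where c: "\<And>y. y \<in> \<Omega> \<Longrightarrow> norm (y - T y) \<le> c"
  proof -
    obtain c1 c2 where "\<And>y. y \<in> \<Omega> \<Longrightarrow> norm y \<le> c1" "\<And>y. y \<in> \<Omega> \<Longrightarrow> norm (T y) \<le> c2"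
      using assms(2) T(2) by (auto simp: bounded_iff)
    then have "norm (y - T y) \<le> c1 + c2" if "y \<in> \<Omega>" for y
      using that norm_triangle_ineq4[of y "T y"] by fastforce
    then show ?thesis using that by blast
  qed
  have m: "?f \<in> borel_measurable ?M"
  proof -
    have "(\<lambda>y :: real^'n. y) \<in> borel_measurable ?M"
      by (rule measurable_restrict_space1) simp
    then show ?thesis
      using T(1) by (intro borel_measurable_ereal borel_measurable_diff measurable_compose[OF _ borel_measurable_norm])
  qed
  have up: "esssup ?M ?f \<le> ereal c"
    using m c by (intro esssup_I) (auto simp: space_restrict_space)
  have "esssup ?M (\<lambda>_. 0 :: ereal) \<le> esssup ?M ?f"
    by (rule esssup_mono) auto
  then have lo: "0 \<le> esssup ?M ?f"
    using esssup_const[OF ne, of "0 :: ereal"] by simp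
  then obtain r where r: "esssup ?M ?f = ereal r"
    using up by (cases "esssup ?M ?f") auto
  then show "0 \<le> Linf_dist_id \<Omega> T"
    using lo by (simp add: Linf_dist_id_def)
  show "AE y in ?M. norm (y - T y) \<le> Linf_dist_id \<Omega> T"
    using esssup_AE[of ?f ?M] r by (simp add: Linf_dist_id_def)
qed

section \<open>Discrete and continuous extrema\<close>

text \<open>Transfers results on discrete maxima to minima. That the centre is a sample keeps the
  set non-empty, so that both extrema are meaningful.\<close>

lemma ball_min_eq: "ball_min x n r w z = - ball_max x n r (\<lambda>y. - w y) z" if "r \<ge> 0" "z \<in> x ` {1..n}"
proof -
  let ?S = "w ` (cball z r \<inter> x ` {1..n})"
  have "z \<in> cball z r \<inter> x ` {1..n}" using that by simp
  then have fin: "finite ?S" and ne: "?S \<noteq> {}" by blast+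
  have "Max (uminus ` ?S) = - Min ?S"
    using fin ne by (intro Max_eqI) (auto intro: Min_in)
  then show ?thesis
    by (simp add: ball_min_def ball_max_def image_image)
qed

context transported
begin

text \<open>Samples in the ball are competitors for the continuous maximum, so one direction costs
  only \<open>e\<close>. For the other, some sample inside the ball must lie near the maximiser; the
  Lipschitz bound for \<open>Q\<close> then gives the error. For radius 0, as for
  \<open>p = 2\<close>, the centre itself is that sample.\<close>

lemma ball_max_near_quadratic_max:
  assumes "bounded_form b a" and r: "r \<ge> 0" "r = 0 \<or> 2 * \<delta> \<le> r" and "\<delta> > 0"
    and j: "j \<in> {1..n}" and sub: "cball (x j) r \<subseteq> \<Omega>" and s: "norm (x j - z) + r \<le> s"
    and approx: "\<And>y. norm (y - z) \<le> s \<Longrightarrow> \<bar>\<phi> y - \<phi> z - quadratic g b (y - z)\<bar> \<le> e"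
  shows "\<bar>ball_max x n r \<phi> (x j) - \<phi> z - quadratic_max g b r (x j - z)\<bar> \<le> e + 4 * (norm g + a * s) * \<delta>"
proof -
  interpret bounded_form g b a by fact
  let ?P = "cball (x j) r \<inter> x ` {1..n}"
  have "x j \<in> ?P" using j r by simp
  then have fin: "finite (\<phi> ` ?P)" and ne: "\<phi> ` ?P \<noteq> {}" by blast+
  have s0: "s \<ge> 0" using s r norm_ge_zero[of "x j - z"] by linarith
  have ns: "norm (y - z) \<le> s" if "dist (x j) y \<le> r" for y
    using that s norm_triangle_ineq[of "y - x j" "x j - z"] by (simp add: dist_norm norm_minus_commute)
  have "ball_max x n r \<phi> (x j) \<le> \<phi> z + quadratic_max g b r (x j - z) + e"
    unfolding ball_max_def
  proof (rule Max.boundedI[OF fin ne], safe)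
    fix y l assume y: "x l \<in> cball (x j) r"
    have "quadratic g b (x l - z) \<le> quadratic_max g b r (x j - z)"
      using quadratic_le_max[of "x l - x j" r "x j - z"] y by (simp add: dist_norm norm_minus_commute)
    then show "\<phi> (x l) \<le> \<phi> z + quadratic_max g b r (x j - z) + e"
      using approx[OF ns, of "x l"] y by simp
  qed
  moreover have "0 \<le> 4 * (norm g + a * s) * \<delta>"
    using a_nonneg s0 \<open>\<delta> > 0\<close> by simp
  moreover have "\<phi> z + quadratic_max g b r (x j - z) - (e + 4 * (norm g + a * s) * \<delta>) \<le> ball_max x n r \<phi> (x j)"
  proof -
    obtain h where h: "norm h \<le> r" "quadratic_max g b r (x j - z) = quadratic g b (x j - z + h)"
      using quadratic_max_attained r by metis
    obtain l where l: "l \<in> {1..n}" "dist (x j) (x l) \<le> r" "norm (x l - (x j + h)) \<le> 4 * \<delta>"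
    proof (cases "r = 0")
      case True
      then show ?thesis using that[of j] j h \<open>\<delta> > 0\<close> by simp
    next
      case False
      then have r2: "2 * \<delta> \<le> r" "r > 0" using r by auto
      \<comment> \<open>The maximiser is first drawn 2 \<delta> towards the centre, so that a sample
        within 2 \<delta> of the new point is still in the ball. Both moves together give the
        distance 4 \<delta>.\<close>
      define t where "t = 2 * \<delta> / r"
      have t: "0 \<le> t" "t \<le> 1" "t * r = 2 * \<delta>" using r2 \<open>\<delta> > 0\<close> by (auto simp: t_def)
      define c where "c = x j + (1 - t) *\<^sub>R h"
      have "norm ((1 - t) *\<^sub>R h) \<le> (1 - t) * r"
        using t h by (simp add: mult_left_mono)
      moreover have "dist (x j) c = norm ((1 - t) *\<^sub>R h)"
        by (simp add: c_def dist_norm)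
      ultimately have cx: "dist (x j) c \<le> r - 2 * \<delta>"
        using t by (simp add: left_diff_distrib)
      have "norm (t *\<^sub>R h) \<le> t * r"
        using mult_left_mono[OF h(1) t(1)] t by simp
      then have ch: "norm (c - (x j + h)) \<le> 2 * \<delta>"
        using t by (simp add: c_def algebra_simps)
      have "ball c \<delta> \<subseteq> \<Omega>"
      proof -
        have "ball c \<delta> \<subseteq> cball (x j) r"
        proof
          fix y assume "y \<in> ball c \<delta>"
          then show "y \<in> cball (x j) r"
            using cx dist_triangle[of "x j" y c] \<open>\<delta> > 0\<close> by simp
        qed
        then show ?thesis using sub by blast
      qed
      then obtain l where l: "l \<in> {1..n}" "dist c (x l) < 2 * \<delta>"
        using sample_near[OF \<open>\<delta> > 0\<close>] by metis
      show ?thesis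
      proof (rule that[OF l(1)])
        show "dist (x j) (x l) \<le> r"
          using l(2) cx dist_triangle[of "x j" "x l" c] by simp
        show "norm (x l - (x j + h)) \<le> 4 * \<delta>"
          using l(2) ch dist_triangle[of "x l" "x j + h" c] norm_minus_commute[of c "x l"]
          unfolding dist_norm by linarith
      qed
    qed
    have "norm (x j - z + h) \<le> s"
      using s h(1) norm_triangle_ineq[of "x j - z" h] by linarith
    then have "\<bar>quadratic g b (x l - z) - quadratic g b (x j - z + h)\<bar>
        \<le> (norm g + a * s) * norm (x l - z - (x j - z + h))"
      using ns[OF l(2)] by (intro quadratic_diff_le)
    also have "\<dots> \<le> (norm g + a * s) * (4 * \<delta>)"
      using l(3) a_nonneg s0 by (intro mult_left_mono) (auto simp: algebra_simps)
    also have "\<dots> = 4 * (norm g + a * s) * \<delta>" by simp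
    finally have "\<phi> z + quadratic_max g b r (x j - z) - (e + 4 * (norm g + a * s) * \<delta>) \<le> \<phi> (x l)"
      using approx[OF ns[OF l(2)]] unfolding h(2) by linarith
    also have "\<dots> \<le> ball_max x n r \<phi> (x j)"
      unfolding ball_max_def using fin l by (intro Max_ge) auto
    finally show ?thesis .
  qed
  ultimately show ?thesis by linarith
qed

lemma ball_midrange_near_quadratic_midrange:
  assumes form: "bounded_form b a" and r: "r \<ge> 0" "r = 0 \<or> 2 * \<delta> \<le> r" and "\<delta> > 0"
    and j: "j \<in> {1..n}" and sub: "cball (x j) r \<subseteq> \<Omega>" and s: "norm (x j - z) + r \<le> s"
    and approx: "\<And>y. norm (y - z) \<le> s \<Longrightarrow> \<bar>\<phi> y - \<phi> z - quadratic g b (y - z)\<bar> \<le> e"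
  shows "\<bar>ball_max x n r \<phi> (x j) + ball_min x n r \<phi> (x j) - 2 * \<phi> z - quadratic_midrange g b r (x j - z)\<bar>
    \<le> 2 * e + 8 * (norm g + a * s) * \<delta>"
proof -
  interpret bounded_form g b a by fact
  have "\<bar>ball_max x n r \<phi> (x j) - \<phi> z - quadratic_max g b r (x j - z)\<bar> \<le> e + 4 * (norm g + a * s) * \<delta>"
    using assms by (intro ball_max_near_quadratic_max)
  moreover have "\<bar>ball_max x n r (\<lambda>y. - \<phi> y) (x j) - (- \<phi> z) - quadratic_max (- g) (\<lambda>u v. - b u v) r (x j - z)\<bar>
      \<le> e + 4 * (norm (- g) + a * s) * \<delta>"
  proof (rule ball_max_near_quadratic_max[OF negated r \<open>\<delta> > 0\<close> j sub s])
    show "\<bar>- \<phi> y - - \<phi> z - quadratic (- g) (\<lambda>u v. - b u v) (y - z)\<bar> \<le> e" if "norm (y - z) \<le> s" for y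
      using approx[OF that] by (simp add: quadratic_uminus abs_if split: if_splits)
  qed
  moreover have "ball_min x n r \<phi> (x j) = - ball_max x n r (\<lambda>y. - \<phi> y) (x j)"
    using r j by (intro ball_min_eq) auto
  ultimately show ?thesis
    unfolding quadratic_midrange_def norm_minus_cancel by linarith
qed

end

section \<open>Size and regularity of max plus min\<close>

context bounded_form
begin

lemma continuous_quadratic_midrange: "r \<ge> 0 \<Longrightarrow> continuous_on UNIV (quadratic_midrange g b r)"
  using continuous_quadratic_max[of r] bounded_form.continuous_quadratic_max[OF negated, of r "- g"]
  unfolding quadratic_midrange_def[abs_def] by (intro continuous_on_diff)

lemma quadratic_midrange_diff_le:
  assumes "r \<ge> 0" "norm u + r \<le> s" "norm v + r \<le> s"
  shows "\<bar>quadratic_midrange g b r u - quadratic_midrange g b r v\<bar> \<le> 2 * (norm g + a * s) * norm (u - v)"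
  using quadratic_max_diff_le[OF assms] bounded_form.quadratic_max_diff_le[OF negated assms, of "- g"]
  unfolding quadratic_midrange_def norm_minus_cancel by linarith

text \<open>The terms \<open>r * norm g\<close> of maximum and minimum cancel.\<close>

lemma quadratic_midrange_first_order:
  assumes "r \<ge> 0"
  shows "\<bar>quadratic_midrange g b r w - 2 * (g \<bullet> w)\<bar> \<le> 2 * a * (norm w + r)^2"
  using quadratic_max_first_order[OF assms, of w] bounded_form.quadratic_max_first_order[OF negated assms, of "- g" w]
  unfolding quadratic_midrange_def by simp

lemma quadratic_midrange_le:
  assumes "r \<ge> 0" "norm w + r \<le> s"
  shows "\<bar>quadratic_midrange g b r w\<bar> \<le> 2 * (norm g + a * s) * s"
proof -
  have *: "\<bar>quadratic_midrange g b r w\<bar> \<le> 2 * norm g * norm w + 2 * a * (norm w + r)^2"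
    using quadratic_midrange_first_order[OF assms(1), of w] Cauchy_Schwarz_ineq2[of g w] by linarith
  have "norm w \<le> s" using assms by linarith
  then have "2 * norm g * norm w \<le> 2 * norm g * s"
    by (intro mult_left_mono) auto
  moreover have "2 * a * (norm w + r)^2 \<le> 2 * a * s^2"
    using assms a_nonneg by (intro mult_left_mono power_mono) auto
  ultimately show ?thesis using * by (simp add: algebra_simps power2_eq_square)
qed

end

section \<open>Kernel averages of max plus min\<close>

context kernel
begin

lemma integrable_weight_continuous:
  fixes f :: "real^'n \<Rightarrow> real"
  assumes "continuous_on UNIV f"
  shows "integrable lborel (\<lambda>u. weight u * f u)"
proof -
  have "compact (f ` cball 0 1)"
    using assms continuous_on_subset by (intro compact_continuous_image) auto
  then obtain c where "\<forall>u\<in>cball 0 1. \<bar>f u\<bar> \<le> c"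
    using compact_imp_bounded[of "f ` cball 0 1"] by (auto simp: bounded_real)
  then show ?thesis
    using assms by (intro integrable_weight_mult[of f c] borel_measurable_continuous_onI) auto
qed

lemma integral_weight_odd:
  fixes f :: "real^'n \<Rightarrow> real"
  assumes "f \<in> borel_measurable borel" "\<And>u. f (- u) = - f u"
  shows "(\<integral>u. weight u * f u \<partial>lborel) = 0"
  using integral_weight_uminus[OF assms(1)] assms(2) by simp

text \<open>Here the antipodal estimate is applied under the integral. The parameter
  \<open>t\<close> stands for the second moment of the form, later a multiple of the
  Laplacian.\<close>

lemma integral_weight_quadratic_midrange:
  fixes g :: "real^'n"
  assumes form: "bounded_form b a" and "g \<noteq> 0" and \<epsilon>: "\<epsilon> > 0" and k: "k \<ge> 0"
    and trace: "has_bochner_integral lborel (\<lambda>u. weight u * b u u) t"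
  shows "\<bar>(\<integral>u. weight u * quadratic_midrange g b (k * \<epsilon>) (\<epsilon> *\<^sub>R u) \<partial>lborel)
      - \<epsilon>^2 * (t + k^2 * b (sgn g) (sgn g) * (2 * sigma2 TYPE('n) \<eta>))\<bar>
    \<le> 2 * sigma2 TYPE('n) \<eta> * (8 * a^3 * ((k + 1) * \<epsilon>)^4 / (norm g)^2)"
proof -
  interpret bounded_form g b a by fact
  interpret neg: bounded_form "- g" "\<lambda>u v. - b u v" a by (rule negated)
  define r where "r = k * \<epsilon>"
  have r: "r \<ge> 0" using k \<epsilon> by (simp add: r_def)
  define e where "e = sgn g"
  define M1 where "M1 u = quadratic_max g b r (\<epsilon> *\<^sub>R u)" for u
  define M2 where "M2 u = quadratic_max (- g) (\<lambda>u v. - b u v) r (\<epsilon> *\<^sub>R u)" for u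
  have cont: "continuous_on UNIV M1" "continuous_on UNIV M2"
    unfolding M1_def[abs_def] M2_def[abs_def]
    by (rule continuous_on_compose2[OF continuous_quadratic_max[OF r]], auto intro!: continuous_intros)
       (rule continuous_on_compose2[OF neg.continuous_quadratic_max[OF r]], auto intro!: continuous_intros)
  have contm: "continuous_on UNIV (\<lambda>u. M2 (- u))"
    by (rule continuous_on_compose2[OF cont(2)]) (auto intro!: continuous_intros)
  have bb: "bounded_bilinear b"
    using bil by (simp add: bilinear_conv_bounded_bilinear)
  have contb: "continuous_on UNIV (\<lambda>u. b u e + b e u)" "continuous_on UNIV (\<lambda>u. b u u)"
    by (intro continuous_intros bounded_bilinear.continuous_on[OF bb])+
  define q where "q u = b (\<epsilon> *\<^sub>R u + r *\<^sub>R e) (\<epsilon> *\<^sub>R u + r *\<^sub>R e)" for u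
  have q_eq: "q u = \<epsilon>^2 * b u u + \<epsilon> * r * (b u e + b e u) + r^2 * b e e" for u
    by (simp add: q_def b_simps power2_eq_square algebra_simps)
  have contq: "continuous_on UNIV q"
    unfolding q_eq[abs_def] by (intro continuous_intros contb)
  have "(\<integral>u. weight u * q u \<partial>lborel)
      = (\<integral>u. \<epsilon>^2 * (weight u * b u u) + \<epsilon> * r * (weight u * (b u e + b e u)) + r^2 * b e e * (weight u * 1) \<partial>lborel)"
    by (simp add: q_eq algebra_simps)
  also have "\<dots> = \<epsilon>^2 * t + \<epsilon> * r * (\<integral>u. weight u * (b u e + b e u) \<partial>lborel) + r^2 * b e e * (2 * sigma2 TYPE('n) \<eta>)"
  proof -
    note int = integrable_weight_continuous[OF contb(1)] integrable_weight_continuous[OF continuous_on_const[of _ 1]]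
      has_bochner_integral_iff[THEN iffD1, OF trace]
    show ?thesis
      using int by (simp add: integral_weight del: integral_mult_right_zero flip: distrib_left)
  qed
  \<comment> \<open>The mixed term is odd, so the displacement by \<open>r *\<^sub>R e\<close>
    contributes only its square.\<close>
  also have "(\<integral>u. weight u * (b u e + b e u) \<partial>lborel) = 0"
    using contb(1) by (intro integral_weight_odd borel_measurable_continuous_onI) (simp_all add: b_simps)
  finally have Q: "(\<integral>u. weight u * q u \<partial>lborel) = \<epsilon>^2 * (t + k^2 * b e e * (2 * sigma2 TYPE('n) \<eta>))"
    by (simp add: r_def power_mult_distrib algebra_simps)
  have "(\<integral>u. weight u * quadratic_midrange g b r (\<epsilon> *\<^sub>R u) \<partial>lborel)
      = (\<integral>u. weight u * M1 u \<partial>lborel) - (\<integral>u. weight u * M2 u \<partial>lborel)"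
    using integrable_weight_continuous[OF cont(1)] integrable_weight_continuous[OF cont(2)]
    by (simp add: quadratic_midrange_def M1_def M2_def right_diff_distrib)
  \<comment> \<open>The weight is even: the minimum around \<open>\<epsilon> *\<^sub>R u\<close> may
    be replaced by the one around its antipode, although the two differ pointwise.\<close>
  also have "(\<integral>u. weight u * M2 u \<partial>lborel) = (\<integral>u. weight u * M2 (- u) \<partial>lborel)"
    using cont(2) by (intro integral_weight_uminus[symmetric] borel_measurable_continuous_onI)
  finally have "(\<integral>u. weight u * quadratic_midrange g b r (\<epsilon> *\<^sub>R u) \<partial>lborel) - (\<integral>u. weight u * q u \<partial>lborel)
      = (\<integral>u. weight u * (M1 u - M2 (- u) - q u) \<partial>lborel)"
    using integrable_weight_continuous[OF cont(1)] integrable_weight_continuous[OF contm] integrable_weight_continuous[OF contq]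
    by (simp add: right_diff_distrib)
  also have "\<bar>\<dots>\<bar> \<le> 2 * sigma2 TYPE('n) \<eta> * (8 * a^3 * ((k + 1) * \<epsilon>)^4 / (norm g)^2)"
  proof (rule integral_weight_le)
    show "(\<lambda>u. M1 u - M2 (- u) - q u) \<in> borel_measurable borel"
      using cont(1) contm contq by (intro borel_measurable_continuous_onI continuous_on_diff)
    fix u :: "real^'n" assume u: "norm u < 1"
    have "\<bar>M1 u - M2 (- u) - q u\<bar> \<le> 8 * a^3 * (norm (\<epsilon> *\<^sub>R u) + r)^4 / (norm g)^2"
      using quadratic_max_antipodal[OF r \<open>g \<noteq> 0\<close>, of "\<epsilon> *\<^sub>R u"] by (simp add: M1_def M2_def q_def e_def)
    also have "\<dots> \<le> 8 * a^3 * ((k + 1) * \<epsilon>)^4 / (norm g)^2"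
    proof (intro divide_right_mono mult_left_mono power_mono)
      show "norm (\<epsilon> *\<^sub>R u) + r \<le> (k + 1) * \<epsilon>"
        using u \<epsilon> mult_left_mono[of "norm u" 1 \<epsilon>] by (simp add: r_def algebra_simps)
    qed (use r a_nonneg in auto)
    finally show "\<bar>M1 u - M2 (- u) - q u\<bar> \<le> 8 * a^3 * ((k + 1) * \<epsilon>)^4 / (norm g)^2" .
  qed
  finally show ?thesis unfolding Q by (simp add: r_def e_def)
qed

end

section \<open>The averaged extrema\<close>

context sampled_domain
begin

text \<open>The density is expanded at \<open>z\<close>. Its constant part meets the averaged form.
  Its linear part meets \<open>2 * (g \<bullet> w)\<close> and gives the cross term of gradient and
  density gradient in the divergence.\<close>

lemma integral_kernel_quadratic_midrange:
  assumes form: "bounded_form b a" and g: "g \<noteq> 0" "norm g \<le> G" and \<epsilon>: "0 < \<epsilon>" "\<epsilon> \<le> 1" and k: "k \<ge> 0"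
    and z: "z \<in> \<Omega>" and sub: "cball z \<epsilon> \<subseteq> \<Omega>"
    and trace: "has_bochner_integral lborel (\<lambda>u. weight u * b u u) t"
    and \<rho>: "\<And>y. norm (y - z) \<le> \<epsilon> \<Longrightarrow> \<bar>\<rho> y - \<rho> z - h \<bullet> (y - z)\<bar> \<le> c2 * norm (y - z) ^ 2"
    and h: "norm h \<le> H" and c2: "c2 \<ge> 0"
  shows "\<bar>(\<integral>y. cut_kernel CARD('n) \<eta> \<epsilon> (norm (z - y)) * quadratic_midrange g b (k * \<epsilon>) (y - z) \<partial>\<mu>)
      - \<epsilon>^2 * (\<rho> z * (t + k^2 * b (sgn g) (sgn g) * (2 * sigma2 TYPE('n) \<eta>)) + 4 * sigma1 i1 \<eta> * (g \<bullet> h))\<bar>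
    \<le> 2 * sigma2 TYPE('n) \<eta> * (2 * (G + a * (k + 1)) * (k + 1) * c2 + 2 * a * (k + 1)^2 * H) * \<epsilon>^3
      + 16 * R * sigma2 TYPE('n) \<eta> * a^3 * (k + 1)^4 * (\<epsilon>^4 / (norm g)^2)"
proof -
  interpret bounded_form g b a by fact
  define r where "r = k * \<epsilon>"
  have r: "r \<ge> 0" using k \<epsilon> by (simp add: r_def)
  define F where "F u = quadratic_midrange g b r (\<epsilon> *\<^sub>R u)" for u
  \<comment> \<open>\<open>f2\<close> is the error of linearising max plus min against the linear
    part of the density, \<open>f3\<close> the contribution of the density's Taylor remainder. As
    \<open>F\<close> is O(\<epsilon>) with O(\<epsilon>^2) deviation from its linear part, both are
    O(\<epsilon>^3).\<close>
  define f2 where "f2 u = F u * (h \<bullet> (\<epsilon> *\<^sub>R u)) - 2 * \<epsilon>^2 * ((g \<bullet> u) * (h \<bullet> u))" for u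
  define f3 where "f3 u = F u * (indicator \<Omega> (z + \<epsilon> *\<^sub>R u) * \<rho> (z + \<epsilon> *\<^sub>R u) - \<rho> z - h \<bullet> (\<epsilon> *\<^sub>R u))" for u
  have Fc: "continuous_on UNIV F"
    unfolding F_def[abs_def]
    by (rule continuous_on_compose2[OF continuous_quadratic_midrange[OF r]]) (auto intro!: continuous_intros)
  have f2c: "continuous_on UNIV f2"
    unfolding f2_def[abs_def] by (intro continuous_intros Fc)
  have [measurable]: "F \<in> borel_measurable borel" "f2 \<in> borel_measurable borel"
    using Fc f2c by (auto intro: borel_measurable_continuous_onI)
  have [measurable]: "(\<lambda>u. indicator \<Omega> (z + \<epsilon> *\<^sub>R u) * \<rho> (z + \<epsilon> *\<^sub>R u)) \<in> borel_measurable borel"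
    by (rule measurable_compose[OF _ \<rho>_indicator_measurable]) simp
  have f3m [measurable]: "f3 \<in> borel_measurable borel"
    unfolding f3_def[abs_def] by measurable
  have nu: "norm (\<epsilon> *\<^sub>R u) + r \<le> (k + 1) * \<epsilon>" "norm (\<epsilon> *\<^sub>R u) \<le> \<epsilon>" if "norm u < 1" for u :: "real^'n"
    using that \<epsilon> mult_left_mono[of "norm u" 1 \<epsilon>] by (auto simp: r_def algebra_simps)
  have F_le: "\<bar>F u\<bar> \<le> 2 * (G + a * (k + 1)) * (k + 1) * \<epsilon>" if "norm u < 1" for u
  proof -
    have "\<bar>F u\<bar> \<le> 2 * (norm g + a * ((k + 1) * \<epsilon>)) * ((k + 1) * \<epsilon>)"
      unfolding F_def using nu[OF that] by (intro quadratic_midrange_le r)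
    also have "\<dots> \<le> 2 * (G + a * (k + 1)) * ((k + 1) * \<epsilon>)"
      using g a_nonneg k \<epsilon> mult_left_le[of \<epsilon> "k + 1"]
      by (intro mult_right_mono mult_left_mono add_mono) auto
    finally show ?thesis by (simp add: mult_ac)
  qed
  have f2_le: "\<bar>f2 u\<bar> \<le> 2 * a * (k + 1)^2 * H * \<epsilon>^3" if u: "norm u < 1" for u
  proof -
    have "f2 u = (F u - 2 * (g \<bullet> (\<epsilon> *\<^sub>R u))) * (h \<bullet> (\<epsilon> *\<^sub>R u))"
      by (simp add: f2_def power2_eq_square algebra_simps)
    also have "\<bar>\<dots>\<bar> \<le> (2 * a * ((k + 1) * \<epsilon>)^2) * (H * \<epsilon>)"
      unfolding abs_mult
    proof (intro mult_mono)
      have "\<bar>F u - 2 * (g \<bullet> (\<epsilon> *\<^sub>R u))\<bar> \<le> 2 * a * (norm (\<epsilon> *\<^sub>R u) + r)^2"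
        unfolding F_def by (rule quadratic_midrange_first_order[OF r])
      also have "\<dots> \<le> 2 * a * ((k + 1) * \<epsilon>)^2"
        using nu[OF u] a_nonneg r by (intro mult_left_mono power_mono) auto
      finally show "\<bar>F u - 2 * (g \<bullet> (\<epsilon> *\<^sub>R u))\<bar> \<le> 2 * a * ((k + 1) * \<epsilon>)^2" .
      have "\<bar>h \<bullet> (\<epsilon> *\<^sub>R u)\<bar> \<le> norm h * norm (\<epsilon> *\<^sub>R u)"
        by (rule Cauchy_Schwarz_ineq2)
      also have "\<dots> \<le> H * \<epsilon>"
        using nu[OF u] h order_trans[OF norm_ge_zero h] by (intro mult_mono) auto
      finally show "\<bar>h \<bullet> (\<epsilon> *\<^sub>R u)\<bar> \<le> H * \<epsilon>" .
    qed (use a_nonneg in auto)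
    also have "\<dots> = 2 * a * (k + 1)^2 * H * \<epsilon>^3"
      by (simp add: power_mult_distrib power2_eq_square power3_eq_cube)
    finally show ?thesis .
  qed
  have f3_le: "\<bar>f3 u\<bar> \<le> 2 * (G + a * (k + 1)) * (k + 1) * c2 * \<epsilon>^3" if u: "norm u < 1" for u
  proof -
    have "z + \<epsilon> *\<^sub>R u \<in> \<Omega>"
      using nu[OF u] sub by (auto simp: subset_iff dist_norm)
    then have "\<bar>f3 u\<bar> = \<bar>F u\<bar> * \<bar>\<rho> (z + \<epsilon> *\<^sub>R u) - \<rho> z - h \<bullet> (\<epsilon> *\<^sub>R u)\<bar>"
      by (simp add: f3_def abs_mult)
    also have "\<dots> \<le> (2 * (G + a * (k + 1)) * (k + 1) * \<epsilon>) * (c2 * \<epsilon>^2)"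
    proof (intro mult_mono F_le u)
      have "\<bar>\<rho> (z + \<epsilon> *\<^sub>R u) - \<rho> z - h \<bullet> (\<epsilon> *\<^sub>R u)\<bar> \<le> c2 * norm (\<epsilon> *\<^sub>R u)^2"
        using \<rho>[of "z + \<epsilon> *\<^sub>R u"] nu[OF u] by simp
      also have "\<dots> \<le> c2 * \<epsilon>^2"
        using nu[OF u] c2 by (intro mult_left_mono power_mono) auto
      finally show "\<bar>\<rho> (z + \<epsilon> *\<^sub>R u) - \<rho> z - h \<bullet> (\<epsilon> *\<^sub>R u)\<bar> \<le> c2 * \<epsilon>^2" .
      show "0 \<le> 2 * (G + a * (k + 1)) * (k + 1) * \<epsilon>"
        using order_trans[OF norm_ge_zero g(2)] a_nonneg k \<epsilon> by simp
    qed auto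
    finally show ?thesis by (simp add: power2_eq_square power3_eq_cube mult_ac)
  qed
  note int = integrable_weight_continuous[OF Fc] integrable_weight_continuous[OF f2c]
    integrable_weight_mult[OF f3m f3_le]
    has_bochner_integral_weight_inner_inner[of g h, unfolded has_bochner_integral_iff]
  have "(\<integral>y. cut_kernel CARD('n) \<eta> \<epsilon> (norm (z - y)) * quadratic_midrange g b r (y - z) \<partial>\<mu>)
      = (\<integral>u. weight u * (F u * (indicator \<Omega> (z + \<epsilon> *\<^sub>R u) * \<rho> (z + \<epsilon> *\<^sub>R u))) \<partial>lborel)"
    unfolding F_def using \<epsilon>
    by (intro integral_\<mu>_rescale borel_measurable_continuous_onI continuous_quadratic_midrange r)
  also have "\<dots> = (\<integral>u. \<rho> z * (weight u * F u) + weight u * f2 u + 2 * \<epsilon>^2 * (weight u * ((g \<bullet> u) * (h \<bullet> u))) + weight u * f3 u \<partial>lborel)"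
    by (intro Bochner_Integration.integral_cong) (auto simp: f2_def f3_def algebra_simps)
  also have "\<dots> = \<rho> z * (\<integral>u. weight u * F u \<partial>lborel) + (\<integral>u. weight u * f2 u \<partial>lborel)
      + 2 * \<epsilon>^2 * (2 * sigma1 i1 \<eta> * (g \<bullet> h)) + (\<integral>u. weight u * f3 u \<partial>lborel)"
    using int by simp
  finally have eq: "(\<integral>y. cut_kernel CARD('n) \<eta> \<epsilon> (norm (z - y)) * quadratic_midrange g b r (y - z) \<partial>\<mu>)
      - \<epsilon>^2 * (\<rho> z * (t + k^2 * b (sgn g) (sgn g) * (2 * sigma2 TYPE('n) \<eta>)) + 4 * sigma1 i1 \<eta> * (g \<bullet> h))
      = \<rho> z * ((\<integral>u. weight u * F u \<partial>lborel) - \<epsilon>^2 * (t + k^2 * b (sgn g) (sgn g) * (2 * sigma2 TYPE('n) \<eta>)))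
        + (\<integral>u. weight u * f2 u \<partial>lborel) + (\<integral>u. weight u * f3 u \<partial>lborel)"
    by (simp add: algebra_simps)
  have "\<bar>\<rho> z * ((\<integral>u. weight u * F u \<partial>lborel) - \<epsilon>^2 * (t + k^2 * b (sgn g) (sgn g) * (2 * sigma2 TYPE('n) \<eta>)))\<bar>
      \<le> R * (2 * sigma2 TYPE('n) \<eta> * (8 * a^3 * ((k + 1) * \<epsilon>)^4 / (norm g)^2))"
    unfolding abs_mult F_def r_def
    using z le_\<rho> \<rho>_pos R_pos
    by (intro mult_mono integral_weight_quadratic_midrange[OF form g(1) \<epsilon>(1) k trace]) (auto simp: less_imp_le)
  moreover have "\<dots> = 16 * R * sigma2 TYPE('n) \<eta> * a^3 * (k + 1)^4 * (\<epsilon>^4 / (norm g)^2)"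
    by (simp add: power_mult_distrib)
  moreover have "\<bar>\<integral>u. weight u * f2 u \<partial>lborel\<bar> \<le> 2 * sigma2 TYPE('n) \<eta> * (2 * a * (k + 1)^2 * H * \<epsilon>^3)"
    by (intro integral_weight_le f2_le) measurable
  moreover have "\<bar>\<integral>u. weight u * f3 u \<partial>lborel\<bar> \<le> 2 * sigma2 TYPE('n) \<eta> * (2 * (G + a * (k + 1)) * (k + 1) * c2 * \<epsilon>^3)"
    by (intro integral_weight_le f3_le) measurable
  moreover have "2 * sigma2 TYPE('n) \<eta> * (2 * (G + a * (k + 1)) * (k + 1) * c2 + 2 * a * (k + 1)^2 * H) * \<epsilon>^3
    = 2 * sigma2 TYPE('n) \<eta> * (2 * a * (k + 1)^2 * H * \<epsilon>^3)
      + 2 * sigma2 TYPE('n) \<eta> * (2 * (G + a * (k + 1)) * (k + 1) * c2 * \<epsilon>^3)"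
    by (simp add: algebra_simps)
  ultimately show ?thesis
    using eq unfolding r_def by linarith
qed

end

context transported
begin

lemma average_ball_midrange_near:
  assumes form: "bounded_form b a" and g: "norm g \<le> G" and \<epsilon>: "0 < \<epsilon>" "\<epsilon> \<le> 1" and k: "k \<ge> 0"
    and \<delta>: "0 < \<delta>" "\<delta> \<le> \<epsilon>" "k = 0 \<or> 2 * \<delta> \<le> k * \<epsilon>"
    and sub: "cball z ((k + 1) * \<epsilon>) \<subseteq> \<Omega>"
    and \<phi>: "\<And>y. norm (y - z) \<le> (k + 1) * \<epsilon> \<Longrightarrow> \<bar>\<phi> y - \<phi> z - quadratic g b (y - z)\<bar> \<le> c3 * norm (y - z) ^ 3"
    and c3: "c3 \<ge> 0"
  shows "\<bar>(\<Sum>j=1..n. cut_kernel CARD('n) \<eta> \<epsilon> (norm (z - x j)) * (ball_max x n (k * \<epsilon>) \<phi> (x j) + ball_min x n (k * \<epsilon>) \<phi> (x j) - 2 * \<phi> z)) / real n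
      - (\<Sum>j=1..n. cut_kernel CARD('n) \<eta> \<epsilon> (norm (z - x j)) * quadratic_midrange g b (k * \<epsilon>) (x j - z)) / real n\<bar>
    \<le> (2 * c3 * (k + 1)^3 * \<epsilon>^3 + 8 * (G + a * (k + 1)) * \<delta>) * (2 ^ (CARD('n) + 1) * R * unit_ball_vol CARD('n))"
proof -
  interpret bounded_form g b a by fact
  define E where "E = 2 * c3 * (k + 1)^3 * \<epsilon>^3 + 8 * (G + a * (k + 1)) * \<delta>"
  define w where "w j = cut_kernel CARD('n) \<eta> \<epsilon> (norm (z - x j))" for j
  define m where "m j = ball_max x n (k * \<epsilon>) \<phi> (x j) + ball_min x n (k * \<epsilon>) \<phi> (x j) - 2 * \<phi> z" for j
  define q where "q j = quadratic_midrange g b (k * \<epsilon>) (x j - z)" for j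
  have w: "w j \<ge> 0" for j
    unfolding w_def using cut_kernel_nonneg[OF admissible] \<epsilon> by simp
  have G: "0 \<le> G" using order_trans[OF norm_ge_zero g] .
  have E: "E \<ge> 0" using c3 k \<epsilon> G a_nonneg \<delta> by (simp add: E_def)
  have "\<bar>w j * m j - w j * q j\<bar> \<le> w j * E" if j: "j \<in> {1..n}" for j
  proof (cases "norm (z - x j) < \<epsilon>")
    case True
    have xz: "norm (x j - z) + k * \<epsilon> \<le> (k + 1) * \<epsilon>"
      using True by (simp add: norm_minus_commute algebra_simps)
    \<comment> \<open>The kernel reaches \<epsilon> and the extrema a further
      \<open>k * \<epsilon>\<close>: this is the origin of the distance
      \<open>(k + 1) * \<epsilon>\<close> to the boundary.\<close>
    have "cball (x j) (k * \<epsilon>) \<subseteq> cball z ((k + 1) * \<epsilon>)"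
    proof
      fix y assume "y \<in> cball (x j) (k * \<epsilon>)"
      then show "y \<in> cball z ((k + 1) * \<epsilon>)"
        using xz dist_triangle[of z y "x j"] by (simp add: dist_norm norm_minus_commute)
    qed
    then have "\<bar>m j - q j\<bar> \<le> 2 * (c3 * ((k + 1) * \<epsilon>)^3) + 8 * (norm g + a * ((k + 1) * \<epsilon>)) * \<delta>"
      unfolding m_def q_def
    proof (intro ball_midrange_near_quadratic_midrange[OF form _ _ \<delta>(1) j _ xz])
      fix y assume y: "norm (y - z) \<le> (k + 1) * \<epsilon>"
      have "c3 * norm (y - z) ^ 3 \<le> c3 * ((k + 1) * \<epsilon>)^3"
        using y c3 by (intro mult_left_mono power_mono) auto
      then show "\<bar>\<phi> y - \<phi> z - quadratic g b (y - z)\<bar> \<le> c3 * ((k + 1) * \<epsilon>)^3"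
        using \<phi>[OF y] by linarith
    qed (use k \<epsilon> \<delta> sub in auto)
    also have "\<dots> \<le> E"
    proof -
      have "(k + 1) * \<epsilon> \<le> k + 1"
        using k \<epsilon> mult_left_le[of \<epsilon> "k + 1"] by simp
      then have "8 * (norm g + a * ((k + 1) * \<epsilon>)) * \<delta> \<le> 8 * (G + a * (k + 1)) * \<delta>"
        using g a_nonneg \<delta> by (intro mult_right_mono mult_left_mono add_mono) auto
      then show ?thesis by (simp add: E_def power_mult_distrib)
    qed
    finally have "w j * \<bar>m j - q j\<bar> \<le> w j * E"
      using w by (rule mult_left_mono)
    then show ?thesis
      using w[of j] by (simp add: abs_mult flip: right_diff_distrib)
  next
    case False
    then have "w j = 0" using \<epsilon> by (simp add: w_def cut_kernel_def)
    then show ?thesis by simp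
  qed
  then have "\<bar>\<Sum>j=1..n. w j * m j - w j * q j\<bar> \<le> (\<Sum>j=1..n. w j * E)"
    by (intro order_trans[OF sum_abs sum_mono])
  then have "\<bar>\<Sum>j=1..n. w j * m j - w j * q j\<bar> / real n \<le> (\<Sum>j=1..n. w j * E) / real n"
    by (rule divide_right_mono) simp
  also have "\<dots> = E * ((\<Sum>j=1..n. w j) / real n)"
    by (simp add: sum_distrib_left mult.commute)
  also have "\<dots> \<le> E * (2 ^ (CARD('n) + 1) * R * unit_ball_vol CARD('n))"
    unfolding w_def using E \<epsilon> \<delta> by (intro mult_left_mono average_kernel_le) auto
  finally show ?thesis
    unfolding E_def w_def[symmetric] m_def[symmetric] q_def[symmetric]
    by (simp add: sum_subtractf flip: diff_divide_distrib)
qed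

text \<open>Three comparisons are chained: discrete by quadratic extrema, sample average by
  integral, integral by its limit. Since \<epsilon> is at most 1, \<open>G + a * (k + 1)\<close>
  bounds all Lipschitz constants that occur.\<close>

lemma average_ball_midrange_estimate:
  assumes form: "bounded_form b a" and g: "g \<noteq> 0" "norm g \<le> G" and \<epsilon>: "0 < \<epsilon>" "\<epsilon> \<le> 1" and k: "k \<ge> 0"
    and \<delta>: "0 < \<delta>" "\<delta> \<le> \<epsilon>" "k = 0 \<or> 2 * \<delta> \<le> k * \<epsilon>"
    and L: "L-lipschitz_on {0..} \<eta>"
    and sub: "cball z ((k + 1) * \<epsilon>) \<subseteq> \<Omega>"
    and trace: "has_bochner_integral lborel (\<lambda>u. weight u * b u u) t"
    and \<phi>: "\<And>y. norm (y - z) \<le> (k + 1) * \<epsilon> \<Longrightarrow> \<bar>\<phi> y - \<phi> z - quadratic g b (y - z)\<bar> \<le> c3 * norm (y - z) ^ 3"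
    and c3: "c3 \<ge> 0"
    and \<rho>: "\<And>y. norm (y - z) \<le> \<epsilon> \<Longrightarrow> \<bar>\<rho> y - \<rho> z - h \<bullet> (y - z)\<bar> \<le> c2 * norm (y - z) ^ 2"
    and h: "norm h \<le> H" and c2: "c2 \<ge> 0"
  shows "\<bar>(\<Sum>j=1..n. cut_kernel CARD('n) \<eta> \<epsilon> (norm (z - x j)) * (ball_max x n (k * \<epsilon>) \<phi> (x j) + ball_min x n (k * \<epsilon>) \<phi> (x j) - 2 * \<phi> z)) / real n
      - \<epsilon>^2 * (\<rho> z * (t + k^2 * b (sgn g) (sgn g) * (2 * sigma2 TYPE('n) \<eta>)) + 4 * sigma1 i1 \<eta> * (g \<bullet> h))\<bar>
    \<le> (2 * c3 * (k + 1)^3 * (2 ^ (CARD('n) + 1) * R * unit_ball_vol CARD('n))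
        + 2 * sigma2 TYPE('n) \<eta> * (2 * (G + a * (k + 1)) * (k + 1) * c2 + 2 * a * (k + 1)^2 * H)) * \<epsilon>^3
      + (8 * (G + a * (k + 1)) * (2 ^ (CARD('n) + 1) * R * unit_ball_vol CARD('n))
        + (L * (2 * (G + a * (k + 1)) * (k + 1)) + 2 * (2 * (G + a * (k + 1)))
            + 2 ^ (CARD('n) + 1) * real CARD('n) * (2 * (G + a * (k + 1)) * (k + 1))) * R * unit_ball_vol CARD('n)) * \<delta>
      + (16 * R * sigma2 TYPE('n) \<eta> * a^3 * (k + 1)^4) * (\<epsilon>^4 / (norm g)^2)"
    (is "\<bar>?S - ?T\<bar> \<le> _")
proof -
  interpret bounded_form g b a by fact
  have r: "k * \<epsilon> \<ge> 0" using k \<epsilon> by simp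
  have P: "0 \<le> G + a * (k + 1)"
    using order_trans[OF norm_ge_zero g(2)] a_nonneg k by simp
  have s1: "(k + 1) * \<epsilon> \<le> k + 1"
    using k \<epsilon> mult_left_le[of \<epsilon> "k + 1"] by simp
  have P_le: "norm g + a * ((k + 1) * \<epsilon>) \<le> G + a * (k + 1)"
    using g s1 a_nonneg by (intro add_mono mult_left_mono) auto
  have z: "z \<in> \<Omega>" "cball z \<epsilon> \<subseteq> \<Omega>"
  proof -
    have "\<epsilon> \<le> (k + 1) * \<epsilon>" using k \<epsilon> by (simp add: algebra_simps)
    then show "cball z \<epsilon> \<subseteq> \<Omega>" using sub subset_cball by blast
    then show "z \<in> \<Omega>" using \<epsilon> by auto
  qed
  let ?A = "(\<Sum>j=1..n. cut_kernel CARD('n) \<eta> \<epsilon> (norm (z - x j)) * quadratic_midrange g b (k * \<epsilon>) (x j - z)) / real n"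
  let ?I = "\<integral>y. cut_kernel CARD('n) \<eta> \<epsilon> (norm (z - y)) * quadratic_midrange g b (k * \<epsilon>) (y - z) \<partial>\<mu>"
  have "\<bar>?A - ?I\<bar> \<le> (L * (2 * (G + a * (k + 1)) * (k + 1)) + 2 * (2 * (G + a * (k + 1)))
      + 2 ^ (CARD('n) + 1) * real CARD('n) * (2 * (G + a * (k + 1)) * (k + 1))) * R * unit_ball_vol CARD('n) * \<delta>"
  proof (rule average_minus_integral_le[OF L \<epsilon>(1)])
    show "\<bar>quadratic_midrange g b (k * \<epsilon>) w\<bar> \<le> 2 * (G + a * (k + 1)) * (k + 1) * \<epsilon>" if "norm w \<le> \<epsilon>" for w
    proof -
      have "\<bar>quadratic_midrange g b (k * \<epsilon>) w\<bar> \<le> 2 * (norm g + a * ((k + 1) * \<epsilon>)) * ((k + 1) * \<epsilon>)"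
        using that by (intro quadratic_midrange_le r) (simp add: algebra_simps)
      also have "\<dots> \<le> 2 * (G + a * (k + 1)) * ((k + 1) * \<epsilon>)"
        using P_le k \<epsilon> by (intro mult_right_mono mult_left_mono) auto
      finally show ?thesis by (simp add: mult_ac)
    qed
    show "\<bar>quadratic_midrange g b (k * \<epsilon>) v - quadratic_midrange g b (k * \<epsilon>) w\<bar> \<le> 2 * (G + a * (k + 1)) * norm (v - w)"
      if "norm v \<le> \<epsilon>" "norm w \<le> \<epsilon>" for v w
    proof -
      have "\<bar>quadratic_midrange g b (k * \<epsilon>) v - quadratic_midrange g b (k * \<epsilon>) w\<bar>
          \<le> 2 * (norm g + a * ((k + 1) * \<epsilon>)) * norm (v - w)"
        using that by (intro quadratic_midrange_diff_le r) (simp_all add: algebra_simps)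
      also have "\<dots> \<le> 2 * (G + a * (k + 1)) * norm (v - w)"
        using P_le by (intro mult_right_mono mult_left_mono) auto
      finally show ?thesis .
    qed
    show "quadratic_midrange g b (k * \<epsilon>) \<in> borel_measurable borel"
      by (intro borel_measurable_continuous_onI continuous_quadratic_midrange r)
  qed (use P k \<delta> in auto)
  moreover have "\<bar>?S - ?A\<bar> \<le> (2 * c3 * (k + 1)^3 * \<epsilon>^3 + 8 * (G + a * (k + 1)) * \<delta>) * (2 ^ (CARD('n) + 1) * R * unit_ball_vol CARD('n))"
    by (rule average_ball_midrange_near[OF form g(2) \<epsilon> k \<delta> sub \<phi> c3])
  moreover have "\<bar>?I - ?T\<bar> \<le> 2 * sigma2 TYPE('n) \<eta> * (2 * (G + a * (k + 1)) * (k + 1) * c2 + 2 * a * (k + 1)^2 * H) * \<epsilon>^3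
      + 16 * R * sigma2 TYPE('n) \<eta> * a^3 * (k + 1)^4 * (\<epsilon>^4 / (norm g)^2)"
    by (rule integral_kernel_quadratic_midrange[OF form g \<epsilon> k z trace \<rho> h c2])
  ultimately have "\<bar>?S - ?T\<bar> \<le> (L * (2 * (G + a * (k + 1)) * (k + 1)) + 2 * (2 * (G + a * (k + 1)))
      + 2 ^ (CARD('n) + 1) * real CARD('n) * (2 * (G + a * (k + 1)) * (k + 1))) * R * unit_ball_vol CARD('n) * \<delta>
    + (2 * c3 * (k + 1)^3 * \<epsilon>^3 + 8 * (G + a * (k + 1)) * \<delta>) * (2 ^ (CARD('n) + 1) * R * unit_ball_vol CARD('n))
    + (2 * sigma2 TYPE('n) \<eta> * (2 * (G + a * (k + 1)) * (k + 1) * c2 + 2 * a * (k + 1)^2 * H) * \<epsilon>^3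
      + 16 * R * sigma2 TYPE('n) \<eta> * a^3 * (k + 1)^4 * (\<epsilon>^4 / (norm g)^2))"
    by linarith
  \<comment> \<open>Regrouping by powers, stated for variables so that the long constants are
    treated as atoms.\<close>
  moreover have "X * \<delta> + (u * e + v * \<delta>) * M + (w * e + q) = (u * M + w) * e + (v * M + X) * \<delta> + q"
    for X u e v M w q :: real
    by (simp add: algebra_simps)
  ultimately show ?thesis
    by (simp only:)
qed

end

section \<open>Consistency of the operators\<close>

lemma grad_inner_axis: "grad f z \<bullet> axis i 1 = partial i f z"
  by (simp add: grad_def inner_axis)

lemma norm_grad_le:
  fixes f :: "real^'n::finite \<Rightarrow> real" and K :: real
  assumes "\<And>i. \<bar>partial i f z\<bar> \<le> K"
  shows "norm (grad f z) \<le> CARD('n) * K"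
proof -
  have "norm (grad f z) \<le> (\<Sum>i\<in>UNIV. \<bar>grad f z $ i\<bar>)"
    by (rule norm_le_l1_cart)
  also have "\<dots> \<le> (\<Sum>i\<in>(UNIV :: 'n set). K)"
    by (rule sum_mono) (simp add: grad_def assms)
  finally show ?thesis by simp
qed

definition hessian_form :: "(real^'n::finite \<Rightarrow> real) \<Rightarrow> real^'n \<Rightarrow> real^'n \<Rightarrow> real^'n \<Rightarrow> real" where
  "hessian_form f z u v = (\<Sum>i\<in>UNIV. u $ i * (\<Sum>j\<in>UNIV. v $ j * partial j (partial i f) z))"

lemma bounded_form_hessian:
  fixes f :: "real^'n::finite \<Rightarrow> real" and K :: real
  assumes K: "\<And>i j. \<bar>partial j (partial i f) z\<bar> \<le> K"
  shows "bounded_form (hessian_form f z) ((real CARD('n))^2 * K)"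
proof
  show "bilinear (hessian_form f z)"
    unfolding bilinear_def linear_iff hessian_form_def
    by (simp add: algebra_simps sum.distrib sum_distrib_left)
  show "\<bar>hessian_form f z u v\<bar> \<le> (real CARD('n))^2 * K * norm u * norm v" for u v
  proof -
    have "\<bar>hessian_form f z u v\<bar> \<le> CARD('n) * (CARD('n) * K * norm v) * norm u"
      unfolding hessian_form_def by (intro abs_sum_weighted_le K)
    then show ?thesis by (simp add: power2_eq_square mult_ac)
  qed
  have "0 \<le> K" using K order_trans[OF abs_ge_zero] by blast
  then show "0 \<le> (real CARD('n))^2 * K" by simp
qed

lemma divergence_square_grad:
  fixes \<rho> \<phi> :: "real^'n::finite \<Rightarrow> real"
  assumes \<rho>: "\<rho> differentiable (at z)" and \<phi>: "\<And>i. partial i \<phi> differentiable (at z)"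
  shows "divergence (\<lambda>y. (\<rho> y)^2 *\<^sub>R grad \<phi> y) z
    = 2 * \<rho> z * (grad \<phi> z \<bullet> grad \<rho> z) + (\<rho> z)^2 * (\<Sum>i\<in>UNIV. partial i (partial i \<phi>) z)"
proof -
  have "partial i (\<lambda>y. ((\<rho> y)^2 *\<^sub>R grad \<phi> y) $ i) z
      = 2 * \<rho> z * (partial i \<phi> z * partial i \<rho> z) + (\<rho> z)^2 * partial i (partial i \<phi>) z" for i
  proof -
    have "((\<lambda>y. (\<rho> y * \<rho> y) * partial i \<phi> y) has_derivative
        (\<lambda>h. (\<rho> z * \<rho> z) * (grad (partial i \<phi>) z \<bullet> h) + (\<rho> z * (grad \<rho> z \<bullet> h) + (grad \<rho> z \<bullet> h) * \<rho> z) * partial i \<phi> z)) (at z)"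
      by (intro has_derivative_mult has_derivative_grad \<rho> \<phi>)
    then have "((\<lambda>y. ((\<rho> y)^2 *\<^sub>R grad \<phi> y) $ i) has_derivative
        (\<lambda>h. (\<rho> z * \<rho> z) * (grad (partial i \<phi>) z \<bullet> h) + (\<rho> z * (grad \<rho> z \<bullet> h) + (grad \<rho> z \<bullet> h) * \<rho> z) * partial i \<phi> z)) (at z)"
      by (simp add: grad_def power2_eq_square)
    from partial_eqI[OF this, of i] show ?thesis
      unfolding grad_inner_axis by (simp add: power2_eq_square algebra_simps)
  qed
  then show ?thesis
    by (simp add: divergence_def inner_vec_def grad_def sum.distrib sum_distrib_left)
qed

text \<open>Puts the operator into the form that the averages produce; the division by 2 corresponds
  to the prefactor of the discrete operator.\<close>

lemma L_continuum_eq: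
  fixes \<rho> \<phi> :: "real^'n::finite \<Rightarrow> real" and i1 :: 'n
  assumes \<rho>: "\<rho> differentiable (at z)" "\<rho> z > 0" and \<phi>: "\<And>i. partial i \<phi> differentiable (at z)"
  shows "L_continuum i1 \<eta> p \<rho> \<phi> z
    = (\<rho> z * (2 * sigma1 i1 \<eta> * (\<Sum>i\<in>UNIV. partial i (partial i \<phi>) z)
        + (kappa i1 \<eta> p)^2 * hessian_form \<phi> z (sgn (grad \<phi> z)) (sgn (grad \<phi> z)) * (2 * sigma2 TYPE('n) \<eta>))
      + 4 * sigma1 i1 \<eta> * (grad \<phi> z \<bullet> grad \<rho> z)) / 2"
proof -
  have "hessian_form \<phi> z (sgn (grad \<phi> z)) (sgn (grad \<phi> z))
      = (\<Sum>i\<in>UNIV. \<Sum>j\<in>UNIV. (1 / (norm (grad \<phi> z))^2) * (partial j (partial i \<phi>) z * partial j \<phi> z * partial i \<phi> z))"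
    by (simp add: hessian_form_def sgn_div_norm grad_def sum_distrib_left power2_eq_square field_simps)
  \<comment> \<open>Exchanging the sums merely exchanges the names of the indices; the order of
    differentiation stays as it is.\<close>
  also have "\<dots> = (1 / (norm (grad \<phi> z))^2) * (\<Sum>i\<in>UNIV. \<Sum>j\<in>UNIV. partial i (partial j \<phi>) z * partial i \<phi> z * partial j \<phi> z)"
    by (subst sum.swap) (simp add: sum_distrib_left)
  finally have "(1 / (norm (grad \<phi> z))^2) * (\<Sum>i\<in>UNIV. \<Sum>j\<in>UNIV. partial i (partial j \<phi>) z * partial i \<phi> z * partial j \<phi> z)
      = hessian_form \<phi> z (sgn (grad \<phi> z)) (sgn (grad \<phi> z))" ..
  then have "L_continuum i1 \<eta> p \<rho> \<phi> z = sigma1 i1 \<eta> * (1 / \<rho> z) * divergence (\<lambda>y. (\<rho> y)^2 *\<^sub>R grad \<phi> y) z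
     + (kappa i1 \<eta> p)^2 * sigma2 TYPE('n) \<eta> * \<rho> z * hessian_form \<phi> z (sgn (grad \<phi> z)) (sgn (grad \<phi> z))"
    unfolding L_continuum_def by (simp only: mult.assoc)
  also have "sigma1 i1 \<eta> * (1 / \<rho> z) * divergence (\<lambda>y. (\<rho> y)^2 *\<^sub>R grad \<phi> y) z
      = sigma1 i1 \<eta> * (2 * (grad \<phi> z \<bullet> grad \<rho> z) + \<rho> z * (\<Sum>i\<in>UNIV. partial i (partial i \<phi>) z))"
    unfolding divergence_square_grad[OF \<rho>(1) \<phi>]
    using \<rho>(2) by (simp add: field_simps power2_eq_square)
  finally show ?thesis
    by (simp add: algebra_simps)
qed

text \<open>A ball is connected, so if it left \<open>\<Omega>\<close> it would meet the frontier.
  Joining further points \<open>A\<close> to the frontier can only decrease the distance.\<close>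

lemma cball_subset_of_infdist_frontier:
  fixes z :: "'a::real_normed_vector"
  assumes "z \<in> \<Omega>" "infdist z (A \<union> frontier \<Omega>) > s"
  shows "cball z s \<subseteq> \<Omega>"
proof (rule ccontr)
  assume "\<not> ?thesis"
  then obtain y where y: "y \<in> cball z s" "y \<notin> \<Omega>" by blast
  \<comment> \<open>Existence of \<open>y\<close> in the ball forces \<open>s\<close> to be
    non-negative.\<close>
  then have "z \<in> cball z s" by (simp add: order_trans[OF zero_le_dist])
  then obtain f where f: "f \<in> cball z s" "f \<in> frontier \<Omega>"
    using connected_Int_frontier[OF connected_cball, of z s \<Omega>] y assms(1) by blast
  then have "infdist z (A \<union> frontier \<Omega>) \<le> s"
    using infdist_le[of f "A \<union> frontier \<Omega>" z] by simp
  then show False using assms(2) by simp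
qed

text \<open>Trades "n large" for "\<epsilon> small": only finitely many indices beyond
  \<open>N\<close> are not large, and a threshold below all their positive values of \<epsilon>
  excludes them.\<close>

lemma small_imp_if_eventually:
  fixes \<epsilon> :: "nat \<Rightarrow> real"
  assumes "\<forall>n>N. \<epsilon> n > 0" "\<forall>\<^sub>F n in sequentially. P n"
  obtains e where "e > 0" "\<And>n. n > N \<Longrightarrow> \<epsilon> n < e \<Longrightarrow> P n"
proof -
  obtain n0 where n0: "\<And>n. n \<ge> n0 \<Longrightarrow> P n"
    using assms(2) by (auto simp: eventually_sequentially)
  define e where "e = Min (insert 1 (\<epsilon> ` {N<..<n0}))"
  have "e > 0" using assms(1) by (auto simp: e_def)
  moreover have "P n" if n: "n > N" "\<epsilon> n < e" for n
  proof (rule n0, rule ccontr)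
    assume "\<not> n \<ge> n0"
    then have "e \<le> \<epsilon> n" unfolding e_def using n by (intro Min_le) auto
    then show False using n by simp
  qed
  ultimately show ?thesis using that by blast
qed

lemma transport_rate_nonneg: "transport_rate d n \<ge> 0"
  by (simp add: transport_rate_def)

text \<open>The lower rate gives positivity of the displacement, the upper one, with slack 1, its
  comparison with the rate, and squaring the assumed limit brings in \<epsilon>^2.\<close>

lemma eventually_Linf_dist_id_small:
  fixes \<Omega> :: "(real^'n::finite) set"
  assumes T: "transported_samples \<Omega> \<rho> N x T" and pos: "\<forall>n>N. \<epsilon> n > 0"
    and lim: "(\<lambda>n. sqrt (transport_rate CARD('n) n) / \<epsilon> n) \<longlonglongrightarrow> 0" and m: "m > 0"
  shows "\<forall>\<^sub>F n in sequentially. 0 < Linf_dist_id \<Omega> (T n) \<and> Linf_dist_id \<Omega> (T n) \<le> m * (\<epsilon> n)^2"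
proof -
  let ?r = "transport_rate CARD('n)"
  obtain c c' where c: "c > 0" "c' > 0"
    "ereal c \<le> liminf (\<lambda>n. ereal (Linf_dist_id \<Omega> (T n) / ?r n))"
    "limsup (\<lambda>n. ereal (Linf_dist_id \<Omega> (T n) / ?r n)) \<le> ereal c'"
    using T unfolding transported_samples_def by blast
  have "ereal 0 < liminf (\<lambda>n. ereal (Linf_dist_id \<Omega> (T n) / ?r n))"
    using c(1,3) less_le_trans[of "ereal 0" "ereal c"] by simp
  then have e1: "\<forall>\<^sub>F n in sequentially. ereal 0 < ereal (Linf_dist_id \<Omega> (T n) / ?r n)"
    by (rule less_LiminfD)
  have "limsup (\<lambda>n. ereal (Linf_dist_id \<Omega> (T n) / ?r n)) < ereal (c' + 1)"
    using c(4) le_less_trans[of _ "ereal c'" "ereal (c' + 1)"] by simp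
  then have e2: "\<forall>\<^sub>F n in sequentially. ereal (Linf_dist_id \<Omega> (T n) / ?r n) < ereal (c' + 1)"
    by (rule Limsup_lessD)
  \<comment> \<open>Chosen so that (c' + 1) times the rate falls below
    \<open>m * (\<epsilon> n)^2\<close> after squaring.\<close>
  define \<theta> where "\<theta> = sqrt (m / (c' + 1))"
  have \<theta>: "\<theta> > 0" "\<theta>^2 = m / (c' + 1)" using m c by (auto simp: \<theta>_def)
  have e3: "\<forall>\<^sub>F n in sequentially. sqrt (?r n) / \<epsilon> n < \<theta>"
    using order_tendstoD(2)[OF lim \<theta>(1)] .
  show ?thesis
    using e1 e2 e3 eventually_gt_at_top[of N]
  proof eventually_elim
    case (elim n)
    have \<epsilon>: "\<epsilon> n > 0" using pos elim by blast
    \<comment> \<open>A vanishing rate would make the quotient 0, so its positivity yields that of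
      rate and displacement alike.\<close>
    have r: "?r n > 0" and l: "Linf_dist_id \<Omega> (T n) > 0"
      using elim(1) transport_rate_nonneg[of "CARD('n)" n] by (auto simp: zero_less_divide_iff)
    have "sqrt (?r n) < \<theta> * \<epsilon> n"
      using elim(3) \<epsilon> by (simp add: divide_less_eq)
    then have "sqrt (?r n)^2 \<le> (\<theta> * \<epsilon> n)^2"
      using r by (intro power_mono) auto
    then have "?r n \<le> m / (c' + 1) * (\<epsilon> n)^2"
      using r by (simp add: power_mult_distrib \<theta>)
    then have "(c' + 1) * ?r n \<le> (c' + 1) * (m / (c' + 1) * (\<epsilon> n)^2)"
      using c by (intro mult_left_mono) auto
    also have "\<dots> = m * (\<epsilon> n)^2" using c by simp
    finally have "(c' + 1) * ?r n \<le> m * (\<epsilon> n)^2" .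
    moreover have "Linf_dist_id \<Omega> (T n) < (c' + 1) * ?r n"
      using elim(2) r by (simp add: divide_less_eq)
    ultimately show ?case using l by simp
  qed
qed

context sampled_domain
begin

text \<open>\<open>B\<close> collects the part that still carries the gradient and is absorbed later
  by the threshold. Both constants are fixed from \<open>K\<close> before samples and function are
  introduced.\<close>

lemma L_discrete_minus_L_continuum_le:
  fixes K p :: real
  assumes \<rho>: "Ck_closure 2 \<Omega> \<rho>" and p: "p \<ge> 2"
  obtains C B :: real where "C \<ge> 0" "B \<ge> 0"
    "\<And>n x T \<delta> z \<epsilon> \<phi>. transported \<eta> \<Omega> \<rho> R n x T \<delta> \<Longrightarrow> Ck_closure 3 \<Omega> \<phi> \<Longrightarrow> Ck_norm 3 \<Omega> \<phi> = K
      \<Longrightarrow> 0 < \<epsilon> \<Longrightarrow> \<epsilon> \<le> 1 \<Longrightarrow> 0 < \<delta> \<Longrightarrow> \<delta> \<le> \<epsilon> \<Longrightarrow> kappa i1 \<eta> p = 0 \<or> 2 * \<delta> \<le> kappa i1 \<eta> p * \<epsilon>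
      \<Longrightarrow> cball z ((kappa i1 \<eta> p + 1) * \<epsilon>) \<subseteq> \<Omega> \<Longrightarrow> grad \<phi> z \<noteq> 0
      \<Longrightarrow> \<bar>L_discrete i1 \<eta> p x n \<epsilon> \<phi> z - L_continuum i1 \<eta> p \<rho> \<phi> z\<bar>
        \<le> C * \<epsilon> + C * \<delta> / \<epsilon>^2 + B * \<epsilon>^2 / (norm (grad \<phi> z))^2"
proof -
  define k where "k = kappa i1 \<eta> p"
  have k: "k \<ge> 0" using kappa_nonneg[OF p] by (simp add: k_def)
  obtain L where L: "L-lipschitz_on {0..} \<eta>"
    using admissible unfolding admissible_kernel_def by blast
  define d where "d = real CARD('n)"
  define K2 where "K2 = Ck_norm 2 \<Omega> \<rho>"
  define G a H c2 c3 V s2 where "G = d * K" and "a = d^2 * K" and "H = d * K2" and "c2 = d^2 * K2"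
    and "c3 = d^3 * K" and "V = 2 ^ (CARD('n) + 1) * R * unit_ball_vol CARD('n)" and "s2 = sigma2 TYPE('n) \<eta>"
  define A1 where "A1 = 2 * c3 * (k + 1)^3 * V + 2 * s2 * (2 * (G + a * (k + 1)) * (k + 1) * c2 + 2 * a * (k + 1)^2 * H)"
  define A2 where "A2 = 8 * (G + a * (k + 1)) * V
        + (L * (2 * (G + a * (k + 1)) * (k + 1)) + 2 * (2 * (G + a * (k + 1)))
            + 2 ^ (CARD('n) + 1) * real CARD('n) * (2 * (G + a * (k + 1)) * (k + 1))) * R * unit_ball_vol CARD('n)"
  define A3 where "A3 = 16 * R * s2 * a^3 * (k + 1)^4"
  have \<rho>_diff: "\<And>is x. length is < 2 \<Longrightarrow> x \<in> \<Omega> \<Longrightarrow> iter_partial is \<rho> differentiable (at x)"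
    using \<rho> by (auto simp: Ck_closure_def)
  have \<rho>_le: "\<And>is x. length is \<le> 2 \<Longrightarrow> x \<in> \<Omega> \<Longrightarrow> \<bar>iter_partial is \<rho> x\<bar> \<le> K2"
    unfolding K2_def using abs_iter_partial_le_Ck_norm[OF \<rho> bounded_\<Omega>] .
  show ?thesis
  \<comment> \<open>\<open>K\<close> is an arbitrary real here, known to be non-negative only once
    some function has it as norm; the absolute values secure the signs beforehand.\<close>
  proof (rule that[of "\<bar>A1\<bar> + \<bar>A2\<bar>" "\<bar>A3\<bar>"])
    fix n x T \<delta> z \<epsilon> \<phi>
    assume tr: "transported \<eta> \<Omega> \<rho> R n x T \<delta>" and \<phi>: "Ck_closure 3 \<Omega> \<phi>" and K: "Ck_norm 3 \<Omega> \<phi> = K"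
      and \<epsilon>: "0 < \<epsilon>" "\<epsilon> \<le> 1" and \<delta>: "0 < \<delta>" "\<delta> \<le> \<epsilon>" "kappa i1 \<eta> p = 0 \<or> 2 * \<delta> \<le> kappa i1 \<eta> p * \<epsilon>"
      and sub: "cball z ((kappa i1 \<eta> p + 1) * \<epsilon>) \<subseteq> \<Omega>" and g: "grad \<phi> z \<noteq> 0"
    interpret transported \<eta> i1 \<Omega> \<rho> R n x T \<delta> by (rule tr)
    have \<phi>_diff: "\<And>is x. length is < 3 \<Longrightarrow> x \<in> \<Omega> \<Longrightarrow> iter_partial is \<phi> differentiable (at x)"
      using \<phi> by (auto simp: Ck_closure_def)
    have \<phi>_le: "\<And>is x. length is \<le> 3 \<Longrightarrow> x \<in> \<Omega> \<Longrightarrow> \<bar>iter_partial is \<phi> x\<bar> \<le> K"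
      using abs_iter_partial_le_Ck_norm[OF \<phi> bounded_\<Omega>] unfolding K .
    have z: "z \<in> \<Omega>"
      using sub k \<epsilon> by (auto simp: k_def)
    have seg: "z + t *\<^sub>R w \<in> \<Omega>" if "0 \<le> t" "t \<le> 1" "norm w \<le> (k + 1) * \<epsilon>" for t w
    proof -
      have "norm (t *\<^sub>R w) \<le> 1 * norm w"
        using that unfolding norm_scaleR by (intro mult_right_mono) auto
      then have "z + t *\<^sub>R w \<in> cball z ((k + 1) * \<epsilon>)"
        using that by (simp add: dist_norm)
      then show ?thesis using sub unfolding k_def by blast
    qed
    have K0: "0 \<le> K" using \<phi>_le[of "[]" z] z by (simp add: order_trans[OF abs_ge_zero])
    have K20: "0 \<le> K2" using \<rho>_le[of "[]" z] z by (simp add: order_trans[OF abs_ge_zero])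
    have e1: "\<epsilon> \<le> (k + 1) * \<epsilon>" using k \<epsilon> by (simp add: algebra_simps)
    have form: "bounded_form (hessian_form \<phi> z) a"
      unfolding a_def d_def using \<phi>_le[of "[_, _]" z] z
      by (intro bounded_form_hessian) (simp add: iter_partial_def)
    define S where "S = (\<Sum>j=1..n. cut_kernel CARD('n) \<eta> \<epsilon> (norm (z - x j)) * (ball_max x n (k * \<epsilon>) \<phi> (x j) + ball_min x n (k * \<epsilon>) \<phi> (x j) - 2 * \<phi> z)) / real n"
    define \<tau> where "\<tau> = \<rho> z * (2 * sigma1 i1 \<eta> * (\<Sum>i\<in>UNIV. partial i (partial i \<phi>) z)
        + k^2 * hessian_form \<phi> z (sgn (grad \<phi> z)) (sgn (grad \<phi> z)) * (2 * s2))
      + 4 * sigma1 i1 \<eta> * (grad \<phi> z \<bullet> grad \<rho> z)"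
    have est: "\<bar>S - \<epsilon>^2 * \<tau>\<bar> \<le> A1 * \<epsilon>^3 + A2 * \<delta> + A3 * (\<epsilon>^4 / (norm (grad \<phi> z))^2)"
      unfolding S_def \<tau>_def A1_def A2_def A3_def V_def s2_def
    proof (rule average_ball_midrange_estimate[OF form g _ \<epsilon> k \<delta>[folded k_def] L sub[folded k_def]])
      show "norm (grad \<phi> z) \<le> G"
        unfolding G_def d_def using \<phi>_le[of "[_]" z] z
        by (intro norm_grad_le) (simp add: iter_partial_def)
      show "norm (grad \<rho> z) \<le> H"
        unfolding H_def d_def using \<rho>_le[of "[_]" z] z
        by (intro norm_grad_le) (simp add: iter_partial_def)
      show "has_bochner_integral lborel (\<lambda>u. weight u * hessian_form \<phi> z u u) (2 * sigma1 i1 \<eta> * (\<Sum>i\<in>UNIV. partial i (partial i \<phi>) z))"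
        unfolding hessian_form_def by (rule has_bochner_integral_weight_form)
      show "0 \<le> c3" "0 \<le> c2" using K0 K20 by (simp_all add: c3_def c2_def d_def)
      show "\<bar>\<phi> y - \<phi> z - quadratic (grad \<phi> z) (hessian_form \<phi> z) (y - z)\<bar> \<le> c3 * norm (y - z) ^ 3"
        if "norm (y - z) \<le> (k + 1) * \<epsilon>" for y
        using Taylor_order_3[of z "y - z" \<Omega> \<phi> K, OF seg \<phi>_diff \<phi>_le] that
        by (simp add: c3_def d_def quadratic_def hessian_form_def algebra_simps)
      show "\<bar>\<rho> y - \<rho> z - grad \<rho> z \<bullet> (y - z)\<bar> \<le> c2 * norm (y - z) ^ 2" if "norm (y - z) \<le> \<epsilon>" for y
        using Taylor_order_2[of z "y - z" \<Omega> \<rho> K2, OF seg \<rho>_diff \<rho>_le] that e1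
        by (simp add: c2_def d_def)
    qed
    have disc: "L_discrete i1 \<eta> p x n \<epsilon> \<phi> z = S / (2 * \<epsilon>^2)"
      by (simp add: L_discrete_def S_def k_def)
    have cont: "L_continuum i1 \<eta> p \<rho> \<phi> z = \<tau> / 2"
      unfolding \<tau>_def k_def s2_def using z \<rho>_pos \<rho>_diff[of "[]" z] \<phi>_diff[of "[_]" z]
      by (intro L_continuum_eq) (auto simp: iter_partial_def)
    have "\<bar>L_discrete i1 \<eta> p x n \<epsilon> \<phi> z - L_continuum i1 \<eta> p \<rho> \<phi> z\<bar> = \<bar>(S - \<epsilon>^2 * \<tau>) / (2 * \<epsilon>^2)\<bar>"
      unfolding disc cont using \<epsilon> by (simp add: field_simps)
    also have "\<dots> = \<bar>S - \<epsilon>^2 * \<tau>\<bar> / (2 * \<epsilon>^2)"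
      using \<epsilon> by simp
    also have "\<dots> \<le> (\<bar>A1\<bar> * \<epsilon>^3 + \<bar>A2\<bar> * \<delta> + \<bar>A3\<bar> * (\<epsilon>^4 / (norm (grad \<phi> z))^2)) / (2 * \<epsilon>^2)"
    proof (rule divide_right_mono)
      have "A1 * \<epsilon>^3 \<le> \<bar>A1\<bar> * \<epsilon>^3" "A2 * \<delta> \<le> \<bar>A2\<bar> * \<delta>"
        "A3 * (\<epsilon>^4 / (norm (grad \<phi> z))^2) \<le> \<bar>A3\<bar> * (\<epsilon>^4 / (norm (grad \<phi> z))^2)"
        using \<epsilon> \<delta> by (intro mult_right_mono abs_ge_self; simp)+
      then show "\<bar>S - \<epsilon>^2 * \<tau>\<bar> \<le> \<bar>A1\<bar> * \<epsilon>^3 + \<bar>A2\<bar> * \<delta> + \<bar>A3\<bar> * (\<epsilon>^4 / (norm (grad \<phi> z))^2)"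
        using est by linarith
    qed simp
    also have "\<dots> = (\<bar>A1\<bar> * \<epsilon> + \<bar>A2\<bar> * \<delta> / \<epsilon>^2 + \<bar>A3\<bar> * \<epsilon>^2 / (norm (grad \<phi> z))^2) / 2"
      using \<epsilon> g by (simp add: field_simps eval_nat_numeral)
    also have "\<dots> \<le> \<bar>A1\<bar> * \<epsilon> + \<bar>A2\<bar> * \<delta> / \<epsilon>^2 + \<bar>A3\<bar> * \<epsilon>^2 / (norm (grad \<phi> z))^2"
    proof -
      have half: "s / 2 \<le> s" if "0 \<le> s" for s :: real
        using that by simp
      show ?thesis
        using \<epsilon> \<delta> by (intro half add_nonneg_nonneg) simp_all
    qed
    also have "\<dots> \<le> (\<bar>A1\<bar> + \<bar>A2\<bar>) * \<epsilon> + (\<bar>A1\<bar> + \<bar>A2\<bar>) * \<delta> / \<epsilon>^2 + \<bar>A3\<bar> * \<epsilon>^2 / (norm (grad \<phi> z))^2"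
      using \<epsilon> \<delta> by (intro add_mono divide_right_mono mult_right_mono) auto
    finally show "\<bar>L_discrete i1 \<eta> p x n \<epsilon> \<phi> z - L_continuum i1 \<eta> p \<rho> \<phi> z\<bar>
        \<le> (\<bar>A1\<bar> + \<bar>A2\<bar>) * \<epsilon> + (\<bar>A1\<bar> + \<bar>A2\<bar>) * \<delta> / \<epsilon>^2 + \<bar>A3\<bar> * \<epsilon>^2 / (norm (grad \<phi> z))^2" .
  qed auto
qed

text \<open>The range of \<open>T n\<close> consists of finitely many samples and is therefore
  bounded, so the displacement norm really is an almost sure bound.\<close>

lemma transported_Linf_dist_id:
  assumes T: "transported_samples \<Omega> \<rho> N x T" and n: "n > N"
  shows "transported \<eta> \<Omega> \<rho> R n x (T n) (Linf_dist_id \<Omega> (T n))"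
proof unfold_locales
  have Tn: "T n ` \<Omega> \<subseteq> x ` {1..n}" "T n \<in> measurable \<mu> borel" "distr \<mu> borel (T n) = empirical_measure x n"
    using T n unfolding transported_samples_def by auto
  show "1 \<le> n" using n by simp
  show "T n ` \<Omega> \<subseteq> x ` {1..n}" "T n \<in> measurable \<mu> borel" "distr \<mu> borel (T n) = empirical_measure x n"
    by (fact Tn)+
  have "T n \<in> borel_measurable (restrict_space lborel \<Omega>)"
    using Tn(2) measurable_cong_sets[OF sets_\<mu> refl] by blast
  moreover have "bounded (T n ` \<Omega>)"
    using Tn(1) by (rule bounded_subset[rotated]) (simp add: finite_imp_bounded)
  ultimately show "AE y in \<mu>. norm (y - T n y) \<le> Linf_dist_id \<Omega> (T n)"
    unfolding AE_\<mu>_iff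
    by (intro AE_norm_diff_le_Linf_dist_id open_\<Omega> bounded_\<Omega> \<Omega>_nonempty)
qed

end

theorem lemma9:
  fixes \<Omega> :: "(real^'n::finite) set" and \<rho> :: "real^'n \<Rightarrow> real"
    and \<eta> :: "real \<Rightarrow> real" and p :: real and i1 :: 'n
  assumes "CARD('n) \<ge> 2"
    and "open \<Omega>" "bounded \<Omega>" "connected \<Omega>" "C1_boundary \<Omega>"
    and "Ck_closure 2 \<Omega> \<rho>" "\<forall>y\<in>closure \<Omega>. \<rho> y > 0" "prob_space (density_measure \<Omega> \<rho>)"
    and "admissible_kernel \<eta>"
    and "p \<ge> 2"
  shows "\<exists>C :: real \<Rightarrow> real.
    \<forall>(N :: nat) (x :: nat \<Rightarrow> real^'n) (T :: nat \<Rightarrow> real^'n \<Rightarrow> real^'n) (\<epsilon> :: nat \<Rightarrow> real)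
      (\<phi> :: real^'n \<Rightarrow> real).
      N \<ge> 1 \<longrightarrow>
      transported_samples \<Omega> \<rho> N x T \<longrightarrow>
      (\<forall>n>N. \<epsilon> n > 0) \<longrightarrow>
      \<epsilon> \<longlonglongrightarrow> 0 \<longrightarrow>
      (\<lambda>n. sqrt (transport_rate CARD('n) n) / \<epsilon> n) \<longlonglongrightarrow> 0 \<longrightarrow>
      Ck_closure 3 \<Omega> \<phi> \<longrightarrow>
      (\<exists>\<epsilon>0 :: real \<Rightarrow> real. (\<forall>g>0. \<epsilon>0 g > 0) \<and>
        (\<forall>n>N. \<forall>i\<in>{1..n}.
          infdist (x i) (x ` {1..N} \<union> frontier \<Omega>) > (kappa i1 \<eta> p + 1) * \<epsilon> n \<longrightarrow>
          grad \<phi> (x i) \<noteq> 0 \<longrightarrow>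
          \<epsilon> n < \<epsilon>0 (norm (grad \<phi> (x i))) \<longrightarrow>
          \<bar>L_discrete i1 \<eta> p x n (\<epsilon> n) \<phi> (x i) - L_continuum i1 \<eta> p \<rho> \<phi> (x i)\<bar>
            \<le> C (Ck_norm 3 \<Omega> \<phi>) * \<epsilon> n
              + C (Ck_norm 3 \<Omega> \<phi>) * Linf_dist_id \<Omega> (T n) / (\<epsilon> n)^2))"
proof -
  define R where "R = Ck_norm 2 \<Omega> \<rho>"
  have R: "\<rho> y \<le> R" if "y \<in> \<Omega>" for y
    using abs_iter_partial_le_Ck_norm[OF assms(6,3), of "[]" y] that by (simp add: R_def iter_partial_def)
  have "continuous_on (closure \<Omega>) \<rho>"
    using assms(6) unfolding Ck_closure_def by (rule conjunct1)
  then interpret sampled_domain \<eta> i1 \<Omega> \<rho> R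
    by (rule sampled_domain.intro[OF kernel.intro[OF assms(9)] sampled_domain_axioms.intro[OF assms(2,3) _ assms(7) R assms(8)]])
  let ?k = "kappa i1 \<eta> p"
  have k: "?k \<ge> 0" using kappa_nonneg[OF assms(10)] .
  have "\<exists>C B. \<forall>K. C K \<ge> 0 \<and> B K \<ge> 0 \<and>
    (\<forall>n x T \<delta> z \<epsilon> \<phi>. transported \<eta> \<Omega> \<rho> R n x T \<delta> \<longrightarrow> Ck_closure 3 \<Omega> \<phi> \<longrightarrow> Ck_norm 3 \<Omega> \<phi> = K
      \<longrightarrow> 0 < \<epsilon> \<longrightarrow> \<epsilon> \<le> 1 \<longrightarrow> 0 < \<delta> \<longrightarrow> \<delta> \<le> \<epsilon> \<longrightarrow> ?k = 0 \<or> 2 * \<delta> \<le> ?k * \<epsilon>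
      \<longrightarrow> cball z ((?k + 1) * \<epsilon>) \<subseteq> \<Omega> \<longrightarrow> grad \<phi> z \<noteq> 0
      \<longrightarrow> \<bar>L_discrete i1 \<eta> p x n \<epsilon> \<phi> z - L_continuum i1 \<eta> p \<rho> \<phi> z\<bar>
        \<le> C K * \<epsilon> + C K * \<delta> / \<epsilon>^2 + B K * \<epsilon>^2 / (norm (grad \<phi> z))^2)"
    (is "\<exists>C B. \<forall>K. ?P K (C K) (B K)")
  proof -
    \<comment> \<open>Both constants depend on \<open>K\<close>; as a pair they become functions by
      a single choice.\<close>
    have "\<forall>K. \<exists>c. ?P K (fst c) (snd c)"
    proof
      fix K
      obtain C B where "?P K C B"
        by (rule L_discrete_minus_L_continuum_le[OF assms(6,10), of K]) blast
      then show "\<exists>c. ?P K (fst c) (snd c)" by (intro exI[of _ "(C, B)"]) simp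
    qed
    then obtain c where "\<forall>K. ?P K (fst (c K)) (snd (c K))" by (rule choice[THEN exE])
    then show ?thesis by (intro exI[of _ "\<lambda>K. fst (c K)"] exI[of _ "\<lambda>K. snd (c K)"])
  qed
  then obtain C B where CB: "\<And>K. C K \<ge> 0" "\<And>K. B K \<ge> 0"
    and main: "\<And>n x T \<delta> z \<epsilon> \<phi>. transported \<eta> \<Omega> \<rho> R n x T \<delta> \<Longrightarrow> Ck_closure 3 \<Omega> \<phi>
      \<Longrightarrow> 0 < \<epsilon> \<Longrightarrow> \<epsilon> \<le> 1 \<Longrightarrow> 0 < \<delta> \<Longrightarrow> \<delta> \<le> \<epsilon> \<Longrightarrow> ?k = 0 \<or> 2 * \<delta> \<le> ?k * \<epsilon>
      \<Longrightarrow> cball z ((?k + 1) * \<epsilon>) \<subseteq> \<Omega> \<Longrightarrow> grad \<phi> z \<noteq> 0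
      \<Longrightarrow> \<bar>L_discrete i1 \<eta> p x n \<epsilon> \<phi> z - L_continuum i1 \<eta> p \<rho> \<phi> z\<bar>
        \<le> C (Ck_norm 3 \<Omega> \<phi>) * \<epsilon> + C (Ck_norm 3 \<Omega> \<phi>) * \<delta> / \<epsilon>^2 + B (Ck_norm 3 \<Omega> \<phi>) * \<epsilon>^2 / (norm (grad \<phi> z))^2"
    by metis
  show ?thesis
  \<comment> \<open>The added 1 takes up the gradient term, which the threshold makes at most
    \<epsilon>.\<close>
  proof (rule exI[of _ "\<lambda>K. C K + 1"], intro allI impI)
    fix N x T \<epsilon> \<phi>
    assume N: "1 \<le> N" and T: "transported_samples \<Omega> \<rho> N x T" and \<epsilon>: "\<forall>n>N. 0 < \<epsilon> n"
      and lim: "(\<lambda>n. sqrt (transport_rate CARD('n) n) / \<epsilon> n) \<longlonglongrightarrow> 0" and \<phi>: "Ck_closure 3 \<Omega> \<phi>"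
    let ?K = "Ck_norm 3 \<Omega> \<phi>"
    \<comment> \<open>With \<epsilon> at most 1, a displacement below
      \<open>m * (\<epsilon> n)^2\<close> is below both \<epsilon> and, for positive
      \<open>?k\<close>, half of the radius \<open>?k * \<epsilon> n\<close>.\<close>
    define m where "m = (if ?k = 0 then 1 else min 1 (?k / 2))"
    have m: "m > 0" "m \<le> 1" "?k = 0 \<or> 2 * m \<le> ?k" using k by (auto simp: m_def)
    obtain e where e: "e > 0" "\<And>n. n > N \<Longrightarrow> \<epsilon> n < e \<Longrightarrow>
        0 < Linf_dist_id \<Omega> (T n) \<and> Linf_dist_id \<Omega> (T n) \<le> m * (\<epsilon> n)^2"
      using small_imp_if_eventually[OF \<epsilon> eventually_Linf_dist_id_small[OF T \<epsilon> lim m(1)]] by metis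
    \<comment> \<open>In turn: 1 for the Taylor constants, \<open>e\<close> for a small
      displacement, and the last entry for the gradient term, with 1 added to \<open>B ?K\<close> to
      keep the denominator positive.\<close>
    define \<epsilon>0 where "\<epsilon>0 g = min (min 1 e) (g^2 / (B ?K + 1))" for g
    show "\<exists>\<epsilon>0. (\<forall>g>0. 0 < \<epsilon>0 g) \<and>
        (\<forall>n>N. \<forall>i\<in>{1..n}.
          (?k + 1) * \<epsilon> n < infdist (x i) (x ` {1..N} \<union> frontier \<Omega>) \<longrightarrow>
          grad \<phi> (x i) \<noteq> 0 \<longrightarrow>
          \<epsilon> n < \<epsilon>0 (norm (grad \<phi> (x i))) \<longrightarrow>
          \<bar>L_discrete i1 \<eta> p x n (\<epsilon> n) \<phi> (x i) - L_continuum i1 \<eta> p \<rho> \<phi> (x i)\<bar>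
            \<le> (C ?K + 1) * \<epsilon> n + (C ?K + 1) * Linf_dist_id \<Omega> (T n) / (\<epsilon> n)^2)"
    proof (intro exI[of _ \<epsilon>0] conjI allI impI ballI)
      show "0 < \<epsilon>0 g" if "0 < g" for g
        using that e(1) CB(2)[of ?K] by (simp add: \<epsilon>0_def)
      fix n i
      assume n: "N < n" and i: "i \<in> {1..n}"
        and inf: "(?k + 1) * \<epsilon> n < infdist (x i) (x ` {1..N} \<union> frontier \<Omega>)"
        and g: "grad \<phi> (x i) \<noteq> 0" and small: "\<epsilon> n < \<epsilon>0 (norm (grad \<phi> (x i)))"
      define \<delta> where "\<delta> = Linf_dist_id \<Omega> (T n)"
      have \<epsilon>n: "0 < \<epsilon> n" "\<epsilon> n \<le> 1" "\<epsilon> n < e" "\<epsilon> n < (norm (grad \<phi> (x i)))^2 / (B ?K + 1)"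
        using small \<epsilon> n by (auto simp: \<epsilon>0_def)
      have "(\<epsilon> n)^2 \<le> \<epsilon> n"
        using \<epsilon>n by (simp add: power2_eq_square mult_left_le)
      then have "m * (\<epsilon> n)^2 \<le> m * \<epsilon> n"
        using m by (intro mult_left_mono) auto
      then have \<delta>: "0 < \<delta>" "\<delta> \<le> m * \<epsilon> n"
        using e(2)[OF n \<epsilon>n(3)] by (auto simp: \<delta>_def)
      have \<delta>1: "\<delta> \<le> \<epsilon> n"
        using \<delta>(2) mult_right_mono[OF m(2) less_imp_le[OF \<epsilon>n(1)]] by linarith
      have \<delta>2: "?k = 0 \<or> 2 * \<delta> \<le> ?k * \<epsilon> n"
        using m(3)
      proof
        assume "2 * m \<le> ?k"
        then have "2 * m * \<epsilon> n \<le> ?k * \<epsilon> n"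
          using \<epsilon>n by (intro mult_right_mono) auto
        then show ?thesis using \<delta>(2) by linarith
      qed blast
      have xi: "x i \<in> \<Omega>"
        using T i by (auto simp: transported_samples_def)
      have "\<bar>L_discrete i1 \<eta> p x n (\<epsilon> n) \<phi> (x i) - L_continuum i1 \<eta> p \<rho> \<phi> (x i)\<bar>
        \<le> C ?K * \<epsilon> n + C ?K * \<delta> / (\<epsilon> n)^2 + B ?K * (\<epsilon> n)^2 / (norm (grad \<phi> (x i)))^2"
        using transported_Linf_dist_id[OF T n] \<epsilon>n \<delta> \<delta>1 \<delta>2 g cball_subset_of_infdist_frontier[OF xi inf]
        unfolding \<delta>_def[symmetric] by (intro main[OF _ \<phi>]) auto
      also have "B ?K * (\<epsilon> n)^2 / (norm (grad \<phi> (x i)))^2 \<le> \<epsilon> n"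
      proof -
        have "B ?K * \<epsilon> n \<le> (B ?K + 1) * \<epsilon> n" using \<epsilon>n by simp
        also have "\<dots> \<le> (norm (grad \<phi> (x i)))^2"
          using \<epsilon>n(4) CB(2)[of ?K] by (simp add: pos_less_divide_eq mult.commute)
        finally have "B ?K * \<epsilon> n * \<epsilon> n \<le> (norm (grad \<phi> (x i)))^2 * \<epsilon> n"
          using \<epsilon>n by (intro mult_right_mono) auto
        then show ?thesis
          using g by (simp add: pos_divide_le_eq power2_eq_square mult_ac)
      qed
      also have "C ?K * \<epsilon> n + C ?K * \<delta> / (\<epsilon> n)^2 + \<epsilon> n \<le> (C ?K + 1) * \<epsilon> n + (C ?K + 1) * \<delta> / (\<epsilon> n)^2"
        using \<delta> \<epsilon>n by (simp add: algebra_simps add_divide_distrib)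
      finally show "\<bar>L_discrete i1 \<eta> p x n (\<epsilon> n) \<phi> (x i) - L_continuum i1 \<eta> p \<rho> \<phi> (x i)\<bar>
            \<le> (C ?K + 1) * \<epsilon> n + (C ?K + 1) * Linf_dist_id \<Omega> (T n) / (\<epsilon> n)^2"
        by (simp add: \<delta>_def)
    qed
  qed
qed

end
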